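(* Let $\Omega\subset\mathbb{C}$ be a bounded simply connected domain whose boundary $\Gamma=\partial\Omega$ is a Liapunov curve, and let $a,b\in L_\infty(\Omega;\mathbb{B})$. If $$\max\{\|a\|_{L_\infty(\Omega;\mathbb{B})},\|b\|_{L_\infty(\Omega;\mathbb{B})}\}<\frac{1}{2\sqrt{2}\operatorname{diam}(\Omega)},$$ then the following orthogonal decomposition holds: $$L_2(\Omega;\mathbb{B})=\mathcal{A}_{(a,b)}^2(\Omega;\mathbb{B})\oplus\left(\boldsymbol{\partial}+a^{\dagger}+b^*\mathbf{C}_{\mathbb{B}}\right)W_0^{1,2}(\Omega;\mathbb{B}).$$
   Context: $\mathbb{B}=\{u+\mathbf{j}v : u,v\in\mathbb{C}\}$ is the commutative $\mathbb{C}$-algebra of bicomplex numbers, with $\mathbf{j}^2=-1$ and $i\mathbf{j}=\mathbf{j}i$. With $^*$ the complex conjugation on $\mathbb{C}$, for $W=u+\mathbf{j}v$: $\operatorname{Sc}W=u$, $\operatorname{Vec}W=v$, $\overline{W}=u-\mathbf{j}v$, $|W|_{\mathbb{B}}=\sqrt{|u|^2+|v|^2}$, $W^\dagger=u^*-\mathbf{j}v^*$, and for the coefficient $b$, $b^*:=(\operatorname{Sc}b)^*+\mathbf{j}(\operatorname{Vec}b)^*$. $\mathbf{C}_{\mathbb{B}}W=\overline{W}$. $\langle W,V\rangle_{\mathbb{B}}=(\operatorname{Sc}W)(\operatorname{Sc}V)^*+(\operatorname{Vec}W)(\operatorname{Vec}V)^*$. A function $F:\Omega\to\mathbb{B}$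 belongs to $\mathscr{F}(\Omega;\mathbb{B})$ (for a space $\mathscr{F}(\Omega)$ of complex-valued functions) iff $\operatorname{Sc}F,\operatorname{Vec}F\in\mathscr{F}(\Omega)$. $\|F\|_{L_\infty(\Omega;\mathbb{B})}=\operatorname{ess\,sup}_\Omega|F|_{\mathbb{B}}$; $L_2(\Omega;\mathbb{B})$ is a complex Hilbert space with $\langle F,G\rangle=\iint_\Omega\langle F(z),G(z)\rangle_{\mathbb{B}}\,dA_z$. With $z=x+iy$: $\boldsymbol{\partial}=\frac12\left(\frac{\partial}{\partial x}-\mathbf{j}\frac{\partial}{\partial y}\right)$, $\overline{\boldsymbol{\partial}}=\frac12\left(\frac{\partial}{\partial x}+\mathbf{j}\frac{\partial}{\partial y}\right)$. A function $V\in L_{1,loc}(\Omega;\mathbb{B})$ is the weak $\overline{\boldsymbol{\partial}}$-derivative of $W$ if $\iint_\Omega W\,\overline{\boldsymbol{\partial}}\phi\,dA=-\iint_\Omega V\phi\,dA$ for all $\phi\in C_0^\infty(\Omega;\mathbb{B})$; similarly for $\boldsymbol{\partial}$. $\mathcal{A}_{(a,b)}^2(\Omega;\mathbb{B})$ is the set of all weak solutions $W\in L_2(\Omega;\mathbb{B})$ of $\overline{\boldsymbol{\partial}}W=aW+b\overline{W}$ in $\Omega$. A closed Jordan curve $\Gamma$ is a Liapunov curve if it is of class $C^1$ and the angle between the tangent to $\Gamma$ at $z\in\Gamma$ and the positive real axis is a Hölder continuous function of $z$. *)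

theory Defs
  imports "HOL-Analysis.Analysis" "HOL-Probability.Essential_Supremum"
begin

section \<open>Bicomplex numbers\<close>

text \<open>\<open>Bicomplex u v\<close> stands for \<open>u + \<j> v\<close>, where \<open>\<j>\<close> is a second imaginary unit commuting with \<open>\<i>\<close>.\<close>

datatype bicomplex = Bicomplex (Sc: complex) (Vec: complex)

lemma bicomplex_eq_iff: "W = V \<longleftrightarrow> Sc W = Sc V \<and> Vec W = Vec V"
  by (cases W; cases V) simp

instantiation bicomplex :: comm_ring_1
begin

definition "0 = Bicomplex 0 0"
definition "1 = Bicomplex 1 0"
definition "W + V = Bicomplex (Sc W + Sc V) (Vec W + Vec V)"
definition "- W = Bicomplex (- Sc W) (- Vec W)"
definition "W - V = Bicomplex (Sc W - Sc V) (Vec W - Vec V)"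
definition "W * V = Bicomplex (Sc W * Sc V - Vec W * Vec V) (Sc W * Vec V + Vec W * Sc V)"

instance
  by standard
    (simp_all add: bicomplex_eq_iff zero_bicomplex_def one_bicomplex_def plus_bicomplex_def
      uminus_bicomplex_def minus_bicomplex_def times_bicomplex_def algebra_simps)

end

lemma Sc_Vec_simps [simp]:
  "Sc 0 = 0" "Vec 0 = 0" "Sc 1 = 1" "Vec 1 = 0"
  "Sc (W + V) = Sc W + Sc V" "Vec (W + V) = Vec W + Vec V"
  "Sc (- W) = - Sc W" "Vec (- W) = - Vec W"
  "Sc (W - V) = Sc W - Sc V" "Vec (W - V) = Vec W - Vec V"
  "Sc (W * V) = Sc W * Sc V - Vec W * Vec V" "Vec (W * V) = Sc W * Vec V + Vec W * Sc V"
  by (simp_all add: zero_bicomplex_def one_bicomplex_def plus_bicomplex_def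
      uminus_bicomplex_def minus_bicomplex_def times_bicomplex_def)

instantiation bicomplex :: real_algebra_1
begin

definition "scaleR r W = Bicomplex (r *\<^sub>R Sc W) (r *\<^sub>R Vec W)"

instance
  by standard (simp_all add: scaleR_bicomplex_def bicomplex_eq_iff algebra_simps)

end

lemma Sc_Vec_scaleR [simp]: "Sc (r *\<^sub>R W) = r *\<^sub>R Sc W" "Vec (r *\<^sub>R W) = r *\<^sub>R Vec W"
  by (simp_all add: scaleR_bicomplex_def)

text \<open>The real inner product below is the real part of the \<open>\<complex>\<close>-valued one, \<open>bc_inner\<close>.\<close>

instantiation bicomplex :: real_inner
begin

definition norm_bicomplex_def: "norm W = sqrt ((cmod (Sc W))\<^sup>2 + (cmod (Vec W))\<^sup>2)"
definition inner_bicomplex_def: "inner W V = inner (Sc W) (Sc V) + inner (Vec W) (Vec V)"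
definition sgn_bicomplex_def: "sgn W = W /\<^sub>R norm W" for W :: bicomplex
definition dist_bicomplex_def: "dist W V = norm (W - V)" for W V :: bicomplex
definition uniformity_bicomplex_def:
  "(uniformity :: (bicomplex \<times> bicomplex) filter) = (INF e\<in>{0 <..}. principal {(x, y). dist x y < e})"
definition open_bicomplex_def:
  "open (U :: bicomplex set) \<longleftrightarrow> (\<forall>x\<in>U. eventually (\<lambda>(x', y). x' = x \<longrightarrow> y \<in> U) uniformity)"

instance
proof
  fix x y z :: bicomplex and r :: real
  show "inner x y = inner y x"
    by (simp add: inner_bicomplex_def inner_commute)
  show "inner (x + y) z = inner x z + inner y z"
    by (simp add: inner_bicomplex_def inner_add_left)
  show "inner (scaleR r x) y = r * inner x y"
    by (simp add: inner_bicomplex_def distrib_left)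
  show "0 \<le> inner x x"
    by (simp add: inner_bicomplex_def)
  show "inner x x = 0 \<longleftrightarrow> x = 0"
    by (simp add: inner_bicomplex_def bicomplex_eq_iff add_nonneg_eq_0_iff)
  show "norm x = sqrt (inner x x)"
    by (simp add: norm_bicomplex_def inner_bicomplex_def power2_norm_eq_inner)
qed (rule sgn_bicomplex_def dist_bicomplex_def uniformity_bicomplex_def open_bicomplex_def)+

end

instantiation bicomplex :: euclidean_space
begin

definition Basis_bicomplex_def:
  "Basis = {Bicomplex 1 0, Bicomplex \<i> 0, Bicomplex 0 1, Bicomplex 0 \<i>}"

instance
proof
  show "(Basis :: bicomplex set) \<noteq> {}" "finite (Basis :: bicomplex set)"
    by (simp_all add: Basis_bicomplex_def)
next
  fix u v :: bicomplex
  assume "u \<in> Basis" and "v \<in> Basis"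
  thus "inner u v = (if u = v then 1 else 0)"
    unfolding Basis_bicomplex_def by (elim insertE emptyE; simp add: inner_bicomplex_def)
next
  fix x :: bicomplex
  show "(\<forall>u\<in>Basis. inner x u = 0) \<longleftrightarrow> x = 0"
    by (cases x) (simp add: Basis_bicomplex_def inner_bicomplex_def zero_bicomplex_def complex_eq_iff)
qed

end

definition bc_j :: bicomplex where
  "bc_j = Bicomplex 0 1"

definition bc_bar :: "bicomplex \<Rightarrow> bicomplex" where
  "bc_bar W = Bicomplex (Sc W) (- Vec W)"

definition bc_dagger :: "bicomplex \<Rightarrow> bicomplex" where
  "bc_dagger W = Bicomplex (cnj (Sc W)) (- cnj (Vec W))"

definition bc_star :: "bicomplex \<Rightarrow> bicomplex" where
  "bc_star W = Bicomplex (cnj (Sc W)) (cnj (Vec W))"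

definition bc_inner :: "bicomplex \<Rightarrow> bicomplex \<Rightarrow> complex" where
  "bc_inner W V = Sc W * cnj (Sc V) + Vec W * cnj (Vec V)"


section \<open>Function spaces\<close>

text \<open>
  Functions on \<open>\<Omega>\<close> are represented by total functions on \<open>\<complex>\<close>; their values outside \<open>\<Omega>\<close> are
  irrelevant, except that test functions are extended by zero. Elements of the Lebesgue and
  Sobolev spaces are functions rather than classes of functions, so equality in these spaces
  is equality almost everywhere on \<open>\<Omega>\<close>.
\<close>

definition bc_valued :: "(complex \<Rightarrow> complex) set \<Rightarrow> (complex \<Rightarrow> bicomplex) set" where
  "bc_valued S = {F. (\<lambda>z. Sc (F z)) \<in> S \<and> (\<lambda>z. Vec (F z)) \<in> S}"

text \<open>With \<open>\<complex>\<close> as \<open>\<real>\<^sup>2\<close>, the directions \<open>1\<close> and \<open>\<i>\<close> give the partial derivatives in \<open>x\<close> and \<open>y\<close>.\<close>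

definition partial_deriv :: "complex \<Rightarrow> (complex \<Rightarrow> 'a::real_normed_vector) \<Rightarrow> complex \<Rightarrow> 'a" where
  "partial_deriv e f z = frechet_derivative f (at z) e"

primrec C_k :: "nat \<Rightarrow> (complex \<Rightarrow> 'a::real_normed_vector) \<Rightarrow> bool" where
  "C_k 0 f \<longleftrightarrow> continuous_on UNIV f"
| "C_k (Suc k) f \<longleftrightarrow> f differentiable_on UNIV \<and> C_k k (partial_deriv 1 f) \<and> C_k k (partial_deriv \<i> f)"

definition test_funs :: "complex set \<Rightarrow> (complex \<Rightarrow> complex) set" where
  "test_funs \<Omega> = {\<phi>. (\<forall>k. C_k k \<phi>) \<and> compact (closure {z. \<phi> z \<noteq> 0}) \<and> closure {z. \<phi> z \<noteq> 0} \<subseteq> \<Omega>}"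

definition L1_loc :: "complex set \<Rightarrow> (complex \<Rightarrow> complex) set" where
  "L1_loc \<Omega> = {f \<in> borel_measurable (lebesgue_on \<Omega>).
     \<forall>K. compact K \<and> K \<subseteq> \<Omega> \<longrightarrow> integrable (lebesgue_on K) f}"

definition L2 :: "complex set \<Rightarrow> (complex \<Rightarrow> complex) set" where
  "L2 \<Omega> = {f \<in> borel_measurable (lebesgue_on \<Omega>).
     integrable (lebesgue_on \<Omega>) (\<lambda>z. (cmod (f z))\<^sup>2)}"

definition L2_norm :: "complex set \<Rightarrow> (complex \<Rightarrow> complex) \<Rightarrow> real" where
  "L2_norm \<Omega> f = sqrt (LINT z|lebesgue_on \<Omega>. (cmod (f z))\<^sup>2)"

definition L_infty :: "complex set \<Rightarrow> (complex \<Rightarrow> complex) set" where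
  "L_infty \<Omega> = {f \<in> borel_measurable (lebesgue_on \<Omega>).
     esssup (lebesgue_on \<Omega>) (\<lambda>z. ereal (cmod (f z))) < \<infinity>}"

definition bc_L_infty_norm :: "complex set \<Rightarrow> (complex \<Rightarrow> bicomplex) \<Rightarrow> ereal" where
  "bc_L_infty_norm \<Omega> F = esssup (lebesgue_on \<Omega>) (\<lambda>z. ereal (norm (F z)))"

definition bc_L2_inner :: "complex set \<Rightarrow> (complex \<Rightarrow> bicomplex) \<Rightarrow> (complex \<Rightarrow> bicomplex) \<Rightarrow> complex" where
  "bc_L2_inner \<Omega> F G = (LINT z|lebesgue_on \<Omega>. bc_inner (F z) (G z))"

definition has_weak_partial ::
  "complex \<Rightarrow> complex set \<Rightarrow> (complex \<Rightarrow> complex) \<Rightarrow> (complex \<Rightarrow> complex) \<Rightarrow> bool" where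
  "has_weak_partial e \<Omega> f g \<longleftrightarrow> f \<in> L1_loc \<Omega> \<and> g \<in> L1_loc \<Omega> \<and>
     (\<forall>\<phi>\<in>test_funs \<Omega>. (LINT z|lebesgue_on \<Omega>. f z * partial_deriv e \<phi> z)
                     = - (LINT z|lebesgue_on \<Omega>. g z * \<phi> z))"

text \<open>The closure of the test functions in the Sobolev space \<open>W\<^sup>1\<^sup>,\<^sup>2(\<Omega>)\<close>.\<close>

definition W12_0 :: "complex set \<Rightarrow> (complex \<Rightarrow> complex) set" where
  "W12_0 \<Omega> = {f \<in> L2 \<Omega>. \<exists>fx\<in>L2 \<Omega>. \<exists>fy\<in>L2 \<Omega>.
     has_weak_partial 1 \<Omega> f fx \<and> has_weak_partial \<i> \<Omega> f fy \<and>
     (\<exists>\<phi>. (\<forall>n. \<phi> n \<in> test_funs \<Omega>) \<and>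
        (\<lambda>n. L2_norm \<Omega> (\<lambda>z. \<phi> n z - f z)) \<longlonglongrightarrow> 0 \<and>
        (\<lambda>n. L2_norm \<Omega> (\<lambda>z. partial_deriv 1 (\<phi> n) z - fx z)) \<longlonglongrightarrow> 0 \<and>
        (\<lambda>n. L2_norm \<Omega> (\<lambda>z. partial_deriv \<i> (\<phi> n) z - fy z)) \<longlonglongrightarrow> 0)}"


section \<open>Bicomplex Cauchy--Riemann operators and the Vekua equation\<close>

definition bc_d :: "(complex \<Rightarrow> bicomplex) \<Rightarrow> complex \<Rightarrow> bicomplex" where
  "bc_d F z = (1/2) *\<^sub>R (partial_deriv 1 F z - bc_j * partial_deriv \<i> F z)"

definition bc_dbar :: "(complex \<Rightarrow> bicomplex) \<Rightarrow> complex \<Rightarrow> bicomplex" where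
  "bc_dbar F z = (1/2) *\<^sub>R (partial_deriv 1 F z + bc_j * partial_deriv \<i> F z)"

definition has_weak_d :: "complex set \<Rightarrow> (complex \<Rightarrow> bicomplex) \<Rightarrow> (complex \<Rightarrow> bicomplex) \<Rightarrow> bool" where
  "has_weak_d \<Omega> W V \<longleftrightarrow> W \<in> bc_valued (L1_loc \<Omega>) \<and> V \<in> bc_valued (L1_loc \<Omega>) \<and>
     (\<forall>\<phi>\<in>bc_valued (test_funs \<Omega>). (LINT z|lebesgue_on \<Omega>. W z * bc_d \<phi> z)
                                = - (LINT z|lebesgue_on \<Omega>. V z * \<phi> z))"

definition has_weak_dbar :: "complex set \<Rightarrow> (complex \<Rightarrow> bicomplex) \<Rightarrow> (complex \<Rightarrow> bicomplex) \<Rightarrow> bool" where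
  "has_weak_dbar \<Omega> W V \<longleftrightarrow> W \<in> bc_valued (L1_loc \<Omega>) \<and> V \<in> bc_valued (L1_loc \<Omega>) \<and>
     (\<forall>\<phi>\<in>bc_valued (test_funs \<Omega>). (LINT z|lebesgue_on \<Omega>. W z * bc_dbar \<phi> z)
                                = - (LINT z|lebesgue_on \<Omega>. V z * \<phi> z))"

definition vekua_bergman ::
  "complex set \<Rightarrow> (complex \<Rightarrow> bicomplex) \<Rightarrow> (complex \<Rightarrow> bicomplex) \<Rightarrow> (complex \<Rightarrow> bicomplex) set" where
  "vekua_bergman \<Omega> a b = {W \<in> bc_valued (L2 \<Omega>).
     has_weak_dbar \<Omega> W (\<lambda>z. a z * W z + b z * bc_bar (W z))}"

text \<open>
  The image of \<open>W\<^sub>0\<^sup>1\<^sup>,\<^sup>2\<close> under \<open>\<partial> + a\<^sup>\<dagger> + b\<^sup>* C\<close>, where \<open>C\<close> is the bar conjugation and \<open>U\<close> is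
  the weak derivative \<open>\<partial>V\<close>; as a set of functions it is closed under equality almost everywhere.
\<close>

definition adjoint_range ::
  "complex set \<Rightarrow> (complex \<Rightarrow> bicomplex) \<Rightarrow> (complex \<Rightarrow> bicomplex) \<Rightarrow> (complex \<Rightarrow> bicomplex) set" where
  "adjoint_range \<Omega> a b = {G. \<exists>V\<in>bc_valued (W12_0 \<Omega>). \<exists>U. has_weak_d \<Omega> V U \<and>
     (AE z in lebesgue_on \<Omega>. G z = U z + bc_dagger (a z) * V z + bc_star (b z) * bc_bar (V z))}"


section \<open>Orthogonal decompositions\<close>

definition complex_subspace :: "(complex \<Rightarrow> bicomplex) set \<Rightarrow> bool" where
  "complex_subspace A \<longleftrightarrow> (\<lambda>z. 0) \<in> A \<and> (\<forall>F\<in>A. \<forall>G\<in>A. (\<lambda>z. F z + G z) \<in> A) \<and>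
     (\<forall>c. \<forall>F\<in>A. (\<lambda>z. Bicomplex c 0 * F z) \<in> A)"

text \<open>\<open>L\<^sub>2(\<Omega>; \<bool>) = A \<oplus> B\<close> with \<open>A\<close> orthogonal to \<open>B\<close>, for sets \<open>A\<close> and \<open>B\<close> of representatives.\<close>

definition L2_orthogonal_sum ::
  "complex set \<Rightarrow> (complex \<Rightarrow> bicomplex) set \<Rightarrow> (complex \<Rightarrow> bicomplex) set \<Rightarrow> bool" where
  "L2_orthogonal_sum \<Omega> A B \<longleftrightarrow>
     A \<subseteq> bc_valued (L2 \<Omega>) \<and> B \<subseteq> bc_valued (L2 \<Omega>) \<and>
     complex_subspace A \<and> complex_subspace B \<and>
     (\<forall>W\<in>A. \<forall>G\<in>B. bc_L2_inner \<Omega> W G = 0) \<and>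
     (\<forall>F\<in>bc_valued (L2 \<Omega>). \<exists>W\<in>A. \<exists>G\<in>B.
        (AE z in lebesgue_on \<Omega>. F z = W z + G z) \<and>
        (\<forall>W'\<in>A. \<forall>G'\<in>B. (AE z in lebesgue_on \<Omega>. F z = W' z + G' z) \<longrightarrow>
           (AE z in lebesgue_on \<Omega>. W' z = W z) \<and> (AE z in lebesgue_on \<Omega>. G' z = G z)))"


section \<open>Liapunov curves\<close>

text \<open>
  \<open>\<theta> z\<close> is an angle from the positive real axis to the tangent at \<open>z\<close>. It is determined only modulo
  \<open>2\<pi>\<close> and turns once around along the curve, so Hoelder continuity is understood modulo \<open>2\<pi>\<close>.
\<close>

definition liapunov_curve :: "complex set \<Rightarrow> bool" where
  "liapunov_curve \<Gamma> \<longleftrightarrow> (\<exists>\<gamma> \<gamma>' \<theta> C \<alpha>.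
     simple_path \<gamma> \<and> pathfinish \<gamma> = pathstart \<gamma> \<and> path_image \<gamma> = \<Gamma> \<and>
     (\<forall>t\<in>{0..1}. (\<gamma> has_vector_derivative \<gamma>' t) (at t within {0..1}) \<and> \<gamma>' t \<noteq> 0) \<and>
     continuous_on {0..1} \<gamma>' \<and> \<gamma>' 0 = \<gamma>' 1 \<and>
     (\<forall>t\<in>{0..1}. \<gamma>' t = of_real (cmod (\<gamma>' t)) * cis (\<theta> (\<gamma> t))) \<and>
     0 < \<alpha> \<and> \<alpha> \<le> 1 \<and>
     (\<forall>z\<in>\<Gamma>. \<forall>w\<in>\<Gamma>. \<exists>k::int. \<bar>\<theta> z - \<theta> w - 2 * pi * of_int k\<bar> \<le> C * dist z w powr \<alpha>))"

end

theory Submission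
  imports Defs
begin

text \<open>
  The operator \<open>D = \<partial> + a\<^sup>\<dagger> + b\<^sup>* C\<close> on test functions is the adjoint of the Vekua operator: since
  \<open>\<langle>W, V\<rangle> = Sc (W V\<^sup>\<dagger>)\<close>, orthogonality of \<open>W\<close> to \<open>D \<phi>\<close> for all test functions \<open>\<phi>\<close> is exactly the weak
  Vekua equation for \<open>W\<close>. Everything else is the closedness of the range of \<open>D\<close> on \<open>W\<^sub>0\<^sup>1\<^sup>,\<^sup>2\<close>. A
  Poincare inequality with the factor \<open>d\<^sup>2 / 2\<close>, \<open>d = diam \<Omega>\<close>, for each of the two partial
  derivatives, together with \<open>4 \<parallel>\<partial>\<phi>\<parallel>\<^sup>2 = \<parallel>\<phi>\<^sub>x\<parallel>\<^sup>2 + \<parallel>\<phi>\<^sub>y\<parallel>\<^sup>2\<close>, gives \<open>\<parallel>\<phi>\<parallel> \<le> d \<parallel>\<partial>\<phi>\<parallel>\<close>. As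
  \<open>|W V| \<le> \<surd>2 |W| |V|\<close>, the lower order terms are bounded by \<open>2 \<surd>2 K d \<parallel>\<partial>\<phi>\<parallel>\<close>, where \<open>K\<close> bounds the
  coefficients, and the hypothesis makes this factor smaller than \<open>1\<close>. So \<open>\<parallel>D \<phi>\<parallel>\<close> controls the
  Sobolev norm of \<open>\<phi>\<close>, and the projection of a function onto the closure of the range of \<open>D\<close> is
  attained in \<open>W\<^sub>0\<^sup>1\<^sup>,\<^sup>2\<close>.
\<close>


section \<open>Square integrable functions\<close>

text \<open>Because of the bar conjugation, the operator \<open>adj\<close> is in general linear
  only over the complex numbers, not over the bicomplex ones. The projection is therefore carried
  out in the real Hilbert space with inner product Re <.,.>. The way back from a vanishing real part
  to the full weak equation uses that test functions may be multiplied by bicomplex constants. The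
  projection is a limit of values \<open>adj (\<Phi> n)\<close>. Applied to differences of the
  \<Phi> n, the coercive estimate makes the \<Phi> n themselves Cauchy together with their first
  derivatives, and this is what places the limit in the range. A second obstacle is that
  \<open>adjoint_range\<close> admits any weak derivative of V, whereas an approximating sequence
  yields a particular one. Identifying the two requires uniqueness of weak derivatives, that is, the
  fundamental lemma of the calculus of variations; it is obtained from Stone-Weierstrass and bump
  functions, without mollification. Integration by parts likewise rests only on translation
  invariance of the Lebesgue integral and difference quotients.\<close>

lemma tendsto_0_squeeze:
  fixes f g :: "nat \<Rightarrow> real"
  assumes "g \<longlonglongrightarrow> 0" "\<And>n. 0 \<le> f n" "\<And>n. f n \<le> g n"
  shows "f \<longlonglongrightarrow> 0"
  by (rule tendsto_sandwich[OF _ _ tendsto_const assms(1)]) (use assms in auto)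

text \<open>Values in an arbitrary Euclidean space let one theory cover complex components,
  bicomplex functions and their partial derivatives. Functions are not identified almost everywhere,
  so \<open>sq_norm\<close> is only a seminorm.\<close>

definition sq_integrable :: "'b measure \<Rightarrow> ('b \<Rightarrow> 'a::euclidean_space) \<Rightarrow> bool" where
  "sq_integrable M f \<longleftrightarrow> f \<in> borel_measurable M \<and> integrable M (\<lambda>x. (norm (f x))\<^sup>2)"

definition sq_norm :: "'b measure \<Rightarrow> ('b \<Rightarrow> 'a::euclidean_space) \<Rightarrow> real" where
  "sq_norm M f = sqrt (\<integral>x. (norm (f x))\<^sup>2 \<partial>M)"

lemma sq_integrable_measurable: "sq_integrable M f \<Longrightarrow> f \<in> borel_measurable M"
  by (simp add: sq_integrable_def)

lemma sq_norm_nonneg [simp]: "0 \<le> sq_norm M f"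
  by (simp add: sq_norm_def)

lemma sq_norm_power2: "(sq_norm M f)\<^sup>2 = (\<integral>x. (norm (f x))\<^sup>2 \<partial>M)"
  by (simp add: sq_norm_def)

lemma sq_norm_minus_commute: "sq_norm M (\<lambda>x. f x - g x) = sq_norm M (\<lambda>x. g x - f x)"
  by (simp add: sq_norm_def norm_minus_commute)

text \<open>The factor 1/2 is given up, since only domination matters. With \<open>y = 1\<close> the
  same inequality bounds |f| by 1 + |f|^2.\<close>

lemma norm_mult_le_sum_squares: "norm x * norm y \<le> (norm x)\<^sup>2 + (norm y)\<^sup>2"
  for x :: "'a::real_normed_vector" and y :: "'b::real_normed_vector"
proof -
  have "2 * norm x * norm y \<le> (norm x)\<^sup>2 + (norm y)\<^sup>2" "0 \<le> norm x * norm y"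
    by (auto simp: sum_squares_bound)
  thus ?thesis by linarith
qed

lemma sq_integrable_norm_mult:
  assumes "sq_integrable M f" "sq_integrable M g"
  shows "integrable M (\<lambda>x. norm (f x) * norm (g x))"
proof (rule Bochner_Integration.integrable_bound)
  show "integrable M (\<lambda>x. (norm (f x))\<^sup>2 + (norm (g x))\<^sup>2)"
    using assms by (auto simp: sq_integrable_def)
  show "(\<lambda>x. norm (f x) * norm (g x)) \<in> borel_measurable M"
    using assms by (auto simp: sq_integrable_def)
  show "AE x in M. norm (norm (f x) * norm (g x)) \<le> norm ((norm (f x))\<^sup>2 + (norm (g x))\<^sup>2)"
    using norm_mult_le_sum_squares by auto
qed

text \<open>Cauchy-Schwarz with the norms inside the integral, so that every bounded bilinear
  product inherits it and not only the inner product.\<close>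

lemma integral_norm_mult_le:
  assumes f: "sq_integrable M f" and g: "sq_integrable M g"
  shows "(\<integral>x. norm (f x) * norm (g x) \<partial>M) \<le> sq_norm M f * sq_norm M g"
proof -
  have [measurable]: "f \<in> borel_measurable M" "g \<in> borel_measurable M"
    using assms by (auto simp: sq_integrable_def)
  have "(\<integral>\<^sup>+x. ennreal (norm (f x)) * ennreal (norm (g x)) \<partial>M)\<^sup>2
      \<le> (\<integral>\<^sup>+x. ennreal (norm (f x)) ^ 2 \<partial>M) * (\<integral>\<^sup>+x. ennreal (norm (g x)) ^ 2 \<partial>M)"
    by (rule Cauchy_Schwarz_nn_integral) auto
  also have "(\<integral>\<^sup>+x. ennreal (norm (f x)) * ennreal (norm (g x)) \<partial>M)
      = ennreal (\<integral>x. norm (f x) * norm (g x) \<partial>M)"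
    by (subst ennreal_mult[symmetric], simp, simp, rule nn_integral_eq_integral)
       (auto intro: sq_integrable_norm_mult assms)
  also have "(\<integral>\<^sup>+x. ennreal (norm (f x)) ^ 2 \<partial>M) = ennreal ((sq_norm M f)\<^sup>2)"
    using f by (simp add: ennreal_power sq_norm_power2 sq_integrable_def nn_integral_eq_integral)
  also have "(\<integral>\<^sup>+x. ennreal (norm (g x)) ^ 2 \<partial>M) = ennreal ((sq_norm M g)\<^sup>2)"
    using g by (simp add: ennreal_power sq_norm_power2 sq_integrable_def nn_integral_eq_integral)
  finally have "(\<integral>x. norm (f x) * norm (g x) \<partial>M)\<^sup>2 \<le> (sq_norm M f * sq_norm M g)\<^sup>2"
    by (simp add: ennreal_power ennreal_mult[symmetric] power_mult_distrib)
  thus ?thesis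
    by (rule power2_le_imp_le) simp
qed

lemma sq_integrable_bounded_by:
  assumes "f \<in> borel_measurable M" "sq_integrable M g" "AE x in M. norm (f x) \<le> K * norm (g x)"
  shows "sq_integrable M f"
  unfolding sq_integrable_def
proof
  show "integrable M (\<lambda>x. (norm (f x))\<^sup>2)"
  proof (rule Bochner_Integration.integrable_bound)
    show "integrable M (\<lambda>x. K\<^sup>2 * (norm (g x))\<^sup>2)"
      using assms by (auto simp: sq_integrable_def)
    show "(\<lambda>x. (norm (f x))\<^sup>2) \<in> borel_measurable M"
      using assms by auto
    show "AE x in M. norm ((norm (f x))\<^sup>2) \<le> norm (K\<^sup>2 * (norm (g x))\<^sup>2)"
      using assms(3)
    proof eventually_elim
      case (elim x)
      hence "(norm (f x))\<^sup>2 \<le> (K * norm (g x))\<^sup>2" by (intro power_mono) auto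
      thus ?case by (simp add: power_mult_distrib)
    qed
  qed
qed fact

lemma sq_norm_bounded_by:
  assumes "f \<in> borel_measurable M" "sq_integrable M g" "AE x in M. norm (f x) \<le> K * norm (g x)" "0 \<le> K"
  shows "sq_norm M f \<le> K * sq_norm M g"
proof -
  have f: "sq_integrable M f" using sq_integrable_bounded_by assms(1-3) by blast
  have "(\<integral>x. (norm (f x))\<^sup>2 \<partial>M) \<le> (\<integral>x. K\<^sup>2 * (norm (g x))\<^sup>2 \<partial>M)"
  proof (rule integral_mono_AE)
    show "AE x in M. (norm (f x))\<^sup>2 \<le> K\<^sup>2 * (norm (g x))\<^sup>2"
      using assms(3)
    proof eventually_elim
      case (elim x)
      hence "(norm (f x))\<^sup>2 \<le> (K * norm (g x))\<^sup>2" by (intro power_mono) auto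
      thus ?case by (simp add: power_mult_distrib)
    qed
  qed (use f assms(2) in \<open>auto simp: sq_integrable_def\<close>)
  hence "(sq_norm M f)\<^sup>2 \<le> (K * sq_norm M g)\<^sup>2"
    by (simp add: sq_norm_power2 power_mult_distrib)
  thus ?thesis by (rule power2_le_imp_le) (simp add: assms(4))
qed

lemma sq_integrable_zero [simp]: "sq_integrable M (\<lambda>x. 0)"
  by (simp add: sq_integrable_def)

lemma sq_integrable_add:
  assumes f: "sq_integrable M f" and g: "sq_integrable M g"
  shows "sq_integrable M (\<lambda>x. f x + g x)"
  unfolding sq_integrable_def
proof
  show m: "(\<lambda>x. f x + g x) \<in> borel_measurable M"
    using assms by (auto simp: sq_integrable_def)
  show "integrable M (\<lambda>x. (norm (f x + g x))\<^sup>2)"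
  proof (rule Bochner_Integration.integrable_bound)
    show "integrable M (\<lambda>x. 2 * ((norm (f x))\<^sup>2 + (norm (g x))\<^sup>2))"
      using assms by (auto simp: sq_integrable_def)
    show "(\<lambda>x. (norm (f x + g x))\<^sup>2) \<in> borel_measurable M"
      using m by auto
    have "(norm (f x + g x))\<^sup>2 \<le> 2 * ((norm (f x))\<^sup>2 + (norm (g x))\<^sup>2)" for x
    proof -
      have "(norm (f x + g x))\<^sup>2 \<le> (norm (f x) + norm (g x))\<^sup>2"
        by (intro power_mono norm_triangle_ineq) auto
      also have "\<dots> \<le> 2 * ((norm (f x))\<^sup>2 + (norm (g x))\<^sup>2)"
        using sum_squares_bound[of "norm (f x)" "norm (g x)"] by (simp add: power2_sum)
      finally show ?thesis .
    qed
    thus "AE x in M. norm ((norm (f x + g x))\<^sup>2) \<le> norm (2 * ((norm (f x))\<^sup>2 + (norm (g x))\<^sup>2))"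
      by (auto simp: abs_of_nonneg)
  qed
qed

lemma sq_integrable_bounded_linear:
  assumes "bounded_linear T" "sq_integrable M f"
  shows "sq_integrable M (\<lambda>x. T (f x))"
proof -
  obtain K where "\<And>x. norm (T x) \<le> norm x * K"
    using bounded_linear.bounded[OF assms(1)] by blast
  moreover have "(\<lambda>x. T (f x)) \<in> borel_measurable M"
    using borel_measurable_continuous_on[OF linear_continuous_on[OF assms(1)] sq_integrable_measurable[OF assms(2)]] .
  ultimately show ?thesis
    using assms(2) by (rule_tac sq_integrable_bounded_by[where g=f and K=K]) (auto simp: mult.commute)
qed

lemma sq_integrable_scaleR: "sq_integrable M f \<Longrightarrow> sq_integrable M (\<lambda>x. c *\<^sub>R f x)"
  by (rule sq_integrable_bounded_linear[OF bounded_linear_scaleR_right])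

lemma sq_integrable_diff:
  "sq_integrable M f \<Longrightarrow> sq_integrable M g \<Longrightarrow> sq_integrable M (\<lambda>x. f x - g x)"
  using sq_integrable_add[of M f "\<lambda>x. (-1) *\<^sub>R g x"] sq_integrable_scaleR[of M g "-1"] by simp

text \<open>Domination by the product of the norms treats all products at once: the real inner
  product, complex and bicomplex multiplication, and \<open>bc_inner\<close>, which is bilinear over
  the reals.\<close>

lemma sq_integrable_bilinear:
  assumes p: "bounded_bilinear p" and "sq_integrable M f" "sq_integrable M g"
  shows "integrable M (\<lambda>x. p (f x) (g x) :: 'c::euclidean_space)"
proof -
  interpret bounded_bilinear p by fact
  obtain K where K: "\<And>x y. norm (p x y) \<le> norm x * norm y * K" using bounded by blast
  have "integrable M (\<lambda>x. K * (norm (f x) * norm (g x)))"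
    using sq_integrable_norm_mult[OF assms(2,3)] by auto
  moreover have "(\<lambda>x. p (f x) (g x)) \<in> borel_measurable M"
    by (rule borel_measurable_continuous_Pair[OF sq_integrable_measurable[OF assms(2)]
          sq_integrable_measurable[OF assms(3)]])
      (intro continuous_on continuous_on_fst continuous_on_snd continuous_on_id)
  moreover have "norm (p (f x) (g x)) \<le> norm (K * (norm (f x) * norm (g x)))" for x
    using K[of "f x" "g x"] by (simp add: mult.commute abs_le_iff)
  ultimately show ?thesis
    by (rule_tac Bochner_Integration.integrable_bound[where f="\<lambda>x. K * (norm (f x) * norm (g x))"]) auto
qed

lemma sq_integrable_inner:
  "sq_integrable M f \<Longrightarrow> sq_integrable M g \<Longrightarrow> integrable M (\<lambda>x. f x \<bullet> g x)"
  by (rule sq_integrable_bilinear[OF bounded_bilinear_inner])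

lemma norm_integral_bilinear_le:
  fixes p :: "'a::euclidean_space \<Rightarrow> 'b::euclidean_space \<Rightarrow> 'c::euclidean_space"
  assumes p: "bounded_bilinear p" and f: "sq_integrable M f" and g: "sq_integrable M g"
    and K: "\<And>x y. norm (p x y) \<le> K * (norm x * norm y)" "0 \<le> K"
  shows "norm (\<integral>x. p (f x) (g x) \<partial>M) \<le> K * (sq_norm M f * sq_norm M g)"
proof -
  have "norm (\<integral>x. p (f x) (g x) \<partial>M) \<le> (\<integral>x. norm (p (f x) (g x)) \<partial>M)"
    by (rule integral_norm_bound)
  also have "\<dots> \<le> (\<integral>x. K * (norm (f x) * norm (g x)) \<partial>M)"
    using K integrable_norm[OF sq_integrable_bilinear[OF p f g]] sq_integrable_norm_mult[OF f g]
    by (intro integral_mono) auto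
  also have "\<dots> \<le> K * (sq_norm M f * sq_norm M g)"
    using K(2) integral_norm_mult_le[OF f g] by (simp add: mult_left_mono)
  finally show ?thesis .
qed

lemma abs_integral_inner_le:
  assumes "sq_integrable M f" "sq_integrable M g"
  shows "\<bar>\<integral>x. f x \<bullet> g x \<partial>M\<bar> \<le> sq_norm M f * sq_norm M g"
  using norm_integral_bilinear_le[OF bounded_bilinear_inner assms, of 1]
  by (simp add: Cauchy_Schwarz_ineq2)

text \<open>Convergence in norm of one factor with the other one fixed is enough for the limits
  below: weak identities and orthogonality pass in this way from test functions to their Sobolev
  limits.\<close>

lemma tendsto_integral_bilinear:
  fixes p :: "_ \<Rightarrow> _ \<Rightarrow> 'c::euclidean_space"
  assumes p: "bounded_bilinear p" and f: "sq_integrable M f" "\<And>n. sq_integrable M (u n)"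
    and g: "sq_integrable M g" and lim: "(\<lambda>n. sq_norm M (\<lambda>x. u n x - f x)) \<longlonglongrightarrow> 0"
  shows "(\<lambda>n. \<integral>x. p (u n x) (g x) \<partial>M) \<longlonglongrightarrow> (\<integral>x. p (f x) (g x) \<partial>M)"
proof -
  interpret bounded_bilinear p by fact
  obtain K where K: "0 \<le> K" "\<And>x y. norm (p x y) \<le> norm x * norm y * K"
    using nonneg_bounded by blast
  have "norm ((\<integral>x. p (u n x) (g x) \<partial>M) - (\<integral>x. p (f x) (g x) \<partial>M))
      \<le> K * (sq_norm M (\<lambda>x. u n x - f x) * sq_norm M g)" for n
  proof -
    have "(\<integral>x. p (u n x) (g x) \<partial>M) - (\<integral>x. p (f x) (g x) \<partial>M) = (\<integral>x. p (u n x - f x) (g x) \<partial>M)"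
      by (simp add: diff_left sq_integrable_bilinear p f g)
    thus ?thesis
      using norm_integral_bilinear_le[OF p sq_integrable_diff[OF f(2) f(1)] g, of K n] K
      by (simp add: mult.commute)
  qed
  moreover have "(\<lambda>n. K * (sq_norm M (\<lambda>x. u n x - f x) * sq_norm M g)) \<longlonglongrightarrow> 0"
    using tendsto_mult_right_zero[OF tendsto_mult_left_zero[OF lim]] by auto
  ultimately have "(\<lambda>n. (\<integral>x. p (u n x) (g x) \<partial>M) - (\<integral>x. p (f x) (g x) \<partial>M)) \<longlonglongrightarrow> 0"
    by (rule_tac Lim_null_comparison[where g="\<lambda>n. K * (sq_norm M (\<lambda>x. u n x - f x) * sq_norm M g)"]) auto
  thus ?thesis by (simp add: LIM_zero_iff)
qed

lemma integral_norm_add_power2: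
  assumes f: "sq_integrable M f" and g: "sq_integrable M g"
  shows "(\<integral>x. (norm (f x + g x))\<^sup>2 \<partial>M)
    = (\<integral>x. (norm (f x))\<^sup>2 \<partial>M) + 2 * (\<integral>x. f x \<bullet> g x \<partial>M) + (\<integral>x. (norm (g x))\<^sup>2 \<partial>M)"
proof -
  have "(norm (f x + g x))\<^sup>2 = (norm (f x))\<^sup>2 + 2 * (f x \<bullet> g x) + (norm (g x))\<^sup>2" for x
    by (simp add: power2_norm_eq_inner inner_add inner_commute)
  thus ?thesis
    using assms sq_integrable_inner[OF f g] by (simp add: sq_integrable_def)
qed

lemma sq_norm_triangle:
  assumes f: "sq_integrable M f" and g: "sq_integrable M g"
  shows "sq_norm M (\<lambda>x. f x + g x) \<le> sq_norm M f + sq_norm M g"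
proof -
  have "(sq_norm M (\<lambda>x. f x + g x))\<^sup>2 \<le> (sq_norm M f + sq_norm M g)\<^sup>2"
    using abs_integral_inner_le[OF f g]
    by (simp add: integral_norm_add_power2[OF f g] sq_norm_power2 power2_sum)
  thus ?thesis by (rule power2_le_imp_le) simp
qed

lemma sq_norm_scaleR: "sq_norm M (\<lambda>x. c *\<^sub>R f x) = \<bar>c\<bar> * sq_norm M f"
  by (simp add: sq_norm_def power_mult_distrib real_sqrt_mult)

lemma sq_norm_triangle3:
  assumes f: "sq_integrable M f" and g: "sq_integrable M g" and h: "sq_integrable M h"
  shows "sq_norm M (\<lambda>x. f x - h x) \<le> sq_norm M (\<lambda>x. f x - g x) + sq_norm M (\<lambda>x. g x - h x)"
  using sq_norm_triangle[OF sq_integrable_diff[OF f g] sq_integrable_diff[OF g h]] by simp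

lemma sq_norm_eq_0_imp_AE:
  assumes "sq_integrable M f" "sq_norm M f = 0"
  shows "AE x in M. f x = 0"
  using assms integral_nonneg_eq_0_iff_AE[of M "\<lambda>x. (norm (f x))\<^sup>2"]
  by (simp add: sq_norm_def sq_integrable_def)

section \<open>Completeness\<close>

definition sq_Cauchy :: "'b measure \<Rightarrow> (nat \<Rightarrow> 'b \<Rightarrow> 'a::euclidean_space) \<Rightarrow> bool" where
  "sq_Cauchy M u \<longleftrightarrow> (\<forall>e>0. \<exists>N. \<forall>m\<ge>N. \<forall>n\<ge>N. sq_norm M (\<lambda>x. u m x - u n x) < e)"

text \<open>A subsequence with geometrically small increments \<open>d\<^sub>k\<close> converges almost everywhere, because
  \<open>|d\<^sub>k| \<le> 2\<^sup>-\<^sup>k + 2\<^sup>k |d\<^sub>k|\<^sup>2\<close> and the squares have summable integrals; Fatou's lemma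
  then turns the almost everywhere limit into a limit in norm.\<close>

lemma sq_Cauchy_AE_convergent:
  assumes u: "\<And>n. sq_integrable M (u n)" and C: "sq_Cauchy M u"
  obtains s :: "nat \<Rightarrow> nat" where "strict_mono s" "AE x in M. convergent (\<lambda>k. u (s k) x)"
proof -
  have "\<forall>k. \<exists>N. \<forall>m\<ge>N. \<forall>n\<ge>N. sq_norm M (\<lambda>x. u m x - u n x) < (1/2)^k"
    using C unfolding sq_Cauchy_def by (metis zero_less_power zero_less_divide_1_iff zero_less_numeral)
  then obtain N where N: "\<And>k m n. N k \<le> m \<Longrightarrow> N k \<le> n \<Longrightarrow> sq_norm M (\<lambda>x. u m x - u n x) < (1/2)^k"
    by metis
  obtain s where s: "strict_mono s" "\<And>k. s k \<ge> N k"
  proof -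
    have "\<exists>s. \<forall>k. N k \<le> s k \<and> s k < s (Suc k)"
    proof (rule dependent_nat_choice)
      show "\<exists>x. N 0 \<le> x" by blast
      show "\<And>x n. N n \<le> x \<Longrightarrow> \<exists>y. N (Suc n) \<le> y \<and> x < y"
        by (metis max.cobounded1 max.cobounded2 Suc_le_eq)
    qed
    then obtain s where "\<forall>k. N k \<le> s k \<and> s k < s (Suc k)" by blast
    thus ?thesis using that[of s] by (auto simp: strict_mono_Suc_iff)
  qed
  define d where "d k x = u (s (Suc k)) x - u (s k) x" for k x
  have d: "sq_integrable M (d k)" for k
    unfolding d_def by (intro sq_integrable_diff u)
  hence [measurable]: "d k \<in> borel_measurable M" for k
    by (simp add: sq_integrable_def)
  \<comment> \<open>The squared increments are at most 4^(-k); against the weight 2^k this still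
    leaves the summable 2^(-k).\<close>
  have dn: "(sq_norm M (d k))\<^sup>2 \<le> (1/4)^k" for k
  proof -
    have "sq_norm M (d k) \<le> (1/2)^k"
      unfolding d_def
      using N[of k "s (Suc k)" "s k"] s(2)[of k] strict_monoD[OF s(1), of k "Suc k"]
      by (simp add: less_imp_le)
    hence "(sq_norm M (d k))\<^sup>2 \<le> ((1/2)^k)\<^sup>2" by (intro power_mono) auto
    also have "\<dots> = (1/4::real)^k"
      by (simp add: power_mult[symmetric] mult.commute[of k 2]) (simp add: power_mult power2_eq_square)
    finally show ?thesis .
  qed
  have "(\<integral>\<^sup>+x. (\<Sum>k. ennreal (2^k * (norm (d k x))\<^sup>2)) \<partial>M) = (\<Sum>k. (\<integral>\<^sup>+x. ennreal (2^k * (norm (d k x))\<^sup>2) \<partial>M))"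
    by (rule nn_integral_suminf) measurable
  also have "\<dots> \<le> (\<Sum>k. ennreal ((1/2)^k))"
  proof (rule suminf_le)
    fix k
    have "(\<integral>\<^sup>+x. ennreal (2^k * (norm (d k x))\<^sup>2) \<partial>M) = ennreal (2^k * (sq_norm M (d k))\<^sup>2)"
      using d[of k] by (subst nn_integral_eq_integral) (auto simp: sq_norm_power2 sq_integrable_def)
    also have "\<dots> \<le> ennreal (2^k * (1/4)^k)"
      using dn[of k] by (intro ennreal_leI mult_left_mono) auto
    also have "2^k * (1/4)^k = (1/2::real)^k"
      by (simp add: power_mult_distrib[symmetric])
    finally show "(\<integral>\<^sup>+x. ennreal (2^k * (norm (d k x))\<^sup>2) \<partial>M) \<le> ennreal ((1/2)^k)" .
  qed auto
  also have "\<dots> = ennreal (\<Sum>k. (1/2)^k)"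
    by (rule suminf_ennreal2) (auto intro: summable_geometric)
  also have "\<dots> < \<infinity>" by simp
  finally have "AE x in M. (\<Sum>k. ennreal (2^k * (norm (d k x))\<^sup>2)) \<noteq> \<infinity>"
    by (intro nn_integral_PInf_AE) auto
  hence "AE x in M. convergent (\<lambda>k. u (s k) x)"
  proof eventually_elim
    case (elim x)
    hence "summable (\<lambda>k. 2^k * (norm (d k x))\<^sup>2)"
      by (intro summable_suminf_not_top) auto
    hence "summable (\<lambda>k. (1/2)^k + 2^k * (norm (d k x))\<^sup>2)"
      by (intro summable_add summable_geometric) auto
    moreover have "norm (d k x) \<le> (1/2)^k + 2^k * (norm (d k x))\<^sup>2" for k
    proof -
      have "0 \<le> (1 - 2^k * norm (d k x))\<^sup>2" "0 \<le> 2^k * norm (d k x)" by simp_all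
      hence "2^k * norm (d k x) \<le> 1 + (2^k)\<^sup>2 * (norm (d k x))\<^sup>2"
        unfolding power2_diff power_mult_distrib one_power2 by linarith
      hence "(1/2)^k * (2^k * norm (d k x)) \<le> (1/2)^k * (1 + (2^k)\<^sup>2 * (norm (d k x))\<^sup>2)"
        by (intro mult_left_mono) auto
      thus ?thesis by (simp add: power_one_over field_simps power2_eq_square)
    qed
    ultimately have "summable (\<lambda>k. d k x)"
      by (intro summable_comparison_test[where f="\<lambda>k. d k x"]) auto
    moreover have "(\<lambda>k. u (s k) x) = (\<lambda>k. (\<Sum>i<k. d i x) + u (s 0) x)"
      unfolding d_def by (rule ext, subst sum_lessThan_telescope) simp
    ultimately show ?case
      by (simp add: convergent_add_const_right_iff summable_iff_convergent)
  qed
  thus ?thesis using that s(1) by blast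
qed

lemma sq_complete:
  assumes u: "\<And>n. sq_integrable M (u n)" and C: "sq_Cauchy M u"
  obtains f where "sq_integrable M f" "(\<lambda>n. sq_norm M (\<lambda>x. u n x - f x)) \<longlonglongrightarrow> 0"
proof -
  obtain s where s: "strict_mono s" "AE x in M. convergent (\<lambda>k. u (s k) x)"
    using sq_Cauchy_AE_convergent[OF u C] by blast
  have [measurable]: "u n \<in> borel_measurable M" for n
    using u by (simp add: sq_integrable_def)
  \<comment> \<open>Where the subsequence diverges, \<open>lim\<close> has an unspecified value;
    this affects only a null set.\<close>
  define f where "f x = lim (\<lambda>k. u (s k) x)" for x
  have [measurable]: "f \<in> borel_measurable M"
    unfolding f_def by (intro borel_measurable_lim_metric) auto
  \<comment> \<open>Fatou along the subsequence transfers the Cauchy bound from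
    \<open>u n - u m\<close> to \<open>u n - f\<close>. Nonnegative integrals are used because
    \<open>f\<close> is not yet known to be square integrable.\<close>
  have le: "(\<integral>\<^sup>+x. ennreal ((norm (u n x - f x))\<^sup>2) \<partial>M) \<le> ennreal (e\<^sup>2)"
    if "0 \<le> e" and N: "\<And>m. m \<ge> N \<Longrightarrow> sq_norm M (\<lambda>x. u n x - u m x) \<le> e" for n N e
  proof -
    have "(\<integral>\<^sup>+x. ennreal ((norm (u n x - f x))\<^sup>2) \<partial>M)
        = (\<integral>\<^sup>+x. liminf (\<lambda>k. ennreal ((norm (u n x - u (s k) x))\<^sup>2)) \<partial>M)"
    proof (rule nn_integral_cong_AE)
      show "AE x in M. ennreal ((norm (u n x - f x))\<^sup>2) = liminf (\<lambda>k. ennreal ((norm (u n x - u (s k) x))\<^sup>2))"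
        using s(2)
      proof eventually_elim
        case (elim x)
        hence "(\<lambda>k. u (s k) x) \<longlonglongrightarrow> f x"
          unfolding f_def by (simp add: convergent_LIMSEQ_iff)
        hence "(\<lambda>k. ennreal ((norm (u n x - u (s k) x))\<^sup>2)) \<longlonglongrightarrow> ennreal ((norm (u n x - f x))\<^sup>2)"
          by (intro tendsto_ennrealI tendsto_intros)
        thus ?case by (intro lim_imp_Liminf[symmetric]) auto
      qed
    qed
    also have "\<dots> \<le> liminf (\<lambda>k. \<integral>\<^sup>+x. ennreal ((norm (u n x - u (s k) x))\<^sup>2) \<partial>M)"
      by (rule nn_integral_liminf) measurable
    also have "\<dots> \<le> limsup (\<lambda>k. \<integral>\<^sup>+x. ennreal ((norm (u n x - u (s k) x))\<^sup>2) \<partial>M)"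
      by (rule Liminf_le_Limsup) simp
    also have "\<dots> \<le> ennreal (e\<^sup>2)"
    proof (rule Limsup_bounded)
      show "\<forall>\<^sub>F k in sequentially. (\<integral>\<^sup>+x. ennreal ((norm (u n x - u (s k) x))\<^sup>2) \<partial>M) \<le> ennreal (e\<^sup>2)"
        unfolding eventually_sequentially
      proof (intro exI allI impI)
        fix k assume "N \<le> k"
        hence "sq_norm M (\<lambda>x. u n x - u (s k) x) \<le> e"
          using seq_suble[OF s(1), of k] by (intro N) auto
        hence "(sq_norm M (\<lambda>x. u n x - u (s k) x))\<^sup>2 \<le> e\<^sup>2"
          by (intro power_mono) auto
        thus "(\<integral>\<^sup>+x. ennreal ((norm (u n x - u (s k) x))\<^sup>2) \<partial>M) \<le> ennreal (e\<^sup>2)"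
          using sq_integrable_diff[OF u[of n] u[of "s k"]]
          by (subst nn_integral_eq_integral) (auto simp: sq_norm_power2 sq_integrable_def)
      qed
    qed
    finally show ?thesis .
  qed
  have ev: "\<exists>N. \<forall>n\<ge>N. sq_integrable M (\<lambda>x. u n x - f x) \<and> sq_norm M (\<lambda>x. u n x - f x) \<le> e" if "e > 0" for e
  proof -
    obtain N where N: "\<And>m n. m \<ge> N \<Longrightarrow> n \<ge> N \<Longrightarrow> sq_norm M (\<lambda>x. u m x - u n x) < e"
      using C \<open>e > 0\<close> unfolding sq_Cauchy_def by blast
    show ?thesis
    proof (intro exI allI impI)
      fix n assume "n \<ge> N"
      have *: "(\<integral>\<^sup>+x. ennreal ((norm (u n x - f x))\<^sup>2) \<partial>M) \<le> ennreal (e\<^sup>2)"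
        using that N[OF \<open>n \<ge> N\<close>] by (intro le[of e N n]) (auto intro: less_imp_le)
      have i: "sq_integrable M (\<lambda>x. u n x - f x)"
        unfolding sq_integrable_def
        by (intro conjI integrableI_nonneg le_less_trans[OF *]) auto
      moreover have "ennreal ((sq_norm M (\<lambda>x. u n x - f x))\<^sup>2) \<le> ennreal (e\<^sup>2)"
        using * i by (subst (asm) nn_integral_eq_integral) (auto simp: sq_norm_power2 sq_integrable_def)
      hence "sq_norm M (\<lambda>x. u n x - f x) \<le> e"
        using that by (auto intro: power2_le_imp_le[of _ e])
      ultimately show "sq_integrable M (\<lambda>x. u n x - f x) \<and> sq_norm M (\<lambda>x. u n x - f x) \<le> e" by blast
    qed
  qed
  obtain n where n: "sq_integrable M (\<lambda>x. u n x - f x)"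
    using ev[of 1] by auto
  have "sq_integrable M f"
    using sq_integrable_diff[OF u[of n] n] by simp
  moreover have "(\<lambda>n. sq_norm M (\<lambda>x. u n x - f x)) \<longlonglongrightarrow> 0"
  proof (rule LIMSEQ_I)
    fix r :: real assume "0 < r"
    then obtain N where N: "\<And>n. n \<ge> N \<Longrightarrow> sq_norm M (\<lambda>x. u n x - f x) \<le> r/2"
      using ev[of "r/2"] half_gt_zero[OF \<open>0 < r\<close>] by blast
    have "norm (sq_norm M (\<lambda>x. u n x - f x) - 0) < r" if "n \<ge> N" for n :: nat
      using N[OF that] \<open>0 < r\<close> by simp
    thus "\<exists>N. \<forall>n\<ge>N. norm (sq_norm M (\<lambda>x. u n x - f x) - 0) < r" by blast
  qed
  ultimately show ?thesis using that by blast
qed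

lemma sq_Cauchy_bounded_by:
  assumes C: "sq_Cauchy M u" and le: "\<And>m n. sq_norm M (\<lambda>z. v m z - v n z) \<le> B * sq_norm M (\<lambda>z. u m z - u n z)"
  shows "sq_Cauchy M v"
  unfolding sq_Cauchy_def
proof (intro allI impI)
  fix e :: real assume "e > 0"
  \<comment> \<open>\<open>B\<close> carries no sign condition and may be 0; |B| + 1 is a positive
    factor above it.\<close>
  hence "e / (\<bar>B\<bar> + 1) > 0" by simp
  then obtain N where N: "\<And>m n. m \<ge> N \<Longrightarrow> n \<ge> N \<Longrightarrow> sq_norm M (\<lambda>z. u m z - u n z) < e / (\<bar>B\<bar> + 1)"
    using C unfolding sq_Cauchy_def by blast
  have "sq_norm M (\<lambda>z. v m z - v n z) < e" if "m \<ge> N" "n \<ge> N" for m n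
  proof -
    have "sq_norm M (\<lambda>z. v m z - v n z) \<le> (\<bar>B\<bar> + 1) * sq_norm M (\<lambda>z. u m z - u n z)"
      by (rule order_trans[OF le]) (intro mult_right_mono; simp)
    also have "\<dots> < (\<bar>B\<bar> + 1) * (e / (\<bar>B\<bar> + 1))"
      by (intro mult_strict_left_mono N that) simp
    also have "\<dots> = e"
      using nonzero_mult_div_cancel_left[of "\<bar>B\<bar> + 1" e] abs_ge_zero[of B] by (simp add: add_nonneg_eq_0_iff)
    finally show ?thesis .
  qed
  thus "\<exists>N. \<forall>m\<ge>N. \<forall>n\<ge>N. sq_norm M (\<lambda>z. v m z - v n z) < e" by blast
qed

section \<open>Orthogonal projection onto the closure of a subspace\<close>

lemma quadratic_nonneg_imp_zero:
  fixes A c :: real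
  assumes "\<And>t. 0 \<le> t\<^sup>2 * A - 2 * t * c"
  shows "c = 0"
proof (rule ccontr)
  assume "c \<noteq> 0"
  have A: "0 \<le> A" using assms[of 1] assms[of "-1"] by simp
  \<comment> \<open>The minimizer c / A of the quadratic would need A > 0. With A + 1 in its place
    the value is -t^2 (A + 2), negative unless c = 0.\<close>
  define t where "t = c / (A + 1)"
  have c: "c = t * (A + 1)" using A by (simp add: t_def)
  have "t\<^sup>2 * A - 2 * t * c = - (t\<^sup>2 * (A + 2))"
    unfolding c by (simp add: algebra_simps power2_eq_square)
  also have "\<dots> < 0"
    using A \<open>c \<noteq> 0\<close> by (auto simp: t_def intro!: mult_pos_pos)
  finally show False using assms[of t] by simp
qed

text \<open>\<open>S\<close> is a real subspace that need not be closed, so the projection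
  \<open>G\<close> is only a limit of elements of \<open>S\<close>. The minimizing sequence
  \<open>g\<close> is returned as well: from its Cauchy property the preimages under
  \<open>adj\<close> are later shown to converge.\<close>

lemma sq_projection:
  fixes F :: "'b \<Rightarrow> 'a::euclidean_space"
  assumes S: "\<And>s. s \<in> S \<Longrightarrow> sq_integrable M s" and zero: "(\<lambda>x. 0) \<in> S"
    and add: "\<And>s t. s \<in> S \<Longrightarrow> t \<in> S \<Longrightarrow> (\<lambda>x. s x + t x) \<in> S"
    and scale: "\<And>s c. s \<in> S \<Longrightarrow> (\<lambda>x. c *\<^sub>R s x) \<in> S"
    and F: "sq_integrable M F"
  obtains g G where "\<And>n. g n \<in> S" "sq_integrable M G" "sq_Cauchy M g"
    "(\<lambda>n. sq_norm M (\<lambda>x. g n x - G x)) \<longlonglongrightarrow> 0" "\<And>s. s \<in> S \<Longrightarrow> (\<integral>x. (F x - G x) \<bullet> s x \<partial>M) = 0"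
proof -
  define N where "N s = sq_norm M (\<lambda>x. F x - s x)" for s
  define \<delta> where "\<delta> = (INF s\<in>S. N s)"
  have bdd: "bdd_below (N ` S)"
    by (rule bdd_belowI[of _ 0]) (auto simp: N_def)
  have \<delta>_le: "\<delta> \<le> N s" if "s \<in> S" for s
    unfolding \<delta>_def using bdd that by (rule cINF_lower)
  have \<delta>0: "0 \<le> \<delta>"
    unfolding \<delta>_def using zero by (intro cINF_greatest) (auto simp: N_def)
  have "\<exists>s\<in>S. N s < \<delta> + 1 / Suc n" for n
  proof -
    have "\<exists>y\<in>N ` S. y < \<delta> + 1 / Suc n"
      using zero bdd unfolding \<delta>_def by (subst cInf_less_iff[symmetric]) auto
    thus ?thesis by blast
  qed
  then obtain g where g: "\<And>n. g n \<in> S" "\<And>n. N (g n) < \<delta> + 1 / Suc n"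
    by metis
  have gi: "sq_integrable M (g n)" for n using S g(1) by blast
  \<comment> \<open>Parallelogram law for \<open>F - g m\<close> and \<open>F - g n\<close>: their
    mean is \<open>F\<close> minus the midpoint of \<open>g m\<close> and \<open>g n\<close>, which
    lies in \<open>S\<close> and hence is at distance at least \<delta> from
    \<open>F\<close>.\<close>
  have par: "(sq_norm M (\<lambda>x. g m x - g n x))\<^sup>2 \<le> 2 * (N (g m))\<^sup>2 + 2 * (N (g n))\<^sup>2 - 4 * \<delta>\<^sup>2" for m n
  proof -
    let ?h = "\<lambda>x. (1/2) *\<^sub>R (g m x + g n x)"
    have h: "?h \<in> S" by (intro scale add g)
    have I: "sq_integrable M (\<lambda>x. F x - g m x)" "sq_integrable M (\<lambda>x. F x - g n x)"
      "sq_integrable M (\<lambda>x. F x - ?h x)" "sq_integrable M (\<lambda>x. g m x - g n x)"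
      by (intro sq_integrable_diff F gi S[OF h])+
    have *: "(norm (g m x - g n x))\<^sup>2 + 4 * (norm (F x - ?h x))\<^sup>2
         = 2 * (norm (F x - g m x))\<^sup>2 + 2 * (norm (F x - g n x))\<^sup>2" for x
    proof -
      have "4 * (norm (F x - ?h x))\<^sup>2 = (norm (2 *\<^sub>R (F x - ?h x)))\<^sup>2"
        by (simp add: power_mult_distrib)
      also have "2 *\<^sub>R (F x - ?h x) = (F x - g m x) + (F x - g n x)"
        by (simp add: algebra_simps scaleR_2)
      finally have "4 * (norm (F x - ?h x))\<^sup>2 = (norm ((F x - g m x) + (F x - g n x)))\<^sup>2" .
      moreover have "g m x - g n x = (F x - g n x) - (F x - g m x)" by simp
      ultimately show ?thesis
        by (simp only: power2_norm_eq_inner inner_add inner_diff) (simp add: inner_commute algebra_simps)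
    qed
    have "(\<integral>x. (norm (g m x - g n x))\<^sup>2 + 4 * (norm (F x - ?h x))\<^sup>2 \<partial>M)
        = (\<integral>x. 2 * (norm (F x - g m x))\<^sup>2 + 2 * (norm (F x - g n x))\<^sup>2 \<partial>M)"
      by (simp only: *)
    hence "(sq_norm M (\<lambda>x. g m x - g n x))\<^sup>2 + 4 * (N ?h)\<^sup>2 = 2 * (N (g m))\<^sup>2 + 2 * (N (g n))\<^sup>2"
      using I by (simp add: sq_norm_power2 sq_integrable_def N_def)
    moreover have "\<delta>\<^sup>2 \<le> (N ?h)\<^sup>2"
      using \<delta>_le[OF h] \<delta>0 by (rule power_mono)
    ultimately show ?thesis by linarith
  qed
  have C: "sq_Cauchy M g"
    unfolding sq_Cauchy_def
  proof (intro allI impI)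
    fix e :: real assume "0 < e"
    have "(\<lambda>n. 4 * (\<delta> + 1 / Suc n)\<^sup>2) \<longlonglongrightarrow> 4 * (\<delta> + 0)\<^sup>2"
      by (intro tendsto_intros LIMSEQ_Suc[OF lim_1_over_n])
    hence "\<forall>\<^sub>F n in sequentially. 4 * (\<delta> + 1 / Suc n)\<^sup>2 < 4 * \<delta>\<^sup>2 + e\<^sup>2"
      using \<open>0 < e\<close> by (elim order_tendstoD) simp
    then obtain K where K: "4 * (\<delta> + 1 / Suc K)\<^sup>2 < 4 * \<delta>\<^sup>2 + e\<^sup>2"
      by (auto simp: eventually_sequentially)
    show "\<exists>N. \<forall>m\<ge>N. \<forall>n\<ge>N. sq_norm M (\<lambda>x. g m x - g n x) < e"
    proof (intro exI allI impI)
      fix m n assume mn: "m \<ge> K" "n \<ge> K"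
      have *: "(N (g m))\<^sup>2 \<le> (\<delta> + 1 / Suc K)\<^sup>2" if "m \<ge> K" for m
      proof (rule power_mono)
        have "N (g m) \<le> \<delta> + 1 / Suc m" using g(2)[of m] by simp
        also have "\<dots> \<le> \<delta> + 1 / Suc K" using that by (simp add: frac_le)
        finally show "N (g m) \<le> \<delta> + 1 / Suc K" .
      qed (simp add: N_def)
      have "(sq_norm M (\<lambda>x. g m x - g n x))\<^sup>2 < e\<^sup>2"
        using par[of m n] *[OF mn(1)] *[OF mn(2)] K by linarith
      thus "sq_norm M (\<lambda>x. g m x - g n x) < e"
        using \<open>0 < e\<close> by (auto intro: power2_less_imp_less)
    qed
  qed
  obtain G where G: "sq_integrable M G" "(\<lambda>n. sq_norm M (\<lambda>x. g n x - G x)) \<longlonglongrightarrow> 0"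
    using sq_complete[OF gi C] by blast
  have NG: "N G \<le> \<delta>"
  proof (rule LIMSEQ_le_const)
    show "(\<lambda>n. \<delta> + 1 / Suc n + sq_norm M (\<lambda>x. g n x - G x)) \<longlonglongrightarrow> \<delta>"
      using tendsto_add[OF tendsto_add[OF tendsto_const[of \<delta>] LIMSEQ_Suc[OF lim_1_over_n]] G(2)] by simp
    show "\<exists>K. \<forall>n\<ge>K. N G \<le> \<delta> + 1 / Suc n + sq_norm M (\<lambda>x. g n x - G x)"
    proof (intro exI allI impI)
      fix n
      show "N G \<le> \<delta> + 1 / Suc n + sq_norm M (\<lambda>x. g n x - G x)"
        using sq_norm_triangle3[OF F gi[of n] G(1)] g(2)[of n] unfolding N_def by linarith
    qed
  qed
  have orth: "(\<integral>x. (F x - G x) \<bullet> s x \<partial>M) = 0" if s: "s \<in> S" for s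
  proof (rule quadratic_nonneg_imp_zero[where A="\<integral>x. (norm (s x))\<^sup>2 \<partial>M"])
    fix t :: real
    have si: "sq_integrable M s" and FG: "sq_integrable M (\<lambda>x. F x - G x)"
      using S s sq_integrable_diff F G(1) by auto
    \<comment> \<open>\<open>G\<close> need not lie in \<open>S\<close>, so minimality is applied to
      \<open>g n + t s\<close>, and n tends to infinity afterwards.\<close>
    have "\<delta> \<le> sq_norm M (\<lambda>x. (F x - G x) + (- t) *\<^sub>R s x)"
    proof (rule LIMSEQ_le_const)
      show "(\<lambda>n. sq_norm M (\<lambda>x. g n x - G x) + sq_norm M (\<lambda>x. (F x - G x) + (- t) *\<^sub>R s x))
          \<longlonglongrightarrow> sq_norm M (\<lambda>x. (F x - G x) + (- t) *\<^sub>R s x)"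
        using tendsto_add[OF G(2) tendsto_const] by simp
      have "\<delta> \<le> sq_norm M (\<lambda>x. g n x - G x) + sq_norm M (\<lambda>x. (F x - G x) + (- t) *\<^sub>R s x)" for n
      proof -
        have "\<delta> \<le> N (\<lambda>x. g n x + t *\<^sub>R s x)"
          by (intro \<delta>_le add scale g s)
        also have "\<dots> = sq_norm M (\<lambda>x. (G x - g n x) + ((F x - G x) + (- t) *\<^sub>R s x))"
          by (simp add: N_def algebra_simps)
        also have "\<dots> \<le> sq_norm M (\<lambda>x. G x - g n x) + sq_norm M (\<lambda>x. (F x - G x) + (- t) *\<^sub>R s x)"
          by (intro sq_norm_triangle sq_integrable_diff sq_integrable_add sq_integrable_scaleR G(1) gi si F)
        finally show ?thesis by (simp add: sq_norm_minus_commute[of M G])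
      qed
      thus "\<exists>N. \<forall>n\<ge>N. \<delta> \<le> sq_norm M (\<lambda>x. g n x - G x) + sq_norm M (\<lambda>x. (F x - G x) + (- t) *\<^sub>R s x)"
        by blast
    qed
    hence "\<delta>\<^sup>2 \<le> (sq_norm M (\<lambda>x. (F x - G x) + (- t) *\<^sub>R s x))\<^sup>2"
      using \<delta>0 by (rule power_mono)
    also have "\<dots> = (N G)\<^sup>2 - 2 * t * (\<integral>x. (F x - G x) \<bullet> s x \<partial>M) + t\<^sup>2 * (\<integral>x. (norm (s x))\<^sup>2 \<partial>M)"
      using integral_norm_add_power2[OF FG sq_integrable_scaleR[OF si, of "- t"]]
      by (simp add: sq_norm_power2 N_def power_mult_distrib)
    finally have "\<delta>\<^sup>2 \<le> (N G)\<^sup>2 - 2 * t * (\<integral>x. (F x - G x) \<bullet> s x \<partial>M) + t\<^sup>2 * (\<integral>x. (norm (s x))\<^sup>2 \<partial>M)" .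
    moreover have "(N G)\<^sup>2 \<le> \<delta>\<^sup>2" using NG by (intro power_mono) (auto simp: N_def)
    ultimately show "0 \<le> t\<^sup>2 * (\<integral>x. (norm (s x))\<^sup>2 \<partial>M) - 2 * t * (\<integral>x. (F x - G x) \<bullet> s x \<partial>M)"
      by linarith
  qed
  show ?thesis using that[OF g(1) G(1) C G(2) orth] by blast
qed


section \<open>Bicomplex numbers as a real algebra\<close>

lemma norm_Sc_le: "cmod (Sc W) \<le> norm W"
  by (auto simp: norm_bicomplex_def intro!: real_le_rsqrt)

lemma norm_Vec_le: "cmod (Vec W) \<le> norm W"
  by (auto simp: norm_bicomplex_def intro!: real_le_rsqrt)

lemma bounded_linear_Sc: "bounded_linear Sc"
  by (rule bounded_linear_intro[of _ 1]) (auto simp: norm_Sc_le)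

lemma bounded_linear_Vec: "bounded_linear Vec"
  by (rule bounded_linear_intro[of _ 1]) (auto simp: norm_Vec_le)

lemma bounded_linear_Bicomplex_Sc: "bounded_linear (\<lambda>c. Bicomplex c 0)"
  by (rule bounded_linear_intro[of _ 1]) (auto simp: bicomplex_eq_iff norm_bicomplex_def)

lemma bounded_linear_Bicomplex_Vec: "bounded_linear (\<lambda>c. Bicomplex 0 c)"
  by (rule bounded_linear_intro[of _ 1]) (auto simp: bicomplex_eq_iff norm_bicomplex_def)

lemma bicomplex_split: "W = Bicomplex (Sc W) 0 + Bicomplex 0 (Vec W)"
  by (simp add: bicomplex_eq_iff)

lemma Sc_Vec_bc_simps [simp]:
  "Sc bc_j = 0" "Vec bc_j = 1"
  "Sc (bc_bar W) = Sc W" "Vec (bc_bar W) = - Vec W"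
  "Sc (bc_dagger W) = cnj (Sc W)" "Vec (bc_dagger W) = - cnj (Vec W)"
  "Sc (bc_star W) = cnj (Sc W)" "Vec (bc_star W) = cnj (Vec W)"
  by (simp_all add: bc_j_def bc_bar_def bc_dagger_def bc_star_def)

lemma norm_bc_simps [simp]:
  "norm (bc_bar W) = norm W" "norm (bc_dagger W) = norm W" "norm (bc_star W) = norm W"
  "norm (bc_j * W) = norm W"
  by (simp_all add: norm_bicomplex_def)

lemma bounded_linear_bc_bar: "bounded_linear bc_bar"
  by (rule bounded_linear_intro[of _ 1]) (auto simp: bicomplex_eq_iff)

lemma bounded_linear_bc_dagger: "bounded_linear bc_dagger"
  by (rule bounded_linear_intro[of _ 1]) (auto simp: bicomplex_eq_iff)

lemma bounded_linear_bc_star: "bounded_linear bc_star"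
  by (rule bounded_linear_intro[of _ 1]) (auto simp: bicomplex_eq_iff)

text \<open>Each of the two components of the product is at most |W| |V| by Cauchy-Schwarz, and two
  such components give sqrt 2. The constant is attained at the idempotent (1 + i j) / 2 multiplied
  by itself; it is the source of the sqrt 2 in the smallness condition.\<close>

lemma norm_bicomplex_mult_le: "norm (W * V) \<le> sqrt 2 * (norm W * norm V)" for W V :: bicomplex
proof -
  define p q s t where "p = cmod (Sc W)" "q = cmod (Vec W)" "s = cmod (Sc V)" "t = cmod (Vec V)"
  note d = p_q_s_t_def
  have "(cmod (Sc W * Sc V - Vec W * Vec V))\<^sup>2 \<le> (p * s + q * t)\<^sup>2"
    unfolding d by (intro power_mono order_trans[OF norm_triangle_ineq4]) (auto simp: norm_mult)
  \<comment> \<open>Lagrange's identity: the two sides differ by the square (p t - q s)^2.\<close>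
  also have "\<dots> \<le> (p\<^sup>2 + q\<^sup>2) * (s\<^sup>2 + t\<^sup>2)"
    using zero_le_power2[of "p * t - q * s"] by (simp add: power2_eq_square algebra_simps)
  finally have 1: "(cmod (Sc W * Sc V - Vec W * Vec V))\<^sup>2 \<le> (p\<^sup>2 + q\<^sup>2) * (s\<^sup>2 + t\<^sup>2)" .
  have "(cmod (Sc W * Vec V + Vec W * Sc V))\<^sup>2 \<le> (p * t + q * s)\<^sup>2"
    unfolding d by (intro power_mono order_trans[OF norm_triangle_ineq]) (auto simp: norm_mult)
  also have "\<dots> \<le> (p\<^sup>2 + q\<^sup>2) * (s\<^sup>2 + t\<^sup>2)"
    using zero_le_power2[of "p * s - q * t"] by (simp add: power2_eq_square algebra_simps)
  finally have 2: "(cmod (Sc W * Vec V + Vec W * Sc V))\<^sup>2 \<le> (p\<^sup>2 + q\<^sup>2) * (s\<^sup>2 + t\<^sup>2)" .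
  have "(norm (W * V))\<^sup>2 \<le> (sqrt 2 * (norm W * norm V))\<^sup>2"
    using 1 2 by (simp add: norm_bicomplex_def power_mult_distrib flip: d)
  thus ?thesis by (rule power2_le_imp_le) simp
qed

lemma bounded_bilinear_bicomplex_mult: "bounded_bilinear ((*) :: bicomplex \<Rightarrow> _)"
proof
  show "\<exists>K. \<forall>W V :: bicomplex. norm (W * V) \<le> norm W * norm V * K"
    by (rule exI[of _ "sqrt 2"]) (use norm_bicomplex_mult_le in \<open>auto simp: mult.commute\<close>)
qed (auto simp: algebra_simps)

lemmas bounded_linear_bicomplex_mult_right =
  bounded_bilinear.bounded_linear_right[OF bounded_bilinear_bicomplex_mult]

lemma norm_complex_mult_bicomplex: "norm (Bicomplex c 0 * W) = cmod c * norm W"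
proof -
  have "(norm (Bicomplex c 0 * W))\<^sup>2 = (cmod c * norm W)\<^sup>2"
    by (simp add: norm_bicomplex_def norm_mult power_mult_distrib distrib_left)
  thus ?thesis by (simp add: power2_eq_iff_nonneg)
qed

lemma sq_norm_complex_mult: "sq_norm M (\<lambda>z. Bicomplex c 0 * F z) = cmod c * sq_norm M F"
  by (simp add: sq_norm_def norm_complex_mult_bicomplex power_mult_distrib real_sqrt_mult)

lemma inner_bicomplex_eq_Re: "W \<bullet> V = Re (bc_inner W V)"
  by (simp add: inner_bicomplex_def bc_inner_def inner_complex_def)

lemma bc_inner_eq_Sc: "bc_inner W V = Sc (W * bc_dagger V)"
  by (simp add: bc_inner_def)

lemma Sc_eq_integral:
  "integrable M f \<Longrightarrow> Sc (\<integral>x. f x \<partial>M) = (\<integral>x. Sc (f x) \<partial>M)"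
  by (rule integral_bounded_linear[OF bounded_linear_Sc, symmetric])

lemma Vec_eq_integral:
  "integrable M f \<Longrightarrow> Vec (\<integral>x. f x \<partial>M) = (\<integral>x. Vec (f x) \<partial>M)"
  by (rule integral_bounded_linear[OF bounded_linear_Vec, symmetric])

lemma borel_measurable_bounded_linear:
  "bounded_linear T \<Longrightarrow> f \<in> borel_measurable M \<Longrightarrow> (\<lambda>x. T (f x)) \<in> borel_measurable M"
  by (rule borel_measurable_continuous_on[OF linear_continuous_on])

lemma borel_measurable_bicomplex_iff:
  "f \<in> borel_measurable M \<longleftrightarrow> (\<lambda>x. Sc (f x)) \<in> borel_measurable M \<and> (\<lambda>x. Vec (f x)) \<in> borel_measurable M"
proof safe
  assume "(\<lambda>x. Sc (f x)) \<in> borel_measurable M" "(\<lambda>x. Vec (f x)) \<in> borel_measurable M"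
  hence "(\<lambda>x. Bicomplex (Sc (f x)) 0 + Bicomplex 0 (Vec (f x))) \<in> borel_measurable M"
    by (intro borel_measurable_add borel_measurable_bounded_linear[OF bounded_linear_Bicomplex_Sc]
        borel_measurable_bounded_linear[OF bounded_linear_Bicomplex_Vec])
  thus "f \<in> borel_measurable M" by (simp flip: bicomplex_split)
qed (auto intro: borel_measurable_bounded_linear bounded_linear_Sc bounded_linear_Vec)

lemma integrable_bicomplex_iff:
  fixes f :: "'a \<Rightarrow> bicomplex"
  shows "integrable M f \<longleftrightarrow> integrable M (\<lambda>x. Sc (f x)) \<and> integrable M (\<lambda>x. Vec (f x))"
proof safe
  assume "integrable M (\<lambda>x. Sc (f x))" "integrable M (\<lambda>x. Vec (f x))"
  hence "integrable M (\<lambda>x. Bicomplex (Sc (f x)) 0 + Bicomplex 0 (Vec (f x)))"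
    by (intro Bochner_Integration.integrable_add integrable_bounded_linear[OF bounded_linear_Bicomplex_Sc]
        integrable_bounded_linear[OF bounded_linear_Bicomplex_Vec])
  thus "integrable M f" by (simp flip: bicomplex_split)
qed (auto intro: integrable_bounded_linear bounded_linear_Sc bounded_linear_Vec)

text \<open>The bridge between the componentwise definition of \<open>bc_valued\<close> and the
  theory built on the bicomplex norm.\<close>

lemma sq_integrable_bicomplex_iff:
  "sq_integrable M f \<longleftrightarrow> sq_integrable M (\<lambda>x. Sc (f x)) \<and> sq_integrable M (\<lambda>x. Vec (f x))"
proof safe
  assume "sq_integrable M (\<lambda>x. Sc (f x))" "sq_integrable M (\<lambda>x. Vec (f x))"
  hence "sq_integrable M (\<lambda>x. Bicomplex (Sc (f x)) 0 + Bicomplex 0 (Vec (f x)))"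
    by (intro sq_integrable_add sq_integrable_bounded_linear[OF bounded_linear_Bicomplex_Sc]
        sq_integrable_bounded_linear[OF bounded_linear_Bicomplex_Vec])
  thus "sq_integrable M f" by (simp flip: bicomplex_split)
qed (auto intro: sq_integrable_bounded_linear bounded_linear_Sc bounded_linear_Vec)

lemma sq_norm_bicomplex_le:
  assumes "sq_integrable M F"
  shows "sq_norm M F \<le> sq_norm M (\<lambda>z. Sc (F z)) + sq_norm M (\<lambda>z. Vec (F z))"
proof -
  have "(norm (F z))\<^sup>2 = (norm (Sc (F z)))\<^sup>2 + (norm (Vec (F z)))\<^sup>2" for z
    by (simp add: norm_bicomplex_def)
  hence "(sq_norm M F)\<^sup>2 = (sq_norm M (\<lambda>z. Sc (F z)))\<^sup>2 + (sq_norm M (\<lambda>z. Vec (F z)))\<^sup>2"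
    using assms sq_integrable_bicomplex_iff[of M F] by (simp add: sq_norm_power2 sq_integrable_def)
  also have "\<dots> \<le> (sq_norm M (\<lambda>z. Sc (F z)) + sq_norm M (\<lambda>z. Vec (F z)))\<^sup>2"
    by (simp add: power2_sum)
  finally show ?thesis by (rule power2_le_imp_le) simp
qed

lemma sq_norm_Sc_le: "sq_integrable M F \<Longrightarrow> sq_norm M (\<lambda>z. Sc (F z)) \<le> sq_norm M F"
  using sq_norm_bounded_by[of "\<lambda>z. Sc (F z)" M F 1] norm_Sc_le
  by (simp add: sq_integrable_bicomplex_iff[of M F] sq_integrable_measurable)

lemma sq_norm_Vec_le: "sq_integrable M F \<Longrightarrow> sq_norm M (\<lambda>z. Vec (F z)) \<le> sq_norm M F"
  using sq_norm_bounded_by[of "\<lambda>z. Vec (F z)" M F 1] norm_Vec_le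
  by (simp add: sq_integrable_bicomplex_iff[of M F] sq_integrable_measurable)

lemma L2_iff_sq_integrable: "f \<in> L2 \<Omega> \<longleftrightarrow> sq_integrable (lebesgue_on \<Omega>) f"
  by (simp add: L2_def sq_integrable_def)

lemma bc_valued_L2_iff: "F \<in> bc_valued (L2 \<Omega>) \<longleftrightarrow> sq_integrable (lebesgue_on \<Omega>) F"
  by (simp add: bc_valued_def L2_iff_sq_integrable sq_integrable_bicomplex_iff[of _ F])

lemma L2_norm_eq_sq_norm: "L2_norm \<Omega> f = sq_norm (lebesgue_on \<Omega>) f"
  by (simp add: L2_norm_def sq_norm_def)


section \<open>Continuously differentiable functions of compact support\<close>

lemma partial_deriv_eqI: "(f has_derivative f') (at z) \<Longrightarrow> partial_deriv e f z = f' e"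
  unfolding partial_deriv_def by (metis frechet_derivative_at)

lemma C_k_continuous: "C_k k f \<Longrightarrow> continuous_on UNIV f"
  by (cases k) (auto intro: differentiable_imp_continuous_on)

lemma C_k_has_derivative:
  "C_k (Suc k) f \<Longrightarrow> (f has_derivative (\<lambda>e. partial_deriv e f z)) (at z)"
  unfolding partial_deriv_def
  by (simp add: differentiable_on_def frechet_derivative_works[symmetric])

text \<open>The derivative enters as an explicit family \<open>f'\<close>; uniqueness of the
  derivative identifies it with the choice made in \<open>frechet_derivative\<close>, so smoothness
  proofs never unfold \<open>partial_deriv\<close>.\<close>

lemma C_k_SucI:
  assumes "\<And>z. (f has_derivative f' z) (at z)" "C_k k (\<lambda>z. f' z 1)" "C_k k (\<lambda>z. f' z \<i>)"
  shows "C_k (Suc k) f"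
proof -
  have "partial_deriv e f = (\<lambda>z. f' z e)" for e
    by (rule ext, rule partial_deriv_eqI[OF assms(1)])
  thus ?thesis
    using assms by (auto simp: differentiable_on_def differentiable_def)
qed

lemma C_k_SucD: "C_k (Suc k) f \<Longrightarrow> C_k k f"
proof (induction k arbitrary: f)
  case 0
  thus ?case by (auto intro: differentiable_imp_continuous_on)
next
  case (Suc k)
  thus ?case by (metis C_k.simps(2))
qed

lemma C_k_le: "C_k k f \<Longrightarrow> j \<le> k \<Longrightarrow> C_k j f"
  by (induction k) (auto simp: le_Suc_eq simp del: C_k.simps dest: C_k_SucD)

lemma C_k_partial: "C_k (Suc k) f \<Longrightarrow> e \<in> {1, \<i>} \<Longrightarrow> C_k k (partial_deriv e f)"
  by auto

lemma C_k_const: "C_k k (\<lambda>z. c)"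
proof (induction k arbitrary: c)
  case (Suc k)
  show ?case by (rule C_k_SucI[where f'="\<lambda>_ _. 0"]) (auto intro: Suc)
qed simp

lemma C_k_linear: "bounded_linear f \<Longrightarrow> C_k k f"
proof (cases k)
  case (Suc m)
  assume "bounded_linear f"
  thus ?thesis unfolding Suc
    by (intro C_k_SucI[where f'="\<lambda>_. f"] bounded_linear_imp_has_derivative C_k_const)
qed (simp add: linear_continuous_on)

lemma C_k_add: "C_k k f \<Longrightarrow> C_k k g \<Longrightarrow> C_k k (\<lambda>z. f z + g z)"
proof (induction k arbitrary: f g)
  case (Suc k)
  show ?case
    by (rule C_k_SucI[OF has_derivative_add[OF C_k_has_derivative[OF Suc.prems(1)]
            C_k_has_derivative[OF Suc.prems(2)]]])
      (rule Suc.IH; (rule C_k_partial[OF Suc.prems(1)] C_k_partial[OF Suc.prems(2)]; simp))+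
qed (auto intro: continuous_intros)

lemma C_k_bounded_linear: "bounded_linear T \<Longrightarrow> C_k k f \<Longrightarrow> C_k k (\<lambda>z. T (f z))"
proof (induction k arbitrary: f)
  case 0
  thus ?case by (auto intro: bounded_linear.continuous_on)
next
  case (Suc k)
  show ?case
    by (rule C_k_SucI[OF bounded_linear.has_derivative[OF Suc.prems(1) C_k_has_derivative[OF Suc.prems(2)]]])
      (rule Suc.IH[OF Suc.prems(1)], rule C_k_partial[OF Suc.prems(2)], simp)+
qed

lemma C_k_bilinear:
  assumes p: "bounded_bilinear p"
  shows "C_k k f \<Longrightarrow> C_k k g \<Longrightarrow> C_k k (\<lambda>z. p (f z) (g z))"
proof (induction k arbitrary: f g)
  case 0
  thus ?case by (auto intro: bounded_bilinear.continuous_on[OF p])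
next
  case (Suc k)
  show ?case
  proof (rule C_k_SucI[where f'="\<lambda>z e. p (f z) (partial_deriv e g z) + p (partial_deriv e f z) (g z)"])
    show "((\<lambda>z. p (f z) (g z)) has_derivative
        (\<lambda>e. p (f z) (partial_deriv e g z) + p (partial_deriv e f z) (g z))) (at z)" for z
      by (rule bounded_bilinear.FDERIV[OF p C_k_has_derivative[OF Suc.prems(1)] C_k_has_derivative[OF Suc.prems(2)]])
    show "C_k k (\<lambda>z. p (f z) (partial_deriv 1 g z) + p (partial_deriv 1 f z) (g z))"
      by (intro C_k_add Suc.IH C_k_partial[OF Suc.prems(1)] C_k_partial[OF Suc.prems(2)] C_k_SucD[OF Suc.prems(1)]
          C_k_SucD[OF Suc.prems(2)]) auto
    show "C_k k (\<lambda>z. p (f z) (partial_deriv \<i> g z) + p (partial_deriv \<i> f z) (g z))"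
      by (intro C_k_add Suc.IH C_k_partial[OF Suc.prems(1)] C_k_partial[OF Suc.prems(2)] C_k_SucD[OF Suc.prems(1)]
          C_k_SucD[OF Suc.prems(2)]) auto
  qed
qed

lemma partial_deriv_add:
  "C_k (Suc k) f \<Longrightarrow> C_k (Suc k) g \<Longrightarrow>
    partial_deriv e (\<lambda>z. f z + g z) z = partial_deriv e f z + partial_deriv e g z"
  by (rule partial_deriv_eqI[OF has_derivative_add[OF C_k_has_derivative C_k_has_derivative]])

lemma partial_deriv_bounded_linear:
  "bounded_linear T \<Longrightarrow> C_k (Suc k) f \<Longrightarrow> partial_deriv e (\<lambda>z. T (f z)) z = T (partial_deriv e f z)"
  by (rule partial_deriv_eqI[OF bounded_linear.has_derivative[OF _ C_k_has_derivative]])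

lemma partial_deriv_bilinear:
  "bounded_bilinear p \<Longrightarrow> C_k (Suc k) f \<Longrightarrow> C_k (Suc k) g \<Longrightarrow>
    partial_deriv e (\<lambda>z. p (f z) (g z)) z = p (f z) (partial_deriv e g z) + p (partial_deriv e f z) (g z)"
  by (rule partial_deriv_eqI[OF bounded_bilinear.FDERIV[OF _ C_k_has_derivative C_k_has_derivative]])

text \<open>A finite order records the loss of one derivative at each differentiation. Any compact
  set outside of which \<open>f\<close> vanishes will do, instead of the closed support itself, so
  sums and products need no computation of supports.\<close>

definition C_k_compact :: "nat \<Rightarrow> complex set \<Rightarrow> (complex \<Rightarrow> 'a::real_normed_vector) \<Rightarrow> bool" where
  "C_k_compact k \<Omega> f \<longleftrightarrow> C_k k f \<and> (\<exists>K. compact K \<and> K \<subseteq> \<Omega> \<and> (\<forall>z. z \<notin> K \<longrightarrow> f z = 0))"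

lemma C_k_compactE:
  assumes "C_k_compact k \<Omega> f"
  obtains K where "compact K" "K \<subseteq> \<Omega>" "\<And>z. z \<notin> K \<Longrightarrow> f z = 0"
  using assms by (auto simp: C_k_compact_def)

lemma C_k_compact_C_k: "C_k_compact k \<Omega> f \<Longrightarrow> C_k k f"
  by (simp add: C_k_compact_def)

lemma test_funs_iff: "\<phi> \<in> test_funs \<Omega> \<longleftrightarrow> (\<forall>k. C_k_compact k \<Omega> \<phi>)"
proof
  assume "\<phi> \<in> test_funs \<Omega>"
  moreover have "\<phi> z = 0" if "z \<notin> closure {z. \<phi> z \<noteq> 0}" for z
    using that closure_subset[of "{z. \<phi> z \<noteq> 0}"] by auto
  ultimately show "\<forall>k. C_k_compact k \<Omega> \<phi>"
    unfolding test_funs_def C_k_compact_def by blast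
next
  assume *: "\<forall>k. C_k_compact k \<Omega> \<phi>"
  then obtain K where K: "compact K" "K \<subseteq> \<Omega>" "\<And>z. z \<notin> K \<Longrightarrow> \<phi> z = 0"
    using C_k_compactE[of 0 \<Omega> \<phi>] by blast
  have "closure {z. \<phi> z \<noteq> 0} \<subseteq> K"
    using K by (intro closure_minimal) (auto simp: compact_imp_closed)
  moreover from this have "compact (closure {z. \<phi> z \<noteq> 0})"
    using K(1) by (meson bounded_subset compact_closure compact_imp_bounded closure_subset order_trans)
  ultimately show "\<phi> \<in> test_funs \<Omega>"
    using * K(2) by (auto simp: test_funs_def C_k_compact_def)
qed

lemma C_k_compact_add:
  assumes "C_k_compact k \<Omega> f" "C_k_compact k \<Omega> g"
  shows "C_k_compact k \<Omega> (\<lambda>z. f z + g z)"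
proof -
  obtain K L where "compact K" "K \<subseteq> \<Omega>" "\<And>z. z \<notin> K \<Longrightarrow> f z = 0" "compact L" "L \<subseteq> \<Omega>" "\<And>z. z \<notin> L \<Longrightarrow> g z = 0"
    using assms by (metis C_k_compactE)
  hence "compact (K \<union> L) \<and> K \<union> L \<subseteq> \<Omega> \<and> (\<forall>z. z \<notin> K \<union> L \<longrightarrow> f z + g z = 0)"
    by auto
  thus ?thesis using assms C_k_add unfolding C_k_compact_def by blast
qed

lemma C_k_compact_bounded_linear:
  assumes T: "bounded_linear T" and "C_k_compact k \<Omega> f"
  shows "C_k_compact k \<Omega> (\<lambda>z. T (f z))"
proof -
  have "T 0 = 0" using T by (simp add: bounded_linear.linear linear_0)
  thus ?thesis
    using assms C_k_bounded_linear[OF T] unfolding C_k_compact_def by metis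
qed

lemma C_k_compact_bilinear:
  assumes p: "bounded_bilinear p" and "C_k_compact k \<Omega> f" "C_k k g"
  shows "C_k_compact k \<Omega> (\<lambda>z. p (f z) (g z))"
proof -
  have "p 0 y = 0" for y using bounded_bilinear.zero_left[OF p] .
  thus ?thesis
    using assms C_k_bilinear[OF p] unfolding C_k_compact_def by metis
qed

lemma C_k_compact_le: "C_k_compact k \<Omega> f \<Longrightarrow> j \<le> k \<Longrightarrow> C_k_compact j \<Omega> f"
  unfolding C_k_compact_def using C_k_le by blast

lemma C_k_compact_partial:
  assumes f: "C_k_compact (Suc k) \<Omega> f" and e: "e \<in> {1, \<i>}"
  shows "C_k_compact k \<Omega> (partial_deriv e f)"
proof -
  obtain K where K: "compact K" "K \<subseteq> \<Omega>" "\<And>z. z \<notin> K \<Longrightarrow> f z = 0"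
    using C_k_compactE[OF f] by blast
  have "partial_deriv e f z = 0" if "z \<notin> K" for z
  proof -
    have "((\<lambda>_. 0) has_derivative (\<lambda>_. 0)) (at z)" by simp
    hence "(f has_derivative (\<lambda>_. 0)) (at z)"
      by (rule has_derivative_transform_within_open[of _ _ _ _ "- K"])
        (use K that in \<open>auto simp: compact_imp_closed open_Compl\<close>)
    thus ?thesis by (rule partial_deriv_eqI)
  qed
  thus ?thesis
    using C_k_partial[OF C_k_compact_C_k[OF f] e] K unfolding C_k_compact_def by blast
qed

lemma C_k_compact_bc_d: "C_k_compact (Suc k) \<Omega> \<phi> \<Longrightarrow> C_k_compact k \<Omega> (bc_d \<phi>)"
  using C_k_compact_add[OF C_k_compact_bounded_linear[OF bounded_linear_scaleR_right[of "1/2"] C_k_compact_partial[of k \<Omega> \<phi> 1]]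
        C_k_compact_bounded_linear[OF bounded_linear_compose[OF bounded_linear_scaleR_right[of "- 1/2"]
          bounded_linear_bicomplex_mult_right[of bc_j]] C_k_compact_partial[of k \<Omega> \<phi> \<i>]]]
  by (simp add: bc_d_def[abs_def] scaleR_diff_right)

lemma C_k_compact_bc_dbar: "C_k_compact (Suc k) \<Omega> \<phi> \<Longrightarrow> C_k_compact k \<Omega> (bc_dbar \<phi>)"
  using C_k_compact_add[OF C_k_compact_bounded_linear[OF bounded_linear_scaleR_right[of "1/2"] C_k_compact_partial[of k \<Omega> \<phi> 1]]
        C_k_compact_bounded_linear[OF bounded_linear_compose[OF bounded_linear_scaleR_right[of "1/2"]
          bounded_linear_bicomplex_mult_right[of bc_j]] C_k_compact_partial[of k \<Omega> \<phi> \<i>]]]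
  by (simp add: bc_dbar_def[abs_def] scaleR_add_right)

lemma bc_valued_test_funs_iff: "\<phi> \<in> bc_valued (test_funs \<Omega>) \<longleftrightarrow> (\<forall>k. C_k_compact k \<Omega> \<phi>)"
proof
  assume "\<phi> \<in> bc_valued (test_funs \<Omega>)"
  hence "C_k_compact k \<Omega> (\<lambda>z. Bicomplex (Sc (\<phi> z)) 0 + Bicomplex 0 (Vec (\<phi> z)))" for k
    by (intro C_k_compact_add C_k_compact_bounded_linear[OF bounded_linear_Bicomplex_Sc]
        C_k_compact_bounded_linear[OF bounded_linear_Bicomplex_Vec]) (auto simp: bc_valued_def test_funs_iff)
  thus "\<forall>k. C_k_compact k \<Omega> \<phi>" by (simp flip: bicomplex_split)
qed (auto simp: bc_valued_def test_funs_iff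
    intro: C_k_compact_bounded_linear bounded_linear_Sc bounded_linear_Vec)

lemma C_k_compact_bounded:
  assumes "C_k_compact k \<Omega> f"
  obtains B where "0 \<le> B" "\<And>z. norm (f z) \<le> B"
proof -
  obtain K where K: "compact K" "K \<subseteq> \<Omega>" "\<And>z. z \<notin> K \<Longrightarrow> f z = 0"
    using C_k_compactE[OF assms] by blast
  have "continuous_on K f"
    using C_k_continuous[OF C_k_compact_C_k[OF assms]] continuous_on_subset by blast
  hence "bounded (f ` K)" using K(1) by (intro compact_imp_bounded compact_continuous_image)
  then obtain B where B: "\<And>z. z \<in> K \<Longrightarrow> norm (f z) \<le> B" by (auto simp: bounded_iff)
  have "norm (f z) \<le> max 0 B" for z
    using B[of z] K(3)[of z] by (cases "z \<in> K") auto
  thus ?thesis using that[of "max 0 B"] by auto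
qed

lemma C_k_compact_integrable:
  fixes f :: "complex \<Rightarrow> 'a::euclidean_space"
  assumes "C_k_compact k \<Omega> f"
  shows "integrable lborel f"
proof -
  obtain K where K: "compact K" "K \<subseteq> \<Omega>" "\<And>z. z \<notin> K \<Longrightarrow> f z = 0"
    using C_k_compactE[OF assms] by blast
  have "integrable lborel (\<lambda>z. indicator K z *\<^sub>R f z)"
    using C_k_continuous[OF C_k_compact_C_k[OF assms]] K(1)
    by (intro borel_integrable_compact) (auto intro: continuous_on_subset)
  moreover have "(\<lambda>z. indicator K z *\<^sub>R f z) = f"
    using K(3) by (auto simp: indicator_def)
  ultimately show ?thesis by simp
qed

text \<open>Moves integrals from the domain to the whole plane, where Lebesgue measure is
  translation invariant; this is how integration by parts on \<Omega> is reduced to the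
  plane.\<close>

lemma C_k_compact_integrable_on:
  fixes f :: "complex \<Rightarrow> 'a::euclidean_space"
  assumes "C_k_compact k \<Omega> f" "open \<Omega>"
  shows "integrable (lebesgue_on \<Omega>) f" "(\<integral>z. f z \<partial>lebesgue_on \<Omega>) = (\<integral>z. f z \<partial>lborel)"
proof -
  have 0: "indicator \<Omega> z *\<^sub>R f z = f z" for z
    using assms by (auto simp: indicator_def C_k_compact_def)
  have m: "\<Omega> \<inter> space lebesgue \<in> sets lebesgue" using assms(2) by auto
  have i: "integrable lborel f" by (rule C_k_compact_integrable[OF assms(1)])
  hence i': "integrable lebesgue f" "(\<integral>z. f z \<partial>lebesgue) = (\<integral>z. f z \<partial>lborel)"
    using integrable_completion[of f lborel] integral_completion[of f lborel] by auto
  show "integrable (lebesgue_on \<Omega>) f"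
    by (simp add: integrable_restrict_space[OF m] 0 i')
  show "(\<integral>z. f z \<partial>lebesgue_on \<Omega>) = (\<integral>z. f z \<partial>lborel)"
    by (simp add: integral_restrict_space[OF m] 0 i')
qed

lemma C_k_compact_sq_integrable:
  fixes f :: "complex \<Rightarrow> 'a::euclidean_space"
  assumes "C_k_compact k \<Omega> f" "open \<Omega>"
  shows "sq_integrable (lebesgue_on \<Omega>) f"
proof -
  have "C_k_compact 0 \<Omega> (\<lambda>z. f z \<bullet> f z)"
    using C_k_compact_le[OF assms(1), of 0]
    by (intro C_k_compact_bilinear[OF bounded_bilinear_inner]) (auto simp: C_k_compact_def)
  thus ?thesis
    using C_k_compact_integrable_on[OF assms] C_k_compact_integrable_on(1)[OF _ assms(2), of 0 "\<lambda>z. f z \<bullet> f z"]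
    by (auto simp: sq_integrable_def power2_norm_eq_inner)
qed


section \<open>Bump functions\<close>

text \<open>The whole family in \<open>m\<close> is needed for smoothness: the derivative of
  exp(-1/t) / t^m is a combination of the members of orders m + 2 and m + 1, so the family is closed
  under differentiation up to linear combinations.\<close>

definition exp_bump :: "nat \<Rightarrow> real \<Rightarrow> real" where
  "exp_bump m t = (if t \<le> 0 then 0 else exp (- 1 / t) / t ^ m)"

text \<open>From exp(1/t) \<ge> (1 + 1/(n t))^n with n = m + 2. Dividing by t^m leaves two powers of
  t, one more than is needed for derivative 0 at the origin.\<close>

lemma exp_bump_le: "\<bar>exp_bump m t\<bar> \<le> real (m + 2) ^ (m + 2) * t\<^sup>2"
proof (cases "t \<le> 0")
  case False
  define n where "n = m + 2"
  have "(1 / t / real n) ^ n \<le> (1 + 1 / t / real n) ^ n"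
    using False by (intro power_mono) auto
  also have "\<dots> \<le> exp (1 / t)"
    using False by (intro exp_ge_one_plus_x_over_n_power_n) (auto simp: n_def intro: order_trans[of _ 0])
  finally have "1 / (t * real n) ^ n \<le> exp (1 / t)"
    by (simp add: power_divide power_mult_distrib field_simps)
  hence "inverse (exp (1 / t)) \<le> inverse (1 / (t * real n) ^ n)"
    using False by (intro le_imp_inverse_le) (auto simp: n_def)
  hence "exp (- 1 / t) \<le> (t * real n) ^ n"
    by (simp add: exp_minus[symmetric])
  hence "exp (- 1 / t) / t ^ m \<le> (t * real n) ^ n / t ^ m"
    using False by (intro divide_right_mono) auto
  also have "\<dots> = real (m + 2) ^ (m + 2) * t\<^sup>2"
    using False by (simp add: n_def power_mult_distrib power_add power2_eq_square)
  finally show ?thesis using False by (simp add: exp_bump_def)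
qed (simp add: exp_bump_def)

lemma DERIV_exp_bump:
  "(exp_bump m has_real_derivative (exp_bump (m + 2) t - real m * exp_bump (m + 1) t)) (at t)"
proof -
  consider "t < 0" | "t > 0" | "t = 0" by linarith
  thus ?thesis
  proof cases
    case 1
    have "((\<lambda>_. 0) has_real_derivative 0) (at t)" by simp
    hence "(exp_bump m has_real_derivative 0) (at t)"
      by (rule DERIV_cong_ev[THEN iffD1, rotated -1])
        (use 1 in \<open>auto simp: exp_bump_def eventually_at_filter eventually_nhds intro!: exI[of _ "{..<0}"]\<close>)
    thus ?thesis using 1 by (simp add: exp_bump_def)
  next
    case 2
    have "((\<lambda>t. exp (- 1 / t) / t ^ m) has_real_derivative
        (exp (- 1 / t) / t ^ (m + 2) - real m * (exp (- 1 / t) / t ^ (m + 1)))) (at t)"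
      using 2
      by (auto intro!: derivative_eq_intros simp: field_simps power2_eq_square power_add)
        (cases m; simp add: field_simps)
    hence "(exp_bump m has_real_derivative
        (exp (- 1 / t) / t ^ (m + 2) - real m * (exp (- 1 / t) / t ^ (m + 1)))) (at t)"
      by (rule DERIV_cong_ev[THEN iffD1, rotated -1])
        (use 2 in \<open>auto simp: exp_bump_def eventually_nhds intro!: exI[of _ "{0<..}"]\<close>)
    thus ?thesis using 2 by (simp add: exp_bump_def)
  next
    case 3
    have "((\<lambda>h. exp_bump m h / h) \<longlongrightarrow> 0) (at 0)"
    proof (rule Lim_null_comparison)
      have "norm (exp_bump m h / h) \<le> real (m + 2) ^ (m + 2) * \<bar>h\<bar>" if "h \<noteq> 0" for h
      proof -
        have "\<bar>exp_bump m h\<bar> \<le> (real (m + 2) ^ (m + 2) * \<bar>h\<bar>) * \<bar>h\<bar>"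
          using exp_bump_le[of m h] by (simp only: power2_eq_square abs_mult_self_eq mult.assoc)
        thus ?thesis using that by (simp add: abs_divide divide_le_eq)
      qed
      thus "\<forall>\<^sub>F h in at 0. norm (exp_bump m h / h) \<le> real (m + 2) ^ (m + 2) * \<bar>h\<bar>"
        by (auto simp: eventually_at_filter)
      show "((\<lambda>h. real (m + 2) ^ (m + 2) * \<bar>h\<bar>) \<longlongrightarrow> 0) (at 0)"
        by (auto intro!: tendsto_eq_intros)
    qed
    thus ?thesis using 3 by (simp add: DERIV_def exp_bump_def)
  qed
qed

text \<open>Using the squared distance keeps the inner function polynomial, hence smooth at the
  centre too; the values are complex so that it is itself a test function.\<close>

definition ball_bump :: "complex \<Rightarrow> real \<Rightarrow> nat \<Rightarrow> complex \<Rightarrow> complex" where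
  "ball_bump c r m z = of_real (exp_bump m (r\<^sup>2 - (norm (z - c))\<^sup>2))"

lemma C_k_ball_bump: "C_k k (ball_bump c r m)"
proof (induction k arbitrary: m)
  case 0
  have "isCont (exp_bump m) t" for t
    using DERIV_exp_bump DERIV_isCont by blast
  hence "continuous_on UNIV (exp_bump m)" by (simp add: continuous_on_eq_continuous_at)
  hence "continuous_on UNIV (\<lambda>z. exp_bump m (r\<^sup>2 - (norm (z - c))\<^sup>2))"
    by (rule continuous_on_compose2) (auto intro!: continuous_intros)
  thus ?case unfolding ball_bump_def by (auto intro!: continuous_intros)
next
  case (Suc k)
  define D where "D z = exp_bump (m + 2) (r\<^sup>2 - (norm (z - c))\<^sup>2) - real m * exp_bump (m + 1) (r\<^sup>2 - (norm (z - c))\<^sup>2)"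
    for z
  have DC: "complex_of_real (D z) = ball_bump c r (m + 2) z + of_real (- real m) * ball_bump c r (m + 1) z" for z
    by (simp add: D_def ball_bump_def)
  have part: "C_k k (\<lambda>z. of_real (D z * (- 2 * ((z - c) \<bullet> e))) :: complex)" for e
  proof -
    have "C_k k (\<lambda>z. (-2 :: complex) * (of_real ((z - c) \<bullet> e) * complex_of_real (D z)))"
    proof (intro C_k_bilinear[OF bounded_bilinear_mult] C_k_const)
      show "C_k k (\<lambda>z. complex_of_real ((z - c) \<bullet> e))"
        using C_k_add[OF C_k_linear[OF bounded_linear_compose[OF bounded_linear_of_real
              bounded_linear_inner_left[of e]]] C_k_const[of k "- complex_of_real (c \<bullet> e)"]]
        by (simp add: inner_diff_left)
      show "C_k k (\<lambda>z. complex_of_real (D z))"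
        unfolding DC by (intro C_k_add C_k_bilinear[OF bounded_bilinear_mult] C_k_const Suc)
    qed
    thus ?thesis by (simp add: mult.commute mult.left_commute)
  qed
  show ?case
  proof (rule C_k_SucI[where f'="\<lambda>z e. of_real (D z * (- 2 * ((z - c) \<bullet> e)))"])
    fix z
    have "((\<lambda>z. r\<^sup>2 - (norm (z - c))\<^sup>2) has_derivative (\<lambda>e. - 2 * ((z - c) \<bullet> e))) (at z)"
      unfolding power2_norm_eq_inner
      by (auto intro!: derivative_eq_intros simp: inner_commute)
    hence "((\<lambda>z. exp_bump m (r\<^sup>2 - (norm (z - c))\<^sup>2)) has_derivative (\<lambda>e. D z * (- 2 * ((z - c) \<bullet> e)))) (at z)"
      using has_derivative_compose[OF _ DERIV_exp_bump[unfolded has_field_derivative_def]]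
      unfolding D_def by blast
    thus "(ball_bump c r m has_derivative (\<lambda>e. of_real (D z * (- 2 * ((z - c) \<bullet> e))))) (at z)"
      unfolding ball_bump_def by (rule has_derivative_of_real)
  qed (use part[of 1] part[of \<i>] in auto)
qed

lemma ball_bump_eq_0_iff: "r > 0 \<Longrightarrow> ball_bump c r m z = 0 \<longleftrightarrow> z \<notin> ball c r"
proof -
  assume "r > 0"
  hence "r\<^sup>2 \<le> (norm (z - c))\<^sup>2 \<longleftrightarrow> r \<le> norm (z - c)"
    using abs_le_square_iff[of r "norm (z - c)"] by simp
  thus ?thesis
    by (auto simp: ball_bump_def exp_bump_def dist_norm norm_minus_commute)
qed

lemma C_k_compact_ball_bump: "r > 0 \<Longrightarrow> cball c r \<subseteq> \<Omega> \<Longrightarrow> C_k_compact k \<Omega> (ball_bump c r m)"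
  using ball_bump_eq_0_iff[of r c m] C_k_ball_bump unfolding C_k_compact_def
  by (intro conjI exI[of _ "cball c r"]) auto


section \<open>Integration by parts and the Poincare inequality\<close>

lemma C_k_compact_mono: "C_k_compact k \<Omega> f \<Longrightarrow> \<Omega> \<subseteq> \<Omega>' \<Longrightarrow> C_k_compact k \<Omega>' f"
  unfolding C_k_compact_def by blast

lemma C_k_compact_shift:
  assumes "C_k_compact 0 UNIV f"
  shows "C_k_compact 0 UNIV (\<lambda>z. f (z + a))"
proof -
  obtain K where K: "compact K" "K \<subseteq> UNIV" "\<And>z. z \<notin> K \<Longrightarrow> f z = 0"
    by (rule C_k_compactE[OF assms]) blast
  have "compact ((\<lambda>z. z - a) ` K)"
    by (rule compact_continuous_image[OF _ K(1)]) (intro continuous_intros)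
  moreover have "f (z + a) = 0" if "z \<notin> (\<lambda>z. z - a) ` K" for z
    using that K(3)[of "z + a"] by force
  moreover have "continuous_on UNIV (\<lambda>z. f (z + a))"
    using assms by (auto simp: C_k_compact_def intro!: continuous_on_compose2[of UNIV f] continuous_intros)
  ultimately show ?thesis unfolding C_k_compact_def by auto
qed

lemma integral_lborel_shift:
  fixes f :: "complex \<Rightarrow> 'a::euclidean_space"
  assumes "f \<in> borel_measurable borel"
  shows "(\<integral>z. f (z + a) \<partial>lborel) = (\<integral>z. f z \<partial>lborel)"
proof -
  have "(\<integral>z. f z \<partial>lborel) = (\<integral>z. f z \<partial>distr lborel borel ((+) a))"
    by (simp add: lborel_distr_plus)
  also have "\<dots> = (\<integral>z. f (a + z) \<partial>lborel)"
    using assms by (intro integral_distr) auto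
  finally show ?thesis by (simp add: add.commute)
qed

lemma C_k_compact_borel: "C_k_compact k \<Omega> f \<Longrightarrow> f \<in> borel_measurable borel"
  by (intro borel_measurable_continuous_onI C_k_continuous C_k_compact_C_k)

text \<open>The step 1/(n+1) makes the limit one over a sequence, as dominated convergence requires;
  it is positive and at most 1, so supports grow by at most 1 for unit directions.\<close>

definition diff_quot :: "complex \<Rightarrow> nat \<Rightarrow> (complex \<Rightarrow> 'a::real_normed_vector) \<Rightarrow> complex \<Rightarrow> 'a" where
  "diff_quot e n f z = real (Suc n) *\<^sub>R (f (z + (1 / real (Suc n)) *\<^sub>R e) - f z)"

lemma diff_quot_tendsto:
  assumes "C_k (Suc k) f"
  shows "(\<lambda>n. diff_quot e n f z) \<longlonglongrightarrow> partial_deriv e f z"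
proof -
  let ?\<gamma> = "\<lambda>t::real. z + t *\<^sub>R e"
  have "(f has_derivative (\<lambda>e. partial_deriv e f z)) (at (?\<gamma> 0))"
    using C_k_has_derivative[OF assms] by simp
  moreover have "(?\<gamma> has_derivative (\<lambda>t. t *\<^sub>R e)) (at 0)"
    by (auto intro!: derivative_eq_intros)
  ultimately have "((\<lambda>t. f (?\<gamma> t)) has_derivative (\<lambda>t. partial_deriv (t *\<^sub>R e) f z)) (at 0)"
    using has_derivative_compose by blast
  moreover have "partial_deriv (t *\<^sub>R e) f z = t *\<^sub>R partial_deriv e f z" for t
    by (rule linear_cmul[OF has_derivative_linear[OF C_k_has_derivative[OF assms]]])
  ultimately have "((\<lambda>t. f (?\<gamma> t)) has_derivative (\<lambda>t. t *\<^sub>R partial_deriv e f z)) (at 0)"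
    by simp
  hence lim: "((\<lambda>t. norm (f (?\<gamma> t) - f z - t *\<^sub>R partial_deriv e f z) / norm t) \<longlongrightarrow> 0) (at 0)"
    by (simp add: has_derivative_at)
  have "((\<lambda>t. (f (?\<gamma> t) - f z) /\<^sub>R t) \<longlongrightarrow> partial_deriv e f z) (at 0)"
  proof (rule LIM_zero_cancel, rule tendsto_norm_zero_cancel, rule Lim_transform_eventually[OF lim])
    have "norm (f (?\<gamma> t) - f z - t *\<^sub>R partial_deriv e f z) / norm t
        = norm ((f (?\<gamma> t) - f z) /\<^sub>R t - partial_deriv e f z)" if "t \<noteq> 0" for t
    proof -
      have "f (?\<gamma> t) - f z - t *\<^sub>R partial_deriv e f z
          = t *\<^sub>R ((f (?\<gamma> t) - f z) /\<^sub>R t - partial_deriv e f z)"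
        using that by (simp add: scaleR_diff_right)
      thus ?thesis using that by simp
    qed
    thus "\<forall>\<^sub>F t in at 0. norm (f (?\<gamma> t) - f z - t *\<^sub>R partial_deriv e f z) / norm t
        = norm ((f (?\<gamma> t) - f z) /\<^sub>R t - partial_deriv e f z)"
      by (auto simp: eventually_at_filter)
  qed
  moreover have "filterlim (\<lambda>n. 1 / real (Suc n)) (at 0) sequentially"
    by (intro filterlim_atI LIMSEQ_Suc[OF lim_1_over_n]) auto
  ultimately have "(\<lambda>n. (f (?\<gamma> (1 / real (Suc n))) - f z) /\<^sub>R (1 / real (Suc n))) \<longlonglongrightarrow> partial_deriv e f z"
    by (rule filterlim_compose)
  thus ?thesis by (simp add: diff_quot_def)
qed

text \<open>Bounded partial derivatives make \<open>f\<close> Lipschitz, which bounds all quotients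
  uniformly. As steps have length at most 1, all quotients vanish outside a ball of radius one
  larger than one containing the support, so there is a single integrable majorant.\<close>

lemma diff_quot_dominated:
  fixes f :: "complex \<Rightarrow> 'a::real_normed_vector"
  assumes f: "C_k_compact (Suc 0) \<Omega> f" and e: "norm e \<le> 1"
  obtains B R where "0 \<le> B" "\<And>n z. norm (diff_quot e n f z) \<le> indicator (cball 0 R) z * B"
proof -
  obtain K where K: "compact K" "K \<subseteq> \<Omega>" "\<And>z. z \<notin> K \<Longrightarrow> f z = 0"
    by (rule C_k_compactE[OF f]) blast
  obtain R where R: "\<And>z. z \<in> K \<Longrightarrow> norm z \<le> R"
    using compact_imp_bounded[OF K(1)] by (auto simp: bounded_iff)
  obtain B1 where B1: "0 \<le> B1" "\<And>z. norm (partial_deriv 1 f z) \<le> B1"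
    using C_k_compact_bounded[OF C_k_compact_partial[OF f, of 1]] by auto
  obtain B2 where B2: "0 \<le> B2" "\<And>z. norm (partial_deriv \<i> f z) \<le> B2"
    using C_k_compact_bounded[OF C_k_compact_partial[OF f, of \<i>]] by auto
  note der = C_k_has_derivative[OF C_k_compact_C_k[OF f]]
  have "onorm (\<lambda>e. partial_deriv e f z) \<le> B1 + B2" for z
  proof (rule onorm_bound)
    fix h :: complex
    interpret linear "\<lambda>e. partial_deriv e f z" using has_derivative_linear[OF der] .
    have "h = Re h *\<^sub>R 1 + Im h *\<^sub>R \<i>" by (simp add: complex_eq_iff)
    hence "partial_deriv h f z = Re h *\<^sub>R partial_deriv 1 f z + Im h *\<^sub>R partial_deriv \<i> f z"
      by (metis add scale)
    also have "norm \<dots> \<le> \<bar>Re h\<bar> * norm (partial_deriv 1 f z) + \<bar>Im h\<bar> * norm (partial_deriv \<i> f z)"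
      by (rule order_trans[OF norm_triangle_ineq]) simp
    also have "\<dots> \<le> norm h * B1 + norm h * B2"
      by (intro add_mono mult_mono B1 B2 abs_Re_le_cmod abs_Im_le_cmod) auto
    finally show "norm (partial_deriv h f z) \<le> (B1 + B2) * norm h" by (simp add: algebra_simps)
  qed (use B1 B2 in auto)
  hence lip: "norm (f x - f y) \<le> (B1 + B2) * norm (x - y)" for x y
    using differentiable_bound[of UNIV f "\<lambda>z e. partial_deriv e f z" "B1 + B2" y x] der by (auto simp: norm_minus_commute)
  have "norm (diff_quot e n f z) \<le> indicator (cball 0 (R + 1)) z * (B1 + B2)" for n z
  proof -
    let ?h = "(1 / real (Suc n)) *\<^sub>R e"
    have h: "norm ?h \<le> 1 / real (Suc n)" using e by (simp add: divide_right_mono)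
    also have "\<dots> \<le> 1" by simp
    finally have h1: "norm ?h \<le> 1" .
    show ?thesis
    proof (cases "z \<in> cball 0 (R + 1)")
      case True
      have "norm (diff_quot e n f z) = real (Suc n) * norm (f (z + ?h) - f z)"
        by (simp add: diff_quot_def)
      also have "\<dots> \<le> real (Suc n) * ((B1 + B2) * (1 / real (Suc n)))"
        using lip[of "z + ?h" z] h B1(1) B2(1)
        by (intro mult_left_mono order_trans[OF lip[of "z + ?h" z]]) auto
      finally show ?thesis using True by simp
    next
      case False
      have "norm z \<le> norm (z + ?h) + norm ?h"
        using norm_triangle_ineq4[of "z + ?h" "?h"] by simp
      hence "\<not> norm z \<le> R" "\<not> norm (z + ?h) \<le> R"
        using False h1 unfolding mem_cball_0 by linarith+
      hence "z \<notin> K" "z + ?h \<notin> K" using R by blast+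
      thus ?thesis using K(3) False by (simp add: diff_quot_def)
    qed
  qed
  thus ?thesis using that[of "B1 + B2" "R + 1"] B1(1) B2(1) by auto
qed

lemma integrable_indicator_cball: "integrable lborel (\<lambda>z::complex. indicator (cball 0 R) z * B :: real)"
proof -
  have "integrable lborel (\<lambda>z::complex. indicator (cball 0 R) z *\<^sub>R B)"
    by (rule borel_integrable_compact) auto
  thus ?thesis by simp
qed

lemma borel_measurable_diff_quot:
  fixes f :: "complex \<Rightarrow> 'a::euclidean_space"
  assumes "f \<in> borel_measurable borel"
  shows "diff_quot e n f \<in> borel_measurable borel"
proof -
  have "(\<lambda>z. f (z + (1 / real (Suc n)) *\<^sub>R e)) \<in> borel_measurable borel"
    by (rule measurable_compose[OF _ assms]) auto
  thus ?thesis unfolding diff_quot_def using assms by auto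
qed

text \<open>By translation invariance every difference quotient has integral 0, and dominated
  convergence passes this to the derivative. Applied to products, this is integration by parts,
  without Fubini or a boundary term.\<close>

lemma integral_partial_deriv_eq_0:
  fixes f :: "complex \<Rightarrow> 'a::euclidean_space"
  assumes f: "C_k_compact (Suc 0) \<Omega> f" and e: "e \<in> {1, \<i>}"
  shows "(\<integral>z. partial_deriv e f z \<partial>lborel) = 0"
proof -
  have "norm e \<le> 1" using e by auto
  from diff_quot_dominated[OF f this]
  obtain B R where B: "0 \<le> B" "\<And>n z. norm (diff_quot e n f z) \<le> indicator (cball 0 R) z * B"
    by blast
  have fi: "integrable lborel f" and fb: "f \<in> borel_measurable borel"
    using C_k_compact_integrable[OF f] C_k_compact_borel[OF f] by auto
  have "(\<lambda>n. \<integral>z. diff_quot e n f z \<partial>lborel) \<longlonglongrightarrow> (\<integral>z. partial_deriv e f z \<partial>lborel)"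
  proof (rule integral_dominated_convergence)
    show "partial_deriv e f \<in> borel_measurable lborel"
      using C_k_compact_borel[OF C_k_compact_partial[OF f e]] by simp
    show "diff_quot e n f \<in> borel_measurable lborel" for n
      using borel_measurable_diff_quot[OF fb] by simp
    show "integrable lborel (\<lambda>z::complex. indicator (cball 0 R) z * B)"
      by (rule integrable_indicator_cball)
  qed (use B diff_quot_tendsto[OF C_k_compact_C_k[OF f]] in auto)
  moreover have "(\<integral>z. diff_quot e n f z \<partial>lborel) = 0" for n
  proof -
    let ?h = "(1 / real (Suc n)) *\<^sub>R e"
    have "C_k_compact 0 UNIV f" using C_k_compact_le[OF f] C_k_compact_mono by blast
    hence "integrable lborel (\<lambda>z. f (z + ?h))"
      by (rule C_k_compact_integrable[OF C_k_compact_shift])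
    thus ?thesis
      using fi integral_lborel_shift[OF fb, of ?h] unfolding diff_quot_def by simp
  qed
  ultimately show ?thesis by (simp add: LIMSEQ_const_iff)
qed

lemma tendsto_integral_diff_quot_inner:
  fixes u v :: "complex \<Rightarrow> 'a::euclidean_space"
  assumes u: "C_k_compact (Suc 0) \<Omega> u" and v: "C_k_compact (Suc 0) \<Omega> v"
    and a: "norm a \<le> 1" and b: "norm b \<le> 1"
  shows "(\<lambda>n. \<integral>z. diff_quot a n u z \<bullet> diff_quot b n v z \<partial>lborel)
    \<longlonglongrightarrow> (\<integral>z. partial_deriv a u z \<bullet> partial_deriv b v z \<partial>lborel)"
proof -
  obtain B R where B: "0 \<le> B" "\<And>n z. norm (diff_quot a n u z) \<le> indicator (cball 0 R) z * B"
    using diff_quot_dominated[OF u a] by blast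
  obtain B' R' where B': "0 \<le> B'" "\<And>n z. norm (diff_quot b n v z) \<le> indicator (cball 0 R') z * B'"
    using diff_quot_dominated[OF v b] by blast
  have lim: "(\<lambda>n. diff_quot a n u z \<bullet> diff_quot b n v z) \<longlonglongrightarrow> partial_deriv a u z \<bullet> partial_deriv b v z" for z
    by (intro tendsto_inner diff_quot_tendsto[OF C_k_compact_C_k[OF u]] diff_quot_tendsto[OF C_k_compact_C_k[OF v]])
  have m: "(\<lambda>z. diff_quot a n u z \<bullet> diff_quot b n v z) \<in> borel_measurable lborel" for n
    using borel_measurable_diff_quot[OF C_k_compact_borel[OF u]] borel_measurable_diff_quot[OF C_k_compact_borel[OF v]]
    by simp
  show ?thesis
  proof (rule integral_dominated_convergence)
    show "(\<lambda>z. partial_deriv a u z \<bullet> partial_deriv b v z) \<in> borel_measurable lborel"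
      by (rule borel_measurable_LIMSEQ_metric[OF m lim])
    show "AE z in lborel. norm (diff_quot a n u z \<bullet> diff_quot b n v z) \<le> indicator (cball 0 R) z * (B * B')" for n
    proof (rule AE_I2)
      fix z
      have "norm (diff_quot a n u z \<bullet> diff_quot b n v z) \<le> norm (diff_quot a n u z) * norm (diff_quot b n v z)"
        by (simp add: Cauchy_Schwarz_ineq2)
      also have "\<dots> \<le> (indicator (cball 0 R) z * B) * B'"
      proof (rule mult_mono)
        show "norm (diff_quot b n v z) \<le> B'"
          using B'(2)[of n z] B'(1) by (cases "z \<in> cball 0 R'") auto
      qed (use B(1) B(2)[of n z] in auto)
      finally show "norm (diff_quot a n u z \<bullet> diff_quot b n v z) \<le> indicator (cball 0 R) z * (B * B')"
        by (simp add: mult.assoc)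
    qed
  qed (use m lim integrable_indicator_cball in auto)
qed

text \<open>Summation by parts for the difference quotients replaces the symmetry of second derivatives.\<close>

lemma integral_diff_quot_inner_swap:
  fixes u v :: "complex \<Rightarrow> 'a::euclidean_space"
  assumes u: "C_k_compact 0 UNIV u" and v: "C_k_compact 0 UNIV v"
  shows "(\<integral>z. diff_quot a n u z \<bullet> diff_quot b n v z \<partial>lborel)
    = (\<integral>z. diff_quot (- b) n u z \<bullet> diff_quot (- a) n v z \<partial>lborel)"
proof -
  define h k where "h = (1 / real (Suc n)) *\<^sub>R a" and "k = (1 / real (Suc n)) *\<^sub>R b"
  define I where "I p q = (\<integral>z. u (z + p) \<bullet> v (z + q) \<partial>lborel)" for p q
  have c: "C_k_compact 0 UNIV (\<lambda>z. u (z + p) \<bullet> v (z + q))" for p q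
    using C_k_compact_shift[OF u, of p] C_k_compact_shift[OF v, of q]
    by (intro C_k_compact_bilinear[OF bounded_bilinear_inner]) (auto simp: C_k_compact_def)
  have i: "integrable lborel (\<lambda>z. u (z + p) \<bullet> v (z + q))" for p q
    by (rule C_k_compact_integrable[OF c])
  have shift: "I (p + r) (q + r) = I p q" for p q r
    using integral_lborel_shift[OF C_k_compact_borel[OF c[of p q]], of r]
    by (simp add: I_def add.assoc add.commute[of r])
  have ex: "(\<integral>z. (u (z + p) - u z) \<bullet> (v (z + q) - v z) \<partial>lborel) = I p q - I p 0 - I 0 q + I 0 0" for p q
    using i[of p q] i[of p 0] i[of 0 q] i[of 0 0]
    by (simp add: I_def inner_diff_left inner_diff_right)
  \<comment> \<open>By translation \<open>I p q\<close> depends only on p - q. Thus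
    \<open>I h k = I (-k) (-h)\<close>, \<open>I h 0 = I 0 (-h)\<close> and
    \<open>I 0 k = I (-k) 0\<close>, and the four terms of the expansions match.\<close>
  have "(\<integral>z. (u (z + h) - u z) \<bullet> (v (z + k) - v z) \<partial>lborel)
      = (\<integral>z. (u (z + - k) - u z) \<bullet> (v (z + - h) - v z) \<partial>lborel)"
    unfolding ex using shift[of "- k" "h + k" "- h"] shift[of "- k" k 0] shift[of 0 h "- h"]
    by (simp add: algebra_simps)
  thus ?thesis
    by (simp add: diff_quot_def h_def k_def)
qed

text \<open>Two classical integrations by parts would require second derivatives; the limit of the
  swapped difference quotients requires only first ones. The directions come back as -b and -a, and
  the two signs cancel. The purpose is to remove the cross term in |bc_d \<phi>|^2.\<close>

lemma integral_partial_inner_swap: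
  fixes u v :: "complex \<Rightarrow> 'a::euclidean_space"
  assumes u: "C_k_compact (Suc 0) \<Omega> u" and v: "C_k_compact (Suc 0) \<Omega> v"
    and a: "norm a \<le> 1" and b: "norm b \<le> 1"
  shows "(\<integral>z. partial_deriv a u z \<bullet> partial_deriv b v z \<partial>lborel)
    = (\<integral>z. partial_deriv b u z \<bullet> partial_deriv a v z \<partial>lborel)"
proof -
  have 0: "C_k_compact 0 UNIV u" "C_k_compact 0 UNIV v"
    using C_k_compact_mono[OF C_k_compact_le[OF u]] C_k_compact_mono[OF C_k_compact_le[OF v]] by auto
  have neg: "partial_deriv (- e) f z = - partial_deriv e f z" if "C_k_compact (Suc 0) \<Omega> f" for e f and z :: complex
    using has_derivative_linear[OF C_k_has_derivative[OF C_k_compact_C_k[OF that]]]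
    by (metis linear_neg)
  have "(\<lambda>n. \<integral>z. diff_quot (- b) n u z \<bullet> diff_quot (- a) n v z \<partial>lborel)
      \<longlonglongrightarrow> (\<integral>z. partial_deriv b u z \<bullet> partial_deriv a v z \<partial>lborel)"
    using tendsto_integral_diff_quot_inner[OF u v, of "- b" "- a"] a b by (simp add: neg[OF u] neg[OF v])
  hence "(\<lambda>n. \<integral>z. diff_quot a n u z \<bullet> diff_quot b n v z \<partial>lborel)
      \<longlonglongrightarrow> (\<integral>z. partial_deriv b u z \<bullet> partial_deriv a v z \<partial>lborel)"
    by (subst integral_diff_quot_inner_swap[OF 0])
  thus ?thesis
    using tendsto_integral_diff_quot_inner[OF u v a b] LIMSEQ_unique by blast
qed

text \<open>A Riccati substitution: expanding \<open>|\<phi>\<^sub>e + G \<phi>|\<^sup>2 \<ge> 0\<close> and integrating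
  \<open>2 G \<phi>\<^sub>e \<bullet> \<phi>\<close> by parts gives the weight \<open>G\<^sub>e - G\<^sup>2\<close> in front of \<open>|\<phi>|\<^sup>2\<close>. In the coordinate
  \<open>t \<in> [-1, 1]\<close> on a strip of width \<open>d\<close> the polynomial \<open>0.7 t + 0.3 t\<^sup>3\<close> makes it at least \<open>2 / d\<^sup>2\<close>;
  a linear \<open>G\<close> would only give \<open>1 / d\<^sup>2\<close>.\<close>

lemma Poincare_strip:
  fixes \<phi> :: "complex \<Rightarrow> 'a::euclidean_space"
  assumes \<phi>: "C_k_compact (Suc 0) \<Omega> \<phi>" and e: "e \<in> {1, \<i>}" and d: "d > 0"
    and strip: "\<And>z. z \<in> \<Omega> \<Longrightarrow> \<bar>z \<bullet> e - s\<bar> \<le> d / 2"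
  shows "(\<integral>z. (norm (\<phi> z))\<^sup>2 \<partial>lborel) \<le> d\<^sup>2 / 2 * (\<integral>z. (norm (partial_deriv e \<phi> z))\<^sup>2 \<partial>lborel)"
proof -
  define m where "m = d / 2"
  have m: "m > 0" using d by (simp add: m_def)
  define t where "t z = (z \<bullet> e - s) / m" for z :: complex
  define G where "G z = (7/10 * t z + 3/10 * t z ^ 3) / m" for z
  define H where "H z = (7/10 + 9/10 * (t z)\<^sup>2) / m\<^sup>2" for z
  have ee: "e \<bullet> e = 1" using e by auto
  have td: "(t has_derivative (\<lambda>h. (h \<bullet> e) / m)) (at z)" for z
    unfolding t_def[abs_def] using m by (auto intro!: derivative_eq_intros)
  have Gd: "(G has_derivative (\<lambda>h. H z * (h \<bullet> e))) (at z)" for z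
    unfolding G_def[abs_def] using m
    by (auto intro!: derivative_eq_intros td simp: H_def add_divide_distrib power2_eq_square algebra_simps)
  have cont: "continuous_on UNIV H"
    unfolding H_def t_def using m by (auto intro!: continuous_intros)
  have G1: "C_k (Suc 0) G"
    by (rule C_k_SucI[OF Gd]) (use cont in \<open>auto intro!: continuous_intros\<close>)
  have pG: "partial_deriv e G z = H z" for z
    using partial_deriv_eqI[OF Gd] ee by simp
  have HG: "1 / (2 * m\<^sup>2) \<le> H z - (G z)\<^sup>2" if "z \<in> \<Omega>" for z
  proof -
    define x where "x = (t z)\<^sup>2"
    have "\<bar>z \<bullet> e - s\<bar> \<le> m" using strip[OF that] by (simp add: m_def)
    hence "\<bar>t z\<bar> \<le> 1" using m by (simp add: t_def abs_divide)
    hence x: "0 \<le> x" "x \<le> 1" by (auto simp: x_def abs_square_le_1)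
    have "x\<^sup>2 \<le> 1 * x" "x ^ 3 \<le> 1 * x"
      using x mult_right_mono[of x 1 x] mult_mono[of x 1 "x\<^sup>2" x] by (auto simp: power2_eq_square power3_eq_cube mult_left_le)
    \<comment> \<open>The coefficients of the squared polynomial sum to (7/10 + 3/10)^2 = 1.
      Bounding x^2 and x^3 by x therefore leaves 7/10 - x/10, which is at least 6/10.\<close>
    hence "1/2 \<le> 7/10 + 9/10 * x - (49/100 * x + 42/100 * x\<^sup>2 + 9/100 * x ^ 3)"
      using x by simp
    also have "49/100 * x + 42/100 * x\<^sup>2 + 9/100 * x ^ 3 = (7/10 * t z + 3/10 * t z ^ 3)\<^sup>2"
      by (simp add: x_def power2_eq_square power3_eq_cube algebra_simps)
    finally have "1/2 / m\<^sup>2 \<le> (7/10 + 9/10 * (t z)\<^sup>2 - (7/10 * t z + 3/10 * t z ^ 3)\<^sup>2) / m\<^sup>2"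
      by (intro divide_right_mono) (auto simp: x_def)
    thus ?thesis by (simp add: H_def G_def power_divide diff_divide_distrib)
  qed
  define \<psi> where "\<psi> z = (\<phi> z \<bullet> \<phi> z) * G z" for z
  have pp1: "C_k_compact (Suc 0) \<Omega> (\<lambda>z. \<phi> z \<bullet> \<phi> z)"
    by (rule C_k_compact_bilinear[OF bounded_bilinear_inner \<phi> C_k_compact_C_k[OF \<phi>]])
  have \<psi>1: "C_k_compact (Suc 0) \<Omega> \<psi>"
    unfolding \<psi>_def by (rule C_k_compact_bilinear[OF bounded_bilinear_mult pp1 G1])
  have p\<psi>: "partial_deriv e \<psi> z = (\<phi> z \<bullet> \<phi> z) * H z + 2 * (partial_deriv e \<phi> z \<bullet> \<phi> z) * G z" for z
    unfolding \<psi>_def[abs_def] partial_deriv_bilinear[OF bounded_bilinear_mult C_k_compact_C_k[OF pp1] G1]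
      partial_deriv_bilinear[OF bounded_bilinear_inner C_k_compact_C_k[OF \<phi>] C_k_compact_C_k[OF \<phi>]] pG
    by (simp add: inner_commute)
  have le: "2 / d\<^sup>2 * (norm (\<phi> z))\<^sup>2 \<le> (norm (partial_deriv e \<phi> z))\<^sup>2 + partial_deriv e \<psi> z" for z
  proof -
    have "2 / d\<^sup>2 * (norm (\<phi> z))\<^sup>2 \<le> (H z - (G z)\<^sup>2) * (norm (\<phi> z))\<^sup>2"
    proof (cases "z \<in> \<Omega>")
      case True
      have "2 / d\<^sup>2 = 1 / (2 * m\<^sup>2)" using d by (simp add: m_def power2_eq_square field_simps)
      thus ?thesis using HG[OF True] by (intro mult_right_mono) auto
    next
      case False
      hence "\<phi> z = 0" using \<phi> by (auto simp: C_k_compact_def)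
      thus ?thesis by simp
    qed
    also have "\<dots> \<le> (H z - (G z)\<^sup>2) * (norm (\<phi> z))\<^sup>2 + (norm (partial_deriv e \<phi> z + G z *\<^sub>R \<phi> z))\<^sup>2"
      by simp
    also have "\<dots> = (norm (partial_deriv e \<phi> z))\<^sup>2 + partial_deriv e \<psi> z"
      unfolding p\<psi> power2_norm_eq_inner
      by (simp add: inner_add inner_commute algebra_simps power2_eq_square)
    finally show ?thesis .
  qed
  have sq: "integrable lborel (\<lambda>z. (norm (f z))\<^sup>2)" if "C_k_compact 0 \<Omega> f" for f :: "complex \<Rightarrow> 'a"
    unfolding power2_norm_eq_inner using that
    by (intro C_k_compact_integrable[of 0 \<Omega>] C_k_compact_bilinear[OF bounded_bilinear_inner])
      (auto simp: C_k_compact_def)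
  have i1: "integrable lborel (\<lambda>z. (norm (\<phi> z))\<^sup>2)"
    using sq[OF C_k_compact_le[OF \<phi>]] by simp
  have i2: "integrable lborel (\<lambda>z. (norm (partial_deriv e \<phi> z))\<^sup>2)"
    by (rule sq[OF C_k_compact_partial[OF \<phi> e]])
  have i3: "integrable lborel (partial_deriv e \<psi>)"
    by (rule C_k_compact_integrable[OF C_k_compact_partial[OF \<psi>1 e]])
  have "2 / d\<^sup>2 * (\<integral>z. (norm (\<phi> z))\<^sup>2 \<partial>lborel) = (\<integral>z. 2 / d\<^sup>2 * (norm (\<phi> z))\<^sup>2 \<partial>lborel)"
    by simp
  also have "\<dots> \<le> (\<integral>z. (norm (partial_deriv e \<phi> z))\<^sup>2 + partial_deriv e \<psi> z \<partial>lborel)"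
    using le i1 i2 i3 by (intro integral_mono) auto
  also have "\<dots> = (\<integral>z. (norm (partial_deriv e \<phi> z))\<^sup>2 \<partial>lborel)"
    using i2 i3 integral_partial_deriv_eq_0[OF \<psi>1 e] by simp
  finally show ?thesis using d by (simp add: field_simps)
qed

section \<open>Estimates in terms of the diameter\<close>

lemma ex_strip:
  fixes \<Omega> :: "complex set"
  assumes "bounded \<Omega>" "\<Omega> \<noteq> {}" "norm e = 1"
  obtains s where "\<And>z. z \<in> \<Omega> \<Longrightarrow> \<bar>z \<bullet> e - s\<bar> \<le> diameter \<Omega> / 2"
proof -
  let ?P = "(\<lambda>z. z \<bullet> e) ` \<Omega>"
  have "bounded ?P"
    by (rule bounded_linear_image[OF assms(1) bounded_linear_inner_left])
  hence b: "bdd_above ?P" "bdd_below ?P"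
    by (auto dest: bounded_imp_bdd_above bounded_imp_bdd_below)
  have dist: "z \<bullet> e \<le> w \<bullet> e + diameter \<Omega>" if "z \<in> \<Omega>" "w \<in> \<Omega>" for z w
  proof -
    have "(z - w) \<bullet> e \<le> norm (z - w) * norm e" by (rule norm_cauchy_schwarz)
    also have "\<dots> \<le> diameter \<Omega>"
      using diameter_bounded_bound[OF assms(1) that] assms(3) by (simp add: dist_norm)
    finally show ?thesis by (simp add: inner_diff_left)
  qed
  have "Sup ?P \<le> Inf ?P + diameter \<Omega>"
  proof (rule cSup_least)
    fix x assume "x \<in> ?P"
    then obtain z where z: "z \<in> \<Omega>" "x = z \<bullet> e" by blast
    have "x - diameter \<Omega> \<le> Inf ?P"
      using assms(2) dist[OF z(1)] z(2) by (intro cInf_greatest) (auto simp: algebra_simps)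
    thus "x \<le> Inf ?P + diameter \<Omega>" by simp
  qed (use assms(2) in auto)
  \<comment> \<open>The centre is the midpoint of the projection of \<Omega>, an interval hull of
    length at most the diameter. Centring at a point of \<Omega> would only give distance d in place
    of d / 2.\<close>
  hence "\<bar>z \<bullet> e - (Sup ?P + Inf ?P) / 2\<bar> \<le> diameter \<Omega> / 2" if "z \<in> \<Omega>" for z
    using cSup_upper[OF imageI[OF that] b(1)] cInf_lower[OF imageI[OF that] b(2)] unfolding abs_le_iff by (simp add: field_simps)
  thus ?thesis using that by blast
qed

lemma diameter_open_pos:
  fixes \<Omega> :: "complex set"
  assumes "open \<Omega>" "bounded \<Omega>" "\<Omega> \<noteq> {}"
  shows "diameter \<Omega> > 0"
proof -
  obtain z r where z: "z \<in> \<Omega>" "r > 0" "ball z r \<subseteq> \<Omega>"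
    using assms(1,3) by (meson ex_in_conv openE)
  hence "z + of_real (r / 2) \<in> \<Omega>" by (auto simp: dist_norm)
  from diameter_bounded_bound[OF assms(2) z(1) this] show ?thesis
    using z(2) by (simp add: dist_norm)
qed

text \<open>The cross term (Sc \<phi>_x . Vec \<phi>_y - Sc \<phi>_y . Vec \<phi>_x) / 2 does not
  vanish pointwise, but it is a null Lagrangian: its integral is 0 for compact support.\<close>

lemma integral_norm_bc_d:
  assumes \<phi>: "C_k_compact (Suc 0) \<Omega> \<phi>"
  shows "(\<integral>z. (norm (bc_d \<phi> z))\<^sup>2 \<partial>lborel)
    = ((\<integral>z. (norm (partial_deriv 1 \<phi> z))\<^sup>2 \<partial>lborel) + (\<integral>z. (norm (partial_deriv \<i> \<phi> z))\<^sup>2 \<partial>lborel)) / 4"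
proof -
  let ?x = "partial_deriv 1 \<phi>" and ?y = "partial_deriv \<i> \<phi>"
  have cx: "C_k_compact 0 \<Omega> ?x" and cy: "C_k_compact 0 \<Omega> ?y"
    by (rule C_k_compact_partial[OF \<phi>]; simp)+
  have inn: "integrable lborel (\<lambda>z. f z \<bullet> g z)" if "C_k_compact 0 \<Omega> f" "C_k_compact 0 \<Omega> g"
    for f g :: "complex \<Rightarrow> 'a::euclidean_space"
    using that by (intro C_k_compact_integrable[of 0 \<Omega>] C_k_compact_bilinear[OF bounded_bilinear_inner])
      (auto simp: C_k_compact_def)
  note S = C_k_compact_bounded_linear[OF bounded_linear_Sc] and V = C_k_compact_bounded_linear[OF bounded_linear_Vec]
  have pS: "partial_deriv e (\<lambda>z. Sc (\<phi> z)) z = Sc (partial_deriv e \<phi> z)"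
    and pV: "partial_deriv e (\<lambda>z. Vec (\<phi> z)) z = Vec (partial_deriv e \<phi> z)" for e z
    by (rule partial_deriv_bounded_linear[OF bounded_linear_Sc C_k_compact_C_k[OF \<phi>]]
          partial_deriv_bounded_linear[OF bounded_linear_Vec C_k_compact_C_k[OF \<phi>]])+
  have swap: "(\<integral>z. Sc (?x z) \<bullet> Vec (?y z) \<partial>lborel) = (\<integral>z. Sc (?y z) \<bullet> Vec (?x z) \<partial>lborel)"
    using integral_partial_inner_swap[OF S[OF \<phi>] V[OF \<phi>], of 1 \<i>] by (simp add: pS pV)
  have "(norm (bc_d \<phi> z))\<^sup>2 = ((norm (?x z))\<^sup>2 + (norm (?y z))\<^sup>2) / 4
      + (Sc (?x z) \<bullet> Vec (?y z) - Sc (?y z) \<bullet> Vec (?x z)) / 2" for z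
    unfolding bc_d_def
    by (simp add: power2_norm_eq_inner inner_bicomplex_def inner_diff inner_add inner_commute field_simps)
  thus ?thesis
    using swap inn[OF cx cx] inn[OF cy cy] inn[OF S[OF cx] V[OF cy]] inn[OF S[OF cy] V[OF cx]]
    by (simp add: power2_norm_eq_inner)
qed

lemma bc_d_bounds:
  fixes \<phi> :: "complex \<Rightarrow> bicomplex"
  assumes \<phi>: "C_k_compact (Suc 0) \<Omega> \<phi>" and \<Omega>: "open \<Omega>" "bounded \<Omega>" "\<Omega> \<noteq> {}"
  defines "M \<equiv> lebesgue_on \<Omega>"
  shows "sq_norm M \<phi> \<le> diameter \<Omega> * sq_norm M (bc_d \<phi>)"
    and "sq_norm M (partial_deriv 1 \<phi>) \<le> 2 * sq_norm M (bc_d \<phi>)"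
    and "sq_norm M (partial_deriv \<i> \<phi>) \<le> 2 * sq_norm M (bc_d \<phi>)"
proof -
  have d: "diameter \<Omega> > 0" by (rule diameter_open_pos[OF \<Omega>])
  have I: "(sq_norm M f)\<^sup>2 = (\<integral>z. (norm (f z))\<^sup>2 \<partial>lborel)" if "C_k_compact 0 \<Omega> f" for f :: "complex \<Rightarrow> bicomplex"
    unfolding sq_norm_power2 power2_norm_eq_inner M_def
    by (rule C_k_compact_integrable_on(2)[OF C_k_compact_bilinear[OF bounded_bilinear_inner that C_k_compact_C_k[OF that]] \<Omega>(1)])
  have cx: "C_k_compact 0 \<Omega> (partial_deriv 1 \<phi>)" and cy: "C_k_compact 0 \<Omega> (partial_deriv \<i> \<phi>)"
    by (rule C_k_compact_partial[OF \<phi>]; simp)+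
  have cd: "C_k_compact 0 \<Omega> (bc_d \<phi>)"
    by (rule C_k_compact_bc_d[OF \<phi>])
  have 1: "4 * (sq_norm M (bc_d \<phi>))\<^sup>2 = (sq_norm M (partial_deriv 1 \<phi>))\<^sup>2 + (sq_norm M (partial_deriv \<i> \<phi>))\<^sup>2"
    unfolding I[OF cd] I[OF cx] I[OF cy] integral_norm_bc_d[OF \<phi>] by simp
  have P: "(sq_norm M \<phi>)\<^sup>2 \<le> (diameter \<Omega>)\<^sup>2 / 2 * (sq_norm M (partial_deriv e \<phi>))\<^sup>2" if e: "e \<in> {1, \<i>}" for e
  proof -
    have "norm e = 1" using e by auto
    from ex_strip[OF \<Omega>(2,3) this]
    obtain s where s: "\<And>z. z \<in> \<Omega> \<Longrightarrow> \<bar>z \<bullet> e - s\<bar> \<le> diameter \<Omega> / 2" by blast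
    show ?thesis
      unfolding I[OF C_k_compact_le[OF \<phi>, of 0, simplified]] I[OF C_k_compact_partial[OF \<phi> e]]
      by (rule Poincare_strip[OF \<phi> e d s])
  qed
  \<comment> \<open>The Poincare inequalities in the two directions are added, so that both partial
    derivatives are used. The factors 2, 1/2 and 4 then combine to the constant
    \<open>diameter \<Omega>\<close> exactly.\<close>
  have "2 * (sq_norm M \<phi>)\<^sup>2 \<le> (diameter \<Omega>)\<^sup>2 / 2 * (4 * (sq_norm M (bc_d \<phi>))\<^sup>2)"
    unfolding 1 using P[of 1] P[of \<i>] by (simp add: distrib_left)
  hence "(sq_norm M \<phi>)\<^sup>2 \<le> (diameter \<Omega> * sq_norm M (bc_d \<phi>))\<^sup>2"
    by (simp add: power_mult_distrib)
  thus "sq_norm M \<phi> \<le> diameter \<Omega> * sq_norm M (bc_d \<phi>)"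
    by (rule power2_le_imp_le) (use d in simp)
  have "(sq_norm M (partial_deriv 1 \<phi>))\<^sup>2 \<le> (2 * sq_norm M (bc_d \<phi>))\<^sup>2"
    using 1 by (simp add: power_mult_distrib)
  thus "sq_norm M (partial_deriv 1 \<phi>) \<le> 2 * sq_norm M (bc_d \<phi>)"
    by (rule power2_le_imp_le) simp
  have "(sq_norm M (partial_deriv \<i> \<phi>))\<^sup>2 \<le> (2 * sq_norm M (bc_d \<phi>))\<^sup>2"
    using 1 by (simp add: power_mult_distrib)
  thus "sq_norm M (partial_deriv \<i> \<phi>) \<le> 2 * sq_norm M (bc_d \<phi>)"
    by (rule power2_le_imp_le) simp
qed


section \<open>The fundamental lemma of the calculus of variations\<close>

text \<open>Inner regularity: every closed subset of {f > 0} is null, and closed subsets exhaust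
  that set up to arbitrarily small measure. Closed sets suffice here, and their indicators are
  limits of continuous functions.\<close>

lemma AE_le_0_if_integral_closed_eq_0:
  fixes f :: "'a::euclidean_space \<Rightarrow> real"
  assumes f: "integrable lebesgue f" and 0: "\<And>C. closed C \<Longrightarrow> (\<integral>z. indicator C z * f z \<partial>lebesgue) = 0"
  shows "AE z in lebesgue. f z \<le> 0"
proof -
  define S where "S = {z. f z > 0}"
  have S: "S \<in> sets lebesgue"
    using measurable_sets[OF borel_measurable_integrable[OF f], of "{0<..}"]
    by (simp add: S_def vimage_def)
  have closed0: "emeasure lebesgue T = 0" if T: "closed T" "T \<subseteq> S" for T
  proof -
    have TL: "T \<in> sets lebesgue" using T(1) by auto
    have i: "integrable lebesgue (\<lambda>z. indicator T z * f z)"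
      using integrable_mult_indicator[OF TL f] by simp
    have "AE z in lebesgue. 0 \<le> indicator T z * f z"
      using T(2) by (intro AE_I2) (auto simp: S_def indicator_def split: if_splits)
    with i 0[OF T(1)] have "AE z in lebesgue. indicator T z * f z = 0"
      using integral_nonneg_eq_0_iff_AE by blast
    hence "AE z in lebesgue. z \<notin> T"
      by eventually_elim (use T(2) in \<open>auto simp: S_def indicator_def split: if_splits\<close>)
    thus ?thesis
      using TL by (subst (asm) AE_iff_measurable[OF TL]) auto
  qed
  have "emeasure lebesgue S \<le> ennreal e" if "e > 0" for e
  proof -
    obtain T where T: "closed T" "T \<subseteq> S" "S - T \<in> lmeasurable" "emeasure lebesgue (S - T) < ennreal e"
      using sets_lebesgue_inner_closed[OF S \<open>e > 0\<close>] by blast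
    have "emeasure lebesgue S = emeasure lebesgue (T \<union> (S - T))"
      using T(2) by (simp add: Un_absorb1)
    also have "\<dots> \<le> emeasure lebesgue T + emeasure lebesgue (S - T)"
      using T by (intro emeasure_subadditive) auto
    also have "\<dots> \<le> ennreal e" using closed0[OF T(1,2)] T(4) by simp
    finally show ?thesis .
  qed
  hence "emeasure lebesgue S = 0"
    by (metis ennreal_le_epsilon le_zero_eq add_0)
  hence "S \<in> null_sets lebesgue" using S by auto
  thus ?thesis
    by (rule AE_I') (auto simp: S_def)
qed

lemma AE_eq_0_if_integral_closed_eq_0:
  fixes f :: "'a::euclidean_space \<Rightarrow> real"
  assumes f: "integrable lebesgue f" and 0: "\<And>C. closed C \<Longrightarrow> (\<integral>z. indicator C z * f z \<partial>lebesgue) = 0"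
  shows "AE z in lebesgue. f z = 0"
proof -
  have "AE z in lebesgue. - f z \<le> 0"
    using f 0 by (intro AE_le_0_if_integral_closed_eq_0) auto
  moreover have "AE z in lebesgue. f z \<le> 0"
    by (intro AE_le_0_if_integral_closed_eq_0 f 0)
  ultimately show ?thesis
    by eventually_elim auto
qed

lemma integrable_mult_bounded_on:
  fixes f :: "complex \<Rightarrow> complex" and g :: "complex \<Rightarrow> real"
  assumes f: "integrable lebesgue f" and K: "compact K" "\<And>z. z \<notin> K \<Longrightarrow> f z = 0"
    and g: "continuous_on UNIV g"
  shows "integrable lebesgue (\<lambda>z. f z * of_real (g z))"
proof -
  have "bounded (g ` K)"
    using K(1) g by (intro compact_imp_bounded compact_continuous_image) (auto intro: continuous_on_subset)
  then obtain B where B: "\<And>z. z \<in> K \<Longrightarrow> \<bar>g z\<bar> \<le> B" by (auto simp: bounded_iff)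
  have gm: "g \<in> borel_measurable lebesgue"
    using g by (intro measurable_completion) (simp add: borel_measurable_continuous_onI)
  show ?thesis
  proof (rule Bochner_Integration.integrable_bound)
    show "integrable lebesgue (\<lambda>z. B * norm (f z))" using f by auto
    show "(\<lambda>z. f z * of_real (g z)) \<in> borel_measurable lebesgue"
      using borel_measurable_integrable[OF f] gm by auto
    have "norm (f z * of_real (g z)) \<le> norm (B * norm (f z))" for z
    proof (cases "z \<in> K")
      case True
      hence "\<bar>g z\<bar> \<le> \<bar>B\<bar>" using B[of z] by linarith
      thus ?thesis by (simp add: norm_mult abs_mult mult.commute mult_right_mono)
    qed (simp add: K(2))
    thus "AE z in lebesgue. norm (f z * of_real (g z)) \<le> norm (B * norm (f z))" by simp
  qed
qed

text \<open>On the compact set carrying f, Stone-Weierstrass extends orthogonality from polynomials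
  to continuous functions. The functions max 0 (1 - n dist(z, C)) decrease to the indicator of a
  closed set C, and dominated convergence finishes.\<close>

lemma AE_eq_0_if_orthogonal_polynomials:
  fixes f :: "complex \<Rightarrow> complex"
  assumes f: "integrable lebesgue f" and K: "compact K" "\<And>z. z \<notin> K \<Longrightarrow> f z = 0"
    and 0: "\<And>P. real_polynomial_function P \<Longrightarrow> (\<integral>z. f z * of_real (P z) \<partial>lebesgue) = 0"
  shows "AE z in lebesgue. f z = 0"
proof -
  have cont0: "(\<integral>z. f z * of_real (g z) \<partial>lebesgue) = 0" if g: "continuous_on UNIV g" for g :: "complex \<Rightarrow> real"
  proof -
    define A where "A = (\<integral>z. norm (f z) \<partial>lebesgue)"
    have A: "0 \<le> A" unfolding A_def by simp
    have le: "norm (\<integral>z. f z * of_real (g z) \<partial>lebesgue) \<le> e * A" if "e > 0" for e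
    proof -
      obtain P where P: "real_polynomial_function P" "\<And>z. z \<in> K \<Longrightarrow> \<bar>g z - P z\<bar> < e"
        using Stone_Weierstrass_real_polynomial_function[OF K(1) continuous_on_subset[OF g] \<open>e > 0\<close>] by blast
      have Pc: "continuous_on UNIV P"
        using P(1) by (simp add: continuous_on_polymonial_function real_polynomial_function_eq)
      note ig = integrable_mult_bounded_on[OF f K g] and iP = integrable_mult_bounded_on[OF f K Pc]
        and id = integrable_mult_bounded_on[OF f K continuous_on_diff[OF g Pc]]
      have "(\<integral>z. f z * of_real (g z) \<partial>lebesgue) = (\<integral>z. f z * of_real (g z) \<partial>lebesgue) - (\<integral>z. f z * of_real (P z) \<partial>lebesgue)"
        using 0[OF P(1)] by simp
      also have "\<dots> = (\<integral>z. f z * of_real (g z - P z) \<partial>lebesgue)"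
        using ig iP by (simp add: right_diff_distrib)
      finally have "norm (\<integral>z. f z * of_real (g z) \<partial>lebesgue) \<le> (\<integral>z. norm (f z * of_real (g z - P z)) \<partial>lebesgue)"
        using integral_norm_bound by metis
      also have "\<dots> \<le> (\<integral>z. e * norm (f z) \<partial>lebesgue)"
      proof (rule integral_mono)
        show "integrable lebesgue (\<lambda>z. norm (f z * of_real (g z - P z)))" using id by (rule integrable_norm)
        show "integrable lebesgue (\<lambda>z. e * norm (f z))" using f by auto
        show "norm (f z * of_real (g z - P z)) \<le> e * norm (f z)" for z
        proof (cases "z \<in> K")
          case True
          thus ?thesis
            using P(2)[OF True] unfolding norm_mult norm_of_real mult.commute[of e] by (intro mult_left_mono) auto
        qed (simp add: K(2))
      qed
      also have "\<dots> = e * A" by (simp add: A_def)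
      finally show ?thesis .
    qed
    have "norm (\<integral>z. f z * of_real (g z) \<partial>lebesgue) \<le> 0"
    proof (rule field_le_epsilon)
      fix e :: real assume "e > 0"
      \<comment> \<open>Dividing by A + 1 instead of A also covers A = 0.\<close>
      have "norm (\<integral>z. f z * of_real (g z) \<partial>lebesgue) \<le> e / (A + 1) * A"
        using A \<open>e > 0\<close> by (intro le) auto
      also have "\<dots> \<le> 0 + e" using A \<open>e > 0\<close> by (simp add: field_simps)
      finally show "norm (\<integral>z. f z * of_real (g z) \<partial>lebesgue) \<le> 0 + e" .
    qed
    thus ?thesis by simp
  qed
  have closed0: "(\<integral>z. f z * indicator C z \<partial>lebesgue) = 0" if C: "closed C" for C
  \<comment> \<open>The empty set is separated because \<open>infdist\<close> to it is 0 by
    convention, so the functions \<open>g n\<close> below would be constantly 1.\<close>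
  proof (cases "C = {}")
    case False
    define g where "g n z = max 0 (1 - real n * infdist z C)" for n and z :: complex
    have gc: "continuous_on UNIV (g n)" for n
      unfolding g_def by (intro continuous_intros)
    have lim: "(\<lambda>n. f z * complex_of_real (g n z)) \<longlonglongrightarrow> f z * indicator C z" for z
    proof (cases "z \<in> C")
      case True
      thus ?thesis by (simp add: g_def)
    next
      case zC: False
      hence pos: "infdist z C > 0" using C False by (simp add: infdist_pos_not_in_closed)
      obtain N where N: "1 < real N * infdist z C" using ex_less_of_nat_mult[OF pos] by blast
      have "g n z = 0" if "n \<ge> N" for n
      proof -
        have "real N * infdist z C \<le> real n * infdist z C" using that pos by simp
        thus ?thesis using N by (simp add: g_def)
      qed
      hence "\<forall>\<^sub>F n in sequentially. f z * complex_of_real (g n z) = f z * indicator C z"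
        using zC by (auto simp: eventually_sequentially)
      thus ?thesis by (rule tendsto_eventually)
    qed
    have "(\<lambda>n. \<integral>z. f z * complex_of_real (g n z) \<partial>lebesgue) \<longlonglongrightarrow> (\<integral>z. f z * indicator C z \<partial>lebesgue)"
    proof (rule integral_dominated_convergence)
      have ind: "(\<lambda>z. indicator C z :: complex) \<in> borel_measurable lebesgue"
        using C by (intro borel_measurable_indicator) auto
      thus "(\<lambda>z. f z * indicator C z) \<in> borel_measurable lebesgue"
        using borel_measurable_integrable[OF f] by auto
      show "(\<lambda>z. f z * complex_of_real (g n z)) \<in> borel_measurable lebesgue" for n
        using borel_measurable_integrable[OF integrable_mult_bounded_on[OF f K gc]] .
      show "integrable lebesgue (\<lambda>z. norm (f z))" using f by (rule integrable_norm)
      have "\<bar>g n z\<bar> \<le> 1" for n z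
        using infdist_nonneg[of z C] by (auto simp: g_def)
      hence "norm (f z * complex_of_real (g n z)) \<le> norm (f z)" for n z
        by (simp add: norm_mult mult_left_le)
      thus "AE z in lebesgue. norm (f z * complex_of_real (g n z)) \<le> norm (f z)" for n by simp
    qed (use lim in simp)
    thus ?thesis by (simp add: cont0[OF gc] LIMSEQ_const_iff)
  qed simp
  have fC: "integrable lebesgue (\<lambda>z. f z * indicator C z)" if "closed C" for C
  proof -
    have "C \<in> sets lebesgue" using that by auto
    from integrable_mult_indicator[OF this f] show ?thesis
      by (simp add: scaleR_conv_of_real mult.commute of_real_indicator)
  qed
  have "AE z in lebesgue. Re (f z) = 0"
  proof (rule AE_eq_0_if_integral_closed_eq_0)
    fix C :: "complex set" assume C: "closed C"
    have "(\<integral>z. indicator C z * Re (f z) \<partial>lebesgue) = (\<integral>z. Re (f z * indicator C z) \<partial>lebesgue)"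
      by (intro Bochner_Integration.integral_cong) (auto simp: indicator_def)
    also have "\<dots> = 0" using closed0[OF C] fC[OF C] by (simp only: integral_Re) simp
    finally show "(\<integral>z. indicator C z * Re (f z) \<partial>lebesgue) = 0" .
  qed (use f in auto)
  moreover have "AE z in lebesgue. Im (f z) = 0"
  proof (rule AE_eq_0_if_integral_closed_eq_0)
    fix C :: "complex set" assume C: "closed C"
    have "(\<integral>z. indicator C z * Im (f z) \<partial>lebesgue) = (\<integral>z. Im (f z * indicator C z) \<partial>lebesgue)"
      by (intro Bochner_Integration.integral_cong) (auto simp: indicator_def)
    also have "\<dots> = 0" using closed0[OF C] fC[OF C] by (simp only: integral_Im) simp
    finally show "(\<integral>z. indicator C z * Im (f z) \<partial>lebesgue) = 0" .
  qed (use f in auto)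
  ultimately show ?thesis
    by eventually_elim (simp add: complex_eq_iff)
qed

lemma C_k_real_polynomial:
  "real_polynomial_function P \<Longrightarrow> C_k k (\<lambda>z. complex_of_real (P z))"
proof (induction rule: real_polynomial_function.induct)
  case (linear f)
  thus ?case by (intro C_k_linear bounded_linear_compose[OF bounded_linear_of_real])
next
  case (add f g)
  thus ?case using C_k_add by fastforce
next
  case (mult f g)
  thus ?case using C_k_bilinear[OF bounded_bilinear_mult] by fastforce
qed (rule C_k_const)

text \<open>Polynomials are not test functions, but their products with a bump function are. So
  \<open>h\<close> times the bump is orthogonal to all polynomials, hence zero almost everywhere,
  and the bump has no zero in the open ball.\<close>

lemma AE_eq_0_on_ball:
  assumes \<Omega>: "open \<Omega>" and h: "h \<in> L1_loc \<Omega>" and r: "r > 0" "cball c r \<subseteq> \<Omega>"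
    and 0: "\<And>\<phi>. \<phi> \<in> test_funs \<Omega> \<Longrightarrow> (\<integral>z. h z * \<phi> z \<partial>lebesgue_on \<Omega>) = 0"
  shows "AE z in lebesgue. z \<in> ball c r \<longrightarrow> h z = 0"
proof -
  let ?K = "cball c r"
  let ?b = "ball_bump c r 0"
  have bump: "C_k_compact k \<Omega> ?b" for k
    by (rule C_k_compact_ball_bump[OF r])
  define f where "f z = (indicator ?K z *\<^sub>R h z) * ?b z" for z
  have b0: "?b z = 0" if "z \<notin> ?K" for z
    using that ball_bump_eq_0_iff[OF r(1)] by auto
  have hK: "integrable lebesgue (\<lambda>z. indicator ?K z *\<^sub>R h z)"
    using h r(2) by (subst integrable_restrict_space[symmetric]) (auto simp: L1_loc_def)
  have f: "integrable lebesgue f"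
  proof -
    have "continuous_on UNIV (\<lambda>z. Re (?b z))"
      by (intro continuous_intros C_k_continuous[OF C_k_ball_bump])
    moreover have "?b z = of_real (Re (?b z))" for z by (simp add: ball_bump_def)
    ultimately show ?thesis
      using integrable_mult_bounded_on[OF hK, of ?K "\<lambda>z. Re (?b z)"] unfolding f_def by simp
  qed
  have "AE z in lebesgue. f z = 0"
  proof (rule AE_eq_0_if_orthogonal_polynomials[OF f])
    show "compact ?K" by simp
    show "f z = 0" if "z \<notin> ?K" for z using that by (simp add: f_def)
    fix P :: "complex \<Rightarrow> real" assume P: "real_polynomial_function P"
    have t: "(\<lambda>z. ?b z * of_real (P z)) \<in> test_funs \<Omega>"
      unfolding test_funs_iff
      by (intro allI C_k_compact_bilinear[OF bounded_bilinear_mult bump C_k_real_polynomial[OF P]])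
    have "f z * of_real (P z) = indicator \<Omega> z *\<^sub>R (h z * (?b z * of_real (P z)))" for z
      using b0[of z] r(2) by (cases "z \<in> ?K") (auto simp: f_def)
    hence "(\<integral>z. f z * of_real (P z) \<partial>lebesgue) = (\<integral>z. h z * (?b z * of_real (P z)) \<partial>lebesgue_on \<Omega>)"
      using \<Omega> by (subst integral_restrict_space) auto
    thus "(\<integral>z. f z * of_real (P z) \<partial>lebesgue) = 0" using 0[OF t] by simp
  qed
  thus ?thesis
  proof eventually_elim
    case (elim z)
    show ?case
    proof
      assume "z \<in> ball c r"
      hence "?b z \<noteq> 0" "z \<in> ?K" using ball_bump_eq_0_iff[OF r(1)] by auto
      thus "h z = 0" using elim by (simp add: f_def)
    qed
  qed
qed

text \<open>Lindelof reduces the cover of \<Omega> by balls to a countable one, so that the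
  exceptional null sets can be united.\<close>

lemma AE_eq_0_if_orthogonal_test_funs:
  assumes \<Omega>: "open \<Omega>" and h: "h \<in> L1_loc \<Omega>"
    and 0: "\<And>\<phi>. \<phi> \<in> test_funs \<Omega> \<Longrightarrow> (\<integral>z. h z * \<phi> z \<partial>lebesgue_on \<Omega>) = 0"
  shows "AE z in lebesgue_on \<Omega>. h z = 0"
proof -
  have "\<exists>r>0. cball z r \<subseteq> \<Omega>" if "z \<in> \<Omega>" for z
    using \<Omega> that open_contains_cball by blast
  then obtain r where r: "\<And>z. z \<in> \<Omega> \<Longrightarrow> r z > 0 \<and> cball z (r z) \<subseteq> \<Omega>" by metis
  obtain F where F: "F \<subseteq> (\<lambda>z. ball z (r z)) ` \<Omega>" "countable F" "\<Union>F = (\<Union>z\<in>\<Omega>. ball z (r z))"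
    using Lindelof[of "(\<lambda>z. ball z (r z)) ` \<Omega>"] by auto
  have "AE z in lebesgue. \<forall>B\<in>F. z \<in> B \<longrightarrow> h z = 0"
  proof (subst AE_ball_countable[OF F(2)], rule ballI)
    fix B assume "B \<in> F"
    then obtain c where c: "c \<in> \<Omega>" "B = ball c (r c)" using F(1) by blast
    show "AE z in lebesgue. z \<in> B \<longrightarrow> h z = 0"
      unfolding c(2) using r[OF c(1)] by (intro AE_eq_0_on_ball[OF \<Omega> h _ _ 0]) auto
  qed
  moreover have "\<Omega> \<subseteq> \<Union>F"
    unfolding F(3) using r by force
  ultimately have "AE z in lebesgue. z \<in> \<Omega> \<longrightarrow> h z = 0"
    by (auto elim!: eventually_mono)
  thus ?thesis
    using \<Omega> by (subst AE_restrict_space_iff) auto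
qed


section \<open>Weak derivatives\<close>

text \<open>Completeness of Lebesgue measure. It is needed because \<open>adjoint_range\<close>
  prescribes its members only almost everywhere and says nothing about their measurability.\<close>

lemma borel_measurable_lebesgue_on_AE:
  fixes f g :: "complex \<Rightarrow> 'a::euclidean_space"
  assumes "open \<Omega>" "f \<in> borel_measurable (lebesgue_on \<Omega>)" "AE z in lebesgue_on \<Omega>. g z = f z"
  shows "g \<in> borel_measurable (lebesgue_on \<Omega>)"
proof -
  have \<Omega>: "\<Omega> \<inter> space lebesgue \<in> sets lebesgue" using assms(1) by auto
  have "AE z in lebesgue. z \<in> \<Omega> \<longrightarrow> g z = f z"
    using assms(3) by (simp add: AE_restrict_space_iff[OF \<Omega>])
  hence "AE z in lebesgue. indicator \<Omega> z *\<^sub>R f z = indicator \<Omega> z *\<^sub>R g z"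
    by eventually_elim (auto simp: indicator_def)
  moreover have "(\<lambda>z. indicator \<Omega> z *\<^sub>R f z) \<in> borel_measurable lebesgue"
    using assms(2) by (simp add: borel_measurable_restrict_space_iff[OF \<Omega>])
  ultimately have "(\<lambda>z. indicator \<Omega> z *\<^sub>R g z) \<in> borel_measurable lebesgue"
    by (rule borel_measurable_AE[rotated])
  thus ?thesis by (simp add: borel_measurable_restrict_space_iff[OF \<Omega>])
qed

lemma sq_integrable_AE_cong:
  fixes f g :: "complex \<Rightarrow> 'a::euclidean_space"
  assumes "open \<Omega>" "sq_integrable (lebesgue_on \<Omega>) f" "AE z in lebesgue_on \<Omega>. g z = f z"
  shows "sq_integrable (lebesgue_on \<Omega>) g"
proof (rule sq_integrable_bounded_by[OF _ assms(2)])
  show "g \<in> borel_measurable (lebesgue_on \<Omega>)"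
    by (rule borel_measurable_lebesgue_on_AE[OF assms(1) sq_integrable_measurable[OF assms(2)] assms(3)])
  show "AE z in lebesgue_on \<Omega>. norm (g z) \<le> 1 * norm (f z)"
    using assms(3) by eventually_elim simp
qed

lemma integrable_lebesgue_on_subset:
  fixes f :: "complex \<Rightarrow> 'a::euclidean_space"
  assumes "open \<Omega>" "compact K" "K \<subseteq> \<Omega>" "integrable (lebesgue_on \<Omega>) f"
  shows "integrable (lebesgue_on K) f"
proof -
  have "integrable lebesgue (\<lambda>z. indicator \<Omega> z *\<^sub>R f z)"
    using assms(1,4) by (subst integrable_restrict_space[symmetric]) auto
  moreover have "K \<in> sets lebesgue" using assms(2) by (auto simp: compact_imp_closed)
  ultimately have "integrable lebesgue (\<lambda>z. indicator K z *\<^sub>R (indicator \<Omega> z *\<^sub>R f z))"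
    using integrable_mult_indicator by blast
  also have "(\<lambda>z. indicator K z *\<^sub>R (indicator \<Omega> z *\<^sub>R f z)) = (\<lambda>z. indicator K z *\<^sub>R f z)"
    using assms(3) by (intro ext) (auto split: split_indicator)
  finally show ?thesis
    using assms(2) by (subst integrable_restrict_space) (auto simp: compact_imp_closed)
qed

text \<open>A bounded domain has finite measure, so 1 + |f|^2 is an integrable majorant. Every
  function entering a weak derivative has to pass this test.\<close>

lemma sq_integrable_imp_L1_loc:
  assumes "open \<Omega>" "bounded \<Omega>" "sq_integrable (lebesgue_on \<Omega>) f"
  shows "f \<in> L1_loc \<Omega>"
proof -
  have "\<Omega> \<in> lmeasurable" using assms by (intro lmeasurable_open) auto
  hence "integrable (lebesgue_on \<Omega>) (\<lambda>z. 1 :: real)"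
    by (simp add: lmeasurable_iff_integrable integrable_restrict_space fmeasurableD)
  hence "integrable (lebesgue_on \<Omega>) (\<lambda>z. 1 + (norm (f z))\<^sup>2)"
    using assms(3) by (auto simp: sq_integrable_def)
  moreover have "norm (f z) \<le> norm (1 + (norm (f z))\<^sup>2)" for z
    using norm_mult_le_sum_squares[of "f z" "1 :: real"] by simp
  ultimately have "integrable (lebesgue_on \<Omega>) f"
    using sq_integrable_measurable[OF assms(3)] by (rule_tac Bochner_Integration.integrable_bound) auto
  thus ?thesis
    using integrable_lebesgue_on_subset[OF assms(1)] sq_integrable_measurable[OF assms(3)]
    by (auto simp: L1_loc_def)
qed

lemma bc_L1_loc_if_sq_integrable:
  assumes "open \<Omega>" "bounded \<Omega>" "sq_integrable (lebesgue_on \<Omega>) F"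
  shows "F \<in> bc_valued (L1_loc \<Omega>)"
  using assms sq_integrable_imp_L1_loc sq_integrable_bicomplex_iff[of _ F] by (auto simp: bc_valued_def)

lemma L1_loc_diff:
  assumes "f \<in> L1_loc \<Omega>" "g \<in> L1_loc \<Omega>"
  shows "(\<lambda>z. f z - g z) \<in> L1_loc \<Omega>"
  using assms by (auto simp: L1_loc_def)

lemma L1_loc_mult_integrable:
  assumes \<Omega>: "open \<Omega>" and f: "f \<in> L1_loc \<Omega>" and \<phi>: "C_k_compact k \<Omega> \<phi>"
  shows "integrable (lebesgue_on \<Omega>) (\<lambda>z. f z * \<phi> z)"
proof -
  obtain K where K: "compact K" "K \<subseteq> \<Omega>" "\<And>z. z \<notin> K \<Longrightarrow> \<phi> z = 0"
    using C_k_compactE[OF \<phi>] by blast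
  obtain B where B: "0 \<le> B" "\<And>z. norm (\<phi> z) \<le> B"
    using C_k_compact_bounded[OF \<phi>] by blast
  have "integrable (lebesgue_on K) f" using f K by (auto simp: L1_loc_def)
  hence i: "integrable lebesgue (\<lambda>z. indicator K z *\<^sub>R f z)"
    using K(1) by (subst integrable_restrict_space[symmetric]) (auto simp: compact_imp_closed)
  have \<phi>m: "\<phi> \<in> borel_measurable lebesgue"
    using C_k_compact_borel[OF \<phi>] by (intro measurable_completion) simp
  have "integrable lebesgue (\<lambda>z. (indicator K z *\<^sub>R f z) * \<phi> z)"
  proof (rule Bochner_Integration.integrable_bound)
    show "integrable lebesgue (\<lambda>z. B * norm (indicator K z *\<^sub>R f z))"
      by (intro integrable_mult_right integrable_norm i)
    show "(\<lambda>z. (indicator K z *\<^sub>R f z) * \<phi> z) \<in> borel_measurable lebesgue"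
      using borel_measurable_integrable[OF i] \<phi>m by (rule borel_measurable_times)
    have "norm ((indicator K z *\<^sub>R f z) * \<phi> z) \<le> norm (B * norm (indicator K z *\<^sub>R f z))" for z
      using mult_left_mono[OF B(2)[of z], of "norm (indicator K z *\<^sub>R f z)"] B(1)
      by (simp add: norm_mult mult.commute mult.left_commute)
    thus "AE z in lebesgue. norm ((indicator K z *\<^sub>R f z) * \<phi> z) \<le> norm (B * norm (indicator K z *\<^sub>R f z))" by simp
  qed
  also have "(\<lambda>z. (indicator K z *\<^sub>R f z) * \<phi> z) = (\<lambda>z. indicator \<Omega> z *\<^sub>R (f z * \<phi> z))"
    using K by (intro ext) (auto split: split_indicator)
  finally show ?thesis
    using \<Omega> by (subst integrable_restrict_space) auto
qed

lemma bc_L1_loc_mult_integrable: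
  assumes \<Omega>: "open \<Omega>" and F: "F \<in> bc_valued (L1_loc \<Omega>)" and \<psi>: "C_k_compact k \<Omega> \<psi>"
  shows "integrable (lebesgue_on \<Omega>) (\<lambda>z. F z * \<psi> z)"
proof -
  note S = C_k_compact_bounded_linear[OF bounded_linear_Sc \<psi>] and V = C_k_compact_bounded_linear[OF bounded_linear_Vec \<psi>]
  have "(\<lambda>z. Sc (F z)) \<in> L1_loc \<Omega>" "(\<lambda>z. Vec (F z)) \<in> L1_loc \<Omega>"
    using F by (auto simp: bc_valued_def)
  thus ?thesis
    unfolding integrable_bicomplex_iff[of _ "\<lambda>z. F z * \<psi> z"] Sc_Vec_simps
    using L1_loc_mult_integrable[OF \<Omega>] S V
    by (intro conjI Bochner_Integration.integrable_diff Bochner_Integration.integrable_add) auto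
qed

text \<open>\<open>adjoint_range\<close> allows an arbitrary weak derivative; this lemma makes the
  choice immaterial. Test functions with zero \<open>Vec\<close> part already separate the two
  components of the difference, so the complex fundamental lemma applies to each.\<close>

lemma has_weak_d_unique:
  assumes \<Omega>: "open \<Omega>" and U: "has_weak_d \<Omega> V U" and U': "has_weak_d \<Omega> V U'"
  shows "AE z in lebesgue_on \<Omega>. U z = U' z"
proof -
  have L: "U \<in> bc_valued (L1_loc \<Omega>)" "U' \<in> bc_valued (L1_loc \<Omega>)"
    using U U' by (auto simp: has_weak_d_def)
  have D: "(\<lambda>z. Sc (U z) - Sc (U' z)) \<in> L1_loc \<Omega>" "(\<lambda>z. Vec (U z) - Vec (U' z)) \<in> L1_loc \<Omega>"
    using L by (auto simp: bc_valued_def intro: L1_loc_diff)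
  have orth: "(\<integral>z. (Sc (U z) - Sc (U' z)) * \<phi> z \<partial>lebesgue_on \<Omega>) = 0 \<and>
      (\<integral>z. (Vec (U z) - Vec (U' z)) * \<phi> z \<partial>lebesgue_on \<Omega>) = 0" if \<phi>: "\<phi> \<in> test_funs \<Omega>" for \<phi>
  proof -
    let ?\<psi> = "\<lambda>z. Bicomplex (\<phi> z) 0"
    have c: "C_k_compact k \<Omega> ?\<psi>" for k
      using \<phi> C_k_compact_bounded_linear[OF bounded_linear_Bicomplex_Sc] by (simp add: test_funs_iff)
    hence "?\<psi> \<in> bc_valued (test_funs \<Omega>)" by (simp add: bc_valued_test_funs_iff)
    hence "(\<integral>z. U z * ?\<psi> z \<partial>lebesgue_on \<Omega>) = (\<integral>z. U' z * ?\<psi> z \<partial>lebesgue_on \<Omega>)"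
      using U U' by (simp add: has_weak_d_def)
    moreover note i = bc_L1_loc_mult_integrable[OF \<Omega> L(1) c[of 0]] bc_L1_loc_mult_integrable[OF \<Omega> L(2) c[of 0]]
    ultimately have 0: "(\<integral>z. (U z - U' z) * ?\<psi> z \<partial>lebesgue_on \<Omega>) = 0"
      by (simp add: left_diff_distrib)
    have "integrable (lebesgue_on \<Omega>) (\<lambda>z. (U z - U' z) * ?\<psi> z)"
      using i by (simp add: left_diff_distrib)
    from Sc_eq_integral[OF this] Vec_eq_integral[OF this] show ?thesis by (simp add: 0)
  qed
  have "AE z in lebesgue_on \<Omega>. Sc (U z) - Sc (U' z) = 0" "AE z in lebesgue_on \<Omega>. Vec (U z) - Vec (U' z) = 0"
    using AE_eq_0_if_orthogonal_test_funs[OF \<Omega>] D orth by blast+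
  thus ?thesis
    by eventually_elim (simp add: bicomplex_eq_iff)
qed

text \<open>The product \<open>p (f z) (g z)\<close> again has compact support, so the integral of
  its derivative vanishes.\<close>

lemma integral_partial_deriv_bilinear:
  fixes p :: "'a::euclidean_space \<Rightarrow> 'b::euclidean_space \<Rightarrow> 'c::euclidean_space"
  assumes \<Omega>: "open \<Omega>" and p: "bounded_bilinear p" and f: "C_k_compact (Suc 0) \<Omega> f" and g: "C_k_compact (Suc 0) \<Omega> g"
    and e: "e \<in> {1, \<i>}"
  shows "(\<integral>z. p (f z) (partial_deriv e g z) \<partial>lebesgue_on \<Omega>) = - (\<integral>z. p (partial_deriv e f z) (g z) \<partial>lebesgue_on \<Omega>)"
proof -
  note f1 = C_k_compact_C_k[OF f] and g1 = C_k_compact_C_k[OF g]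
  have c: "C_k_compact (Suc 0) \<Omega> (\<lambda>z. p (f z) (g z))"
    by (rule C_k_compact_bilinear[OF p f g1])
  have f0: "C_k_compact 0 \<Omega> f" using C_k_compact_le[OF f] by simp
  have 1: "C_k_compact 0 \<Omega> (\<lambda>z. p (f z) (partial_deriv e g z))"
    by (rule C_k_compact_bilinear[OF p f0 C_k_partial[OF g1 e]])
  have 2: "C_k_compact 0 \<Omega> (\<lambda>z. p (partial_deriv e f z) (g z))"
    by (rule C_k_compact_bilinear[OF p C_k_compact_partial[OF f e] C_k_SucD[OF g1]])
  have "(\<integral>z. p (f z) (partial_deriv e g z) + p (partial_deriv e f z) (g z) \<partial>lborel) = 0"
    using integral_partial_deriv_eq_0[OF c e] partial_deriv_bilinear[OF p f1 g1] by simp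
  thus ?thesis
    unfolding C_k_compact_integrable_on(2)[OF 1 \<Omega>] C_k_compact_integrable_on(2)[OF 2 \<Omega>]
    using C_k_compact_integrable[OF 1] C_k_compact_integrable[OF 2] by (simp add: add_eq_0_iff2)
qed


section \<open>Sobolev limits of test functions\<close>

definition W12_limit :: "complex set \<Rightarrow> (complex \<Rightarrow> bicomplex) \<Rightarrow> (complex \<Rightarrow> bicomplex) \<Rightarrow> (complex \<Rightarrow> bicomplex)
    \<Rightarrow> (nat \<Rightarrow> complex \<Rightarrow> bicomplex) \<Rightarrow> bool" where
  "W12_limit \<Omega> V X Y \<Phi> \<longleftrightarrow> sq_integrable (lebesgue_on \<Omega>) V \<and> sq_integrable (lebesgue_on \<Omega>) X \<and>
     sq_integrable (lebesgue_on \<Omega>) Y \<and> (\<forall>n k. C_k_compact k \<Omega> (\<Phi> n)) \<and>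
     (\<lambda>n. sq_norm (lebesgue_on \<Omega>) (\<lambda>z. \<Phi> n z - V z)) \<longlonglongrightarrow> 0 \<and>
     (\<lambda>n. sq_norm (lebesgue_on \<Omega>) (\<lambda>z. partial_deriv 1 (\<Phi> n) z - X z)) \<longlonglongrightarrow> 0 \<and>
     (\<lambda>n. sq_norm (lebesgue_on \<Omega>) (\<lambda>z. partial_deriv \<i> (\<Phi> n) z - Y z)) \<longlonglongrightarrow> 0"

lemma W12_0D:
  assumes "f \<in> W12_0 \<Omega>"
  shows "\<exists>fx fy \<phi>. sq_integrable (lebesgue_on \<Omega>) f \<and> sq_integrable (lebesgue_on \<Omega>) fx \<and>
    sq_integrable (lebesgue_on \<Omega>) fy \<and> (\<forall>n. \<phi> n \<in> test_funs \<Omega>) \<and>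
    (\<lambda>n. sq_norm (lebesgue_on \<Omega>) (\<lambda>z. \<phi> n z - f z)) \<longlonglongrightarrow> 0 \<and>
    (\<lambda>n. sq_norm (lebesgue_on \<Omega>) (\<lambda>z. partial_deriv 1 (\<phi> n) z - fx z)) \<longlonglongrightarrow> 0 \<and>
    (\<lambda>n. sq_norm (lebesgue_on \<Omega>) (\<lambda>z. partial_deriv \<i> (\<phi> n) z - fy z)) \<longlonglongrightarrow> 0"
proof -
  from assms obtain fx fy \<phi> where *: "f \<in> L2 \<Omega>" "fx \<in> L2 \<Omega>" "fy \<in> L2 \<Omega>" "\<forall>n. \<phi> n \<in> test_funs \<Omega>"
    "(\<lambda>n. L2_norm \<Omega> (\<lambda>z. \<phi> n z - f z)) \<longlonglongrightarrow> 0"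
    "(\<lambda>n. L2_norm \<Omega> (\<lambda>z. partial_deriv 1 (\<phi> n) z - fx z)) \<longlonglongrightarrow> 0"
    "(\<lambda>n. L2_norm \<Omega> (\<lambda>z. partial_deriv \<i> (\<phi> n) z - fy z)) \<longlonglongrightarrow> 0"
    unfolding W12_0_def by (elim CollectE conjE bexE exE)
  show ?thesis
    by (rule exI[of _ fx], rule exI[of _ fy], rule exI[of _ \<phi>])
      (use * in \<open>simp add: L2_iff_sq_integrable L2_norm_eq_sq_norm\<close>)
qed

text \<open>Membership in \<open>bc_valued (W12_0 \<Omega>)\<close> gives unrelated approximations
  of the two components. They are glued into one bicomplex sequence, on which \<open>bc_d\<close>
  and \<open>adj\<close> can act.\<close>

lemma W12_0_imp_W12_limit:
  assumes \<Omega>: "open \<Omega>" and V: "V \<in> bc_valued (W12_0 \<Omega>)"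
  obtains X Y \<Phi> where "W12_limit \<Omega> V X Y \<Phi>"
proof -
  let ?M = "lebesgue_on \<Omega>"
  have "(\<lambda>z. Sc (V z)) \<in> W12_0 \<Omega>" using V by (simp add: bc_valued_def)
  from W12_0D[OF this] obtain px py \<phi> where p: "sq_integrable ?M (\<lambda>z. Sc (V z))" "sq_integrable ?M px"
    "sq_integrable ?M py" "\<forall>n. \<phi> n \<in> test_funs \<Omega>"
    "(\<lambda>n. sq_norm ?M (\<lambda>z. \<phi> n z - Sc (V z))) \<longlonglongrightarrow> 0"
    "(\<lambda>n. sq_norm ?M (\<lambda>z. partial_deriv 1 (\<phi> n) z - px z)) \<longlonglongrightarrow> 0"
    "(\<lambda>n. sq_norm ?M (\<lambda>z. partial_deriv \<i> (\<phi> n) z - py z)) \<longlonglongrightarrow> 0"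
    by (elim exE conjE)
  have "(\<lambda>z. Vec (V z)) \<in> W12_0 \<Omega>" using V by (simp add: bc_valued_def)
  from W12_0D[OF this] obtain qx qy \<psi> where q: "sq_integrable ?M (\<lambda>z. Vec (V z))" "sq_integrable ?M qx"
    "sq_integrable ?M qy" "\<forall>n. \<psi> n \<in> test_funs \<Omega>"
    "(\<lambda>n. sq_norm ?M (\<lambda>z. \<psi> n z - Vec (V z))) \<longlonglongrightarrow> 0"
    "(\<lambda>n. sq_norm ?M (\<lambda>z. partial_deriv 1 (\<psi> n) z - qx z)) \<longlonglongrightarrow> 0"
    "(\<lambda>n. sq_norm ?M (\<lambda>z. partial_deriv \<i> (\<psi> n) z - qy z)) \<longlonglongrightarrow> 0"
    by (elim exE conjE)
  define \<Phi> where "\<Phi> n z = Bicomplex (\<phi> n z) (\<psi> n z)" for n z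
  define X where "X z = Bicomplex (px z) (qx z)" for z
  define Y where "Y z = Bicomplex (py z) (qy z)" for z
  have Vi: "sq_integrable ?M V" "sq_integrable ?M X" "sq_integrable ?M Y"
    unfolding sq_integrable_bicomplex_iff[of ?M V] sq_integrable_bicomplex_iff[of ?M X]
      sq_integrable_bicomplex_iff[of ?M Y] using p q by (auto simp: X_def Y_def)
  have \<Phi>: "C_k_compact k \<Omega> (\<Phi> n)" for n k
  proof -
    have "\<Phi> n \<in> bc_valued (test_funs \<Omega>)" using p(4) q(4) by (simp add: bc_valued_def \<Phi>_def)
    thus ?thesis by (simp add: bc_valued_test_funs_iff)
  qed
  have part: "Sc (partial_deriv e (\<Phi> n) z) = partial_deriv e (\<phi> n) z"
    "Vec (partial_deriv e (\<Phi> n) z) = partial_deriv e (\<psi> n) z" for e n z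
    using partial_deriv_bounded_linear[OF bounded_linear_Sc C_k_compact_C_k[OF \<Phi>[of "Suc 0" n]], of e z]
      partial_deriv_bounded_linear[OF bounded_linear_Vec C_k_compact_C_k[OF \<Phi>[of "Suc 0" n]], of e z]
    by (simp_all add: \<Phi>_def)
  have lim: "(\<lambda>n. sq_norm ?M (\<lambda>z. A n z - B z)) \<longlonglongrightarrow> 0"
    if "(\<lambda>n. sq_norm ?M (\<lambda>z. Sc (A n z) - Sc (B z))) \<longlonglongrightarrow> 0" "(\<lambda>n. sq_norm ?M (\<lambda>z. Vec (A n z) - Vec (B z))) \<longlonglongrightarrow> 0"
      "\<And>n. sq_integrable ?M (A n)" "sq_integrable ?M B" for A B
  proof (rule tendsto_0_squeeze)
    show "(\<lambda>n. sq_norm ?M (\<lambda>z. Sc (A n z) - Sc (B z)) + sq_norm ?M (\<lambda>z. Vec (A n z) - Vec (B z))) \<longlonglongrightarrow> 0"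
      using tendsto_add[OF that(1,2)] by simp
    show "sq_norm ?M (\<lambda>z. A n z - B z)
        \<le> sq_norm ?M (\<lambda>z. Sc (A n z) - Sc (B z)) + sq_norm ?M (\<lambda>z. Vec (A n z) - Vec (B z))" for n
      using sq_norm_bicomplex_le[OF sq_integrable_diff[OF that(3)[of n] that(4)]] by simp
  qed simp
  have \<Phi>i: "sq_integrable ?M (\<Phi> n)" "sq_integrable ?M (partial_deriv 1 (\<Phi> n))" "sq_integrable ?M (partial_deriv \<i> (\<Phi> n))" for n
    using C_k_compact_sq_integrable[OF \<Phi>[of 0 n] \<Omega>] C_k_compact_sq_integrable[OF C_k_compact_partial[OF \<Phi>[of "Suc 0" n]] \<Omega>]
    by auto
  have "W12_limit \<Omega> V X Y \<Phi>"
    unfolding W12_limit_def using Vi \<Phi> \<Phi>i p q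
    by (intro conjI lim) (auto simp: \<Phi>_def[symmetric] part, simp_all add: \<Phi>_def X_def Y_def)
  thus ?thesis using that by blast
qed

text \<open>Integration by parts holds for each approximant, and both of its sides are continuous in
  the square norm.\<close>

lemma has_weak_partial_limit:
  assumes \<Omega>: "open \<Omega>" "bounded \<Omega>" and e: "e \<in> {1, \<i>}" and \<Phi>: "\<And>n. C_k_compact (Suc 0) \<Omega> (\<Phi> n)"
    and f: "sq_integrable (lebesgue_on \<Omega>) f" "(\<lambda>n. sq_norm (lebesgue_on \<Omega>) (\<lambda>z. \<Phi> n z - f z)) \<longlonglongrightarrow> 0"
    and g: "sq_integrable (lebesgue_on \<Omega>) g" "(\<lambda>n. sq_norm (lebesgue_on \<Omega>) (\<lambda>z. partial_deriv e (\<Phi> n) z - g z)) \<longlonglongrightarrow> 0"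
  shows "has_weak_partial e \<Omega> f g"
  unfolding has_weak_partial_def
proof (intro conjI ballI)
  fix \<phi> assume "\<phi> \<in> test_funs \<Omega>"
  hence \<phi>: "C_k_compact (Suc 0) \<Omega> \<phi>" by (simp add: test_funs_iff)
  note sq = C_k_compact_sq_integrable[OF _ \<Omega>(1)]
  have 1: "(\<lambda>n. \<integral>z. \<Phi> n z * partial_deriv e \<phi> z \<partial>lebesgue_on \<Omega>) \<longlonglongrightarrow> (\<integral>z. f z * partial_deriv e \<phi> z \<partial>lebesgue_on \<Omega>)"
    by (rule tendsto_integral_bilinear[OF bounded_bilinear_mult f(1) sq[OF \<Phi>] sq[OF C_k_compact_partial[OF \<phi> e]] f(2)])
  have 2: "(\<lambda>n. \<integral>z. partial_deriv e (\<Phi> n) z * \<phi> z \<partial>lebesgue_on \<Omega>) \<longlonglongrightarrow> (\<integral>z. g z * \<phi> z \<partial>lebesgue_on \<Omega>)"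
    by (rule tendsto_integral_bilinear[OF bounded_bilinear_mult g(1) sq[OF C_k_compact_partial[OF \<Phi> e]] sq[OF \<phi>] g(2)])
  show "(\<integral>z. f z * partial_deriv e \<phi> z \<partial>lebesgue_on \<Omega>) = - (\<integral>z. g z * \<phi> z \<partial>lebesgue_on \<Omega>)"
    using LIMSEQ_unique[OF 1] tendsto_minus[OF 2] integral_partial_deriv_bilinear[OF \<Omega>(1) bounded_bilinear_mult \<Phi> \<phi> e]
    by simp
qed (use sq_integrable_imp_L1_loc[OF \<Omega>] f(1) g(1) in auto)

lemma W12_limit_imp_W12_0:
  assumes \<Omega>: "open \<Omega>" "bounded \<Omega>" and V: "W12_limit \<Omega> V X Y \<Phi>"
  shows "V \<in> bc_valued (W12_0 \<Omega>)"
proof -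
  let ?M = "lebesgue_on \<Omega>"
  have Vi: "sq_integrable ?M V" "sq_integrable ?M X" "sq_integrable ?M Y" and \<Phi>: "\<And>k n. C_k_compact k \<Omega> (\<Phi> n)"
    and lim: "(\<lambda>n. sq_norm ?M (\<lambda>z. \<Phi> n z - V z)) \<longlonglongrightarrow> 0"
      "(\<lambda>n. sq_norm ?M (\<lambda>z. partial_deriv 1 (\<Phi> n) z - X z)) \<longlonglongrightarrow> 0"
      "(\<lambda>n. sq_norm ?M (\<lambda>z. partial_deriv \<i> (\<Phi> n) z - Y z)) \<longlonglongrightarrow> 0"
    using V by (auto simp: W12_limit_def)
  have \<Phi>i: "sq_integrable ?M (\<Phi> n)" "sq_integrable ?M (partial_deriv 1 (\<Phi> n))" "sq_integrable ?M (partial_deriv \<i> (\<Phi> n))" for n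
    using C_k_compact_sq_integrable[OF \<Phi>[of 0 n] \<Omega>(1)] C_k_compact_sq_integrable[OF C_k_compact_partial[OF \<Phi>[of "Suc 0" n]] \<Omega>(1)]
    by auto
  \<comment> \<open>One argument for the two projections \<open>Sc\<close> and \<open>Vec\<close>:
    both are linear, commute with partial derivatives and do not increase the norm.\<close>
  have *: "(\<lambda>z. T (V z)) \<in> W12_0 \<Omega>" if T: "bounded_linear T"
    and T_le: "\<And>F. sq_integrable ?M F \<Longrightarrow> sq_norm ?M (\<lambda>z. T (F z)) \<le> sq_norm ?M F" for T :: "bicomplex \<Rightarrow> complex"
  proof -
    have Tlim: "(\<lambda>n. sq_norm ?M (\<lambda>z. T (A n z) - T (B z))) \<longlonglongrightarrow> 0"
      if "(\<lambda>n. sq_norm ?M (\<lambda>z. A n z - B z)) \<longlonglongrightarrow> 0" "\<And>n. sq_integrable ?M (A n)" "sq_integrable ?M B" for A B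
    proof (rule tendsto_0_squeeze[OF that(1)])
      show "sq_norm ?M (\<lambda>z. T (A n z) - T (B z)) \<le> sq_norm ?M (\<lambda>z. A n z - B z)" for n
        using T_le[OF sq_integrable_diff[OF that(2)[of n] that(3)]] by (simp add: linear_diff[OF bounded_linear.linear[OF T]])
    qed simp
    have c: "C_k_compact k \<Omega> (\<lambda>z. T (\<Phi> n z))" for k n
      by (rule C_k_compact_bounded_linear[OF T \<Phi>])
    have pd: "partial_deriv e (\<lambda>z. T (\<Phi> n z)) z = T (partial_deriv e (\<Phi> n) z)" for e n z
      by (rule partial_deriv_bounded_linear[OF T C_k_compact_C_k[OF \<Phi>[of "Suc 0"]]])
    note Ti = sq_integrable_bounded_linear[OF T]
    have l0: "(\<lambda>n. sq_norm ?M (\<lambda>z. T (\<Phi> n z) - T (V z))) \<longlonglongrightarrow> 0"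
      by (rule Tlim[OF lim(1) \<Phi>i(1) Vi(1)])
    have l1: "(\<lambda>n. sq_norm ?M (\<lambda>z. partial_deriv 1 (\<lambda>z. T (\<Phi> n z)) z - T (X z))) \<longlonglongrightarrow> 0"
      unfolding pd by (rule Tlim[OF lim(2) \<Phi>i(2) Vi(2)])
    have l2: "(\<lambda>n. sq_norm ?M (\<lambda>z. partial_deriv \<i> (\<lambda>z. T (\<Phi> n z)) z - T (Y z))) \<longlonglongrightarrow> 0"
      unfolding pd by (rule Tlim[OF lim(3) \<Phi>i(3) Vi(3)])
    have w1: "has_weak_partial 1 \<Omega> (\<lambda>z. T (V z)) (\<lambda>z. T (X z))"
      by (rule has_weak_partial_limit[OF \<Omega> _ c Ti[OF Vi(1)] l0 Ti[OF Vi(2)] l1]) simp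
    have w2: "has_weak_partial \<i> \<Omega> (\<lambda>z. T (V z)) (\<lambda>z. T (Y z))"
      by (rule has_weak_partial_limit[OF \<Omega> _ c Ti[OF Vi(1)] l0 Ti[OF Vi(3)] l2]) simp
    show ?thesis
      unfolding W12_0_def L2_iff_sq_integrable L2_norm_eq_sq_norm mem_Collect_eq
    proof (intro conjI bexI exI)
      show "\<forall>n. (\<lambda>z. T (\<Phi> n z)) \<in> test_funs \<Omega>" using c by (simp add: test_funs_iff)
    qed (use l0 l1 l2 w1 w2 Ti Vi in \<open>auto simp: L2_iff_sq_integrable\<close>)
  qed
  show ?thesis
    unfolding bc_valued_def
    using *[OF bounded_linear_Sc sq_norm_Sc_le] *[OF bounded_linear_Vec sq_norm_Vec_le] by simp
qed

lemma sq_integrable_half_diff_j: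
  assumes "sq_integrable M X" "sq_integrable M Y"
  shows "sq_integrable M (\<lambda>z. (1/2) *\<^sub>R (X z - bc_j * Y z))"
  by (intro sq_integrable_scaleR sq_integrable_diff assms sq_integrable_bounded_linear[OF bounded_linear_bicomplex_mult_right])

lemma sq_norm_half_diff_j_le:
  assumes "sq_integrable M X" "sq_integrable M Y"
  shows "sq_norm M (\<lambda>z. (1/2) *\<^sub>R (X z - bc_j * Y z)) \<le> sq_norm M X + sq_norm M Y"
proof -
  have "sq_norm M (\<lambda>z. (1/2) *\<^sub>R (X z - bc_j * Y z)) = 1/2 * sq_norm M (\<lambda>z. X z + - (bc_j * Y z))"
    by (simp only: sq_norm_scaleR) simp
  also have "\<dots> \<le> 1/2 * (sq_norm M X + sq_norm M (\<lambda>z. - (bc_j * Y z)))"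
    using sq_integrable_scaleR[OF sq_integrable_bounded_linear[OF bounded_linear_bicomplex_mult_right assms(2)], of "-1" bc_j]
    by (intro mult_left_mono sq_norm_triangle assms) auto
  also have "sq_norm M (\<lambda>z. - (bc_j * Y z)) = sq_norm M Y"
    by (simp add: sq_norm_def)
  also have "1/2 * (sq_norm M X + sq_norm M Y) \<le> sq_norm M X + sq_norm M Y"
    by simp
  finally show ?thesis .
qed

lemma integral_mult_bc_d:
  assumes \<Omega>: "open \<Omega>" and \<phi>: "C_k_compact (Suc 0) \<Omega> \<phi>" and \<psi>: "C_k_compact (Suc 0) \<Omega> \<psi>"
  shows "(\<integral>z. \<phi> z * bc_d \<psi> z \<partial>lebesgue_on \<Omega>) = - (\<integral>z. bc_d \<phi> z * \<psi> z \<partial>lebesgue_on \<Omega>)"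
proof -
  let ?M = "lebesgue_on \<Omega>"
  note sq = C_k_compact_sq_integrable[OF _ \<Omega>]
  have i: "integrable ?M (\<lambda>z. \<phi> z * partial_deriv e \<psi> z)" "integrable ?M (\<lambda>z. partial_deriv e \<phi> z * \<psi> z)"
    if "e \<in> {1, \<i>}" for e
    using sq_integrable_bilinear[OF bounded_bilinear_bicomplex_mult sq[OF \<phi>] sq[OF C_k_compact_partial[OF \<psi> that]]]
      sq_integrable_bilinear[OF bounded_bilinear_bicomplex_mult sq[OF C_k_compact_partial[OF \<phi> that]] sq[OF \<psi>]] by auto
  note parts = integral_partial_deriv_bilinear[OF \<Omega> bounded_bilinear_bicomplex_mult \<phi> \<psi>]
  have ij: "integrable ?M (\<lambda>z. bc_j * (\<phi> z * partial_deriv \<i> \<psi> z))" "integrable ?M (\<lambda>z. bc_j * (partial_deriv \<i> \<phi> z * \<psi> z))"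
    using integrable_bounded_linear[OF bounded_linear_bicomplex_mult_right] i[of \<i>] by auto
  have j: "(\<integral>z. bc_j * f z \<partial>?M) = bc_j * (\<integral>z. f z \<partial>?M)" if "integrable ?M f" for f
    by (rule integral_bounded_linear[OF bounded_linear_bicomplex_mult_right that])
  have "(\<integral>z. \<phi> z * bc_d \<psi> z \<partial>?M) = (\<integral>z. (1/2) *\<^sub>R (\<phi> z * partial_deriv 1 \<psi> z - bc_j * (\<phi> z * partial_deriv \<i> \<psi> z)) \<partial>?M)"
    by (simp add: bc_d_def right_diff_distrib mult.left_commute)
  also have "\<dots> = (1/2) *\<^sub>R ((\<integral>z. \<phi> z * partial_deriv 1 \<psi> z \<partial>?M) - bc_j * (\<integral>z. \<phi> z * partial_deriv \<i> \<psi> z \<partial>?M))"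
    using i ij by (simp add: j)
  also have "\<dots> = - ((1/2) *\<^sub>R ((\<integral>z. partial_deriv 1 \<phi> z * \<psi> z \<partial>?M) - bc_j * (\<integral>z. partial_deriv \<i> \<phi> z * \<psi> z \<partial>?M)))"
    using parts[of 1] parts[of \<i>] by (simp add: scaleR_diff_right)
  also have "\<dots> = - (\<integral>z. (1/2) *\<^sub>R (partial_deriv 1 \<phi> z * \<psi> z - bc_j * (partial_deriv \<i> \<phi> z * \<psi> z)) \<partial>?M)"
    using i ij by (simp add: j)
  also have "\<dots> = - (\<integral>z. bc_d \<phi> z * \<psi> z \<partial>?M)"
    by (simp add: bc_d_def left_diff_distrib mult.assoc)
  finally show ?thesis .
qed

lemma W12_limit_bc_d:
  assumes \<Omega>: "open \<Omega>" and V: "W12_limit \<Omega> V X Y \<Phi>"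
  shows "(\<lambda>n. sq_norm (lebesgue_on \<Omega>) (\<lambda>z. bc_d (\<Phi> n) z - (1/2) *\<^sub>R (X z - bc_j * Y z))) \<longlonglongrightarrow> 0"
proof -
  let ?M = "lebesgue_on \<Omega>"
  have V': "sq_integrable ?M X" "sq_integrable ?M Y" and \<Phi>: "\<And>k n. C_k_compact k \<Omega> (\<Phi> n)"
    using V by (auto simp: W12_limit_def)
  show ?thesis
  proof (rule tendsto_0_squeeze)
    show "(\<lambda>n. sq_norm ?M (\<lambda>z. partial_deriv 1 (\<Phi> n) z - X z) + sq_norm ?M (\<lambda>z. partial_deriv \<i> (\<Phi> n) z - Y z)) \<longlonglongrightarrow> 0"
      using V tendsto_add[of _ 0 _ _ 0] by (fastforce simp: W12_limit_def)
    show "sq_norm ?M (\<lambda>z. bc_d (\<Phi> n) z - (1/2) *\<^sub>R (X z - bc_j * Y z))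
        \<le> sq_norm ?M (\<lambda>z. partial_deriv 1 (\<Phi> n) z - X z) + sq_norm ?M (\<lambda>z. partial_deriv \<i> (\<Phi> n) z - Y z)" for n
    proof -
      have "bc_d (\<Phi> n) z - (1/2) *\<^sub>R (X z - bc_j * Y z)
          = (1/2) *\<^sub>R ((partial_deriv 1 (\<Phi> n) z - X z) - bc_j * (partial_deriv \<i> (\<Phi> n) z - Y z))" for z
        by (simp add: bc_d_def right_diff_distrib scaleR_diff_right)
      thus ?thesis
        using C_k_compact_sq_integrable[OF C_k_compact_partial[OF \<Phi>[of "Suc 0" n]] \<Omega>] V'
        by (simp only:) (intro sq_norm_half_diff_j_le sq_integrable_diff; simp)
    qed
  qed simp
qed

lemma W12_limit_has_weak_d:
  assumes \<Omega>: "open \<Omega>" "bounded \<Omega>" and V: "W12_limit \<Omega> V X Y \<Phi>"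
  shows "has_weak_d \<Omega> V (\<lambda>z. (1/2) *\<^sub>R (X z - bc_j * Y z))"
proof -
  let ?M = "lebesgue_on \<Omega>"
  let ?U = "\<lambda>z. (1/2) *\<^sub>R (X z - bc_j * Y z)"
  have Vi: "sq_integrable ?M V" "sq_integrable ?M ?U" and \<Phi>: "\<And>k n. C_k_compact k \<Omega> (\<Phi> n)"
    and lim: "(\<lambda>n. sq_norm ?M (\<lambda>z. \<Phi> n z - V z)) \<longlonglongrightarrow> 0"
    using V sq_integrable_half_diff_j by (auto simp: W12_limit_def)
  note sq = C_k_compact_sq_integrable[OF _ \<Omega>(1)]
  have "(\<integral>z. V z * bc_d \<psi> z \<partial>?M) = - (\<integral>z. ?U z * \<psi> z \<partial>?M)" if "\<psi> \<in> bc_valued (test_funs \<Omega>)" for \<psi>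
  proof -
    have \<psi>: "C_k_compact (Suc 0) \<Omega> \<psi>" using that by (simp add: bc_valued_test_funs_iff)
    have 1: "(\<lambda>n. \<integral>z. \<Phi> n z * bc_d \<psi> z \<partial>?M) \<longlonglongrightarrow> (\<integral>z. V z * bc_d \<psi> z \<partial>?M)"
      by (rule tendsto_integral_bilinear[OF bounded_bilinear_bicomplex_mult Vi(1) sq[OF \<Phi>[of 0]] sq[OF C_k_compact_bc_d[OF \<psi>]] lim])
    have 2: "(\<lambda>n. \<integral>z. bc_d (\<Phi> n) z * \<psi> z \<partial>?M) \<longlonglongrightarrow> (\<integral>z. ?U z * \<psi> z \<partial>?M)"
      by (rule tendsto_integral_bilinear[OF bounded_bilinear_bicomplex_mult Vi(2) sq[OF C_k_compact_bc_d[OF \<Phi>[of "Suc 0"]]] sq[OF \<psi>]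
            W12_limit_bc_d[OF \<Omega>(1) V]])
    show ?thesis
      using LIMSEQ_unique[OF 1] tendsto_minus[OF 2] integral_mult_bc_d[OF \<Omega>(1) \<Phi> \<psi>] by simp
  qed
  thus ?thesis
    unfolding has_weak_d_def using bc_L1_loc_if_sq_integrable[OF \<Omega>] Vi by auto
qed


section \<open>The Vekua equation and its adjoint operator\<close>

text \<open>The arguments are swapped because \<open>tendsto_integral_bilinear\<close> varies the
  first factor, whereas the sequences \<open>adj (\<Phi> n)\<close> stand in the second slot of
  \<open>bc_inner\<close>. Conjugate linearity there is still linearity over the reals.\<close>

lemma bc_inner_bounded_bilinear: "bounded_bilinear (\<lambda>x y. bc_inner y x)"
proof
  show "\<exists>K. \<forall>x y. norm (bc_inner y x) \<le> norm x * norm y * K"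
  proof (intro exI allI)
    fix x y
    have "norm (bc_inner y x) \<le> norm (y * bc_dagger x)"
      unfolding bc_inner_eq_Sc by (rule norm_Sc_le)
    also have "\<dots> \<le> norm x * norm y * sqrt 2"
      using norm_bicomplex_mult_le[of y "bc_dagger x"] by (simp add: mult_ac)
    finally show "norm (bc_inner y x) \<le> norm x * norm y * sqrt 2" .
  qed
qed (auto simp: bc_inner_def algebra_simps scaleR_conv_of_real[where 'a=complex])

lemma bc_inner_self: "bc_inner W W = of_real ((norm W)\<^sup>2)"
  by (simp add: bc_inner_def norm_bicomplex_def complex_mult_cnj cmod_power2)

text \<open>The dagger is a ring homomorphism that sends j to -j, and being real linear it commutes
  with the real partial derivatives.\<close>

lemma bc_dagger_bc_d:
  assumes "C_k (Suc k) \<phi>"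
  shows "bc_dagger (bc_d \<phi> z) = bc_dbar (\<lambda>z. bc_dagger (\<phi> z)) z"
  by (simp add: bc_d_def bc_dbar_def partial_deriv_bounded_linear[OF bounded_linear_bc_dagger assms] bicomplex_eq_iff
      flip: scaleR_minus_right)

lemma bc_d_cmult:
  assumes "C_k (Suc k) \<phi>"
  shows "bc_d (\<lambda>z. c * \<phi> z) z = c * bc_d \<phi> z" "bc_dbar (\<lambda>z. c * \<phi> z) z = c * bc_dbar \<phi> z"
  by (simp_all add: bc_d_def bc_dbar_def partial_deriv_bounded_linear[OF bounded_linear_bicomplex_mult_right assms]
      right_diff_distrib distrib_left mult.left_commute)

lemma bc_d_add:
  assumes "C_k (Suc k) \<phi>" "C_k (Suc k) \<psi>"
  shows "bc_d (\<lambda>z. \<phi> z + \<psi> z) z = bc_d \<phi> z + bc_d \<psi> z"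
  by (simp add: bc_d_def partial_deriv_add[OF assms] scaleR_add_right scaleR_diff_right distrib_left)

lemma complex_subspace_diff:
  assumes A: "complex_subspace A" and F: "F \<in> A" and G: "G \<in> A"
  shows "(\<lambda>z. F z - G z) \<in> A"
proof -
  have add: "\<forall>F\<in>A. \<forall>G\<in>A. (\<lambda>z. F z + G z) \<in> A" and "(\<lambda>z. Bicomplex (-1) 0 * G z) \<in> A"
    using A G by (auto simp: complex_subspace_def)
  moreover have "F z + Bicomplex (-1) 0 * G z = F z - G z" for z
    by (simp add: bicomplex_eq_iff)
  ultimately show ?thesis using bspec[OF bspec[OF add F], of "\<lambda>z. Bicomplex (-1) 0 * G z"] by simp
qed

text \<open>A real constant \<open>K\<close> stands in for the extended real essential suprema.
  \<open>K_small\<close> is exactly the positivity of the factor in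
  \<open>adj_coercive\<close>.\<close>

locale vekua_coefficients =
  fixes \<Omega> :: "complex set" and a b :: "complex \<Rightarrow> bicomplex" and K :: real
  assumes open_domain: "open \<Omega>" and bounded_domain: "bounded \<Omega>" and nonempty_domain: "\<Omega> \<noteq> {}"
    and a_measurable: "a \<in> borel_measurable (lebesgue_on \<Omega>)" and b_measurable: "b \<in> borel_measurable (lebesgue_on \<Omega>)"
    and K_nonneg: "0 \<le> K"
    and a_le: "AE z in lebesgue_on \<Omega>. norm (a z) \<le> K" and b_le: "AE z in lebesgue_on \<Omega>. norm (b z) \<le> K"
    and K_small: "2 * sqrt 2 * K * diameter \<Omega> < 1"
begin

abbreviation M :: "complex measure" where "M \<equiv> lebesgue_on \<Omega>"

definition low :: "(complex \<Rightarrow> bicomplex) \<Rightarrow> complex \<Rightarrow> bicomplex" where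
  "low V z = bc_dagger (a z) * V z + bc_star (b z) * bc_bar (V z)"

definition adj :: "(complex \<Rightarrow> bicomplex) \<Rightarrow> complex \<Rightarrow> bicomplex" where
  "adj \<phi> z = bc_d \<phi> z + low \<phi> z"

definition vek :: "(complex \<Rightarrow> bicomplex) \<Rightarrow> complex \<Rightarrow> bicomplex" where
  "vek W z = a z * W z + b z * bc_bar (W z)"

lemmas test_sq = C_k_compact_sq_integrable[OF _ open_domain]

text \<open>With norm-preserving \<open>T\<close> and \<open>S\<close> the estimate serves both
  operators: dagger and star give \<open>low\<close>, identities give \<open>vek\<close>. Each of
  the two products contributes sqrt 2 K.\<close>

lemma lower_order:
  assumes V: "sq_integrable M V" and T: "bounded_linear T" "bounded_linear S" "\<And>W. norm (T W) = norm W" "\<And>W. norm (S W) = norm W"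
  shows "sq_integrable M (\<lambda>z. T (a z) * V z + S (b z) * bc_bar (V z))"
    "sq_norm M (\<lambda>z. T (a z) * V z + S (b z) * bc_bar (V z)) \<le> 2 * sqrt 2 * K * sq_norm M V"
proof -
  have mult: "(\<lambda>z. F z * G z) \<in> borel_measurable M" if "F \<in> borel_measurable M" "G \<in> borel_measurable M"
    for F G :: "complex \<Rightarrow> bicomplex"
    by (rule borel_measurable_continuous_Pair[OF that])
      (intro bounded_bilinear.continuous_on[OF bounded_bilinear_bicomplex_mult] continuous_on_fst continuous_on_snd continuous_on_id)
  have m: "(\<lambda>z. T (a z) * V z + S (b z) * bc_bar (V z)) \<in> borel_measurable M"
    by (intro borel_measurable_add mult borel_measurable_bounded_linear[OF T(1) a_measurable]
        borel_measurable_bounded_linear[OF T(2) b_measurable]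
        borel_measurable_bounded_linear[OF bounded_linear_bc_bar] sq_integrable_measurable[OF V])
  have le: "AE z in M. norm (T (a z) * V z + S (b z) * bc_bar (V z)) \<le> (2 * sqrt 2 * K) * norm (V z)"
    using a_le b_le
  proof eventually_elim
    case (elim z)
    have *: "norm (W * V') \<le> sqrt 2 * (K * norm V')" if "norm W \<le> K" for W V' :: bicomplex
      using norm_bicomplex_mult_le[of W V'] mult_right_mono[OF that, of "norm V'"] by (smt (verit) mult_left_mono norm_ge_zero real_sqrt_ge_zero)
    have "norm (T (a z) * V z + S (b z) * bc_bar (V z)) \<le> norm (T (a z) * V z) + norm (S (b z) * bc_bar (V z))"
      by (rule norm_triangle_ineq)
    also have "\<dots> \<le> sqrt 2 * (K * norm (V z)) + sqrt 2 * (K * norm (bc_bar (V z)))"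
      using elim by (intro add_mono *) (auto simp: T)
    finally show ?case by (simp add: mult_ac)
  qed
  show "sq_integrable M (\<lambda>z. T (a z) * V z + S (b z) * bc_bar (V z))"
    by (rule sq_integrable_bounded_by[OF m V le])
  show "sq_norm M (\<lambda>z. T (a z) * V z + S (b z) * bc_bar (V z)) \<le> 2 * sqrt 2 * K * sq_norm M V"
    by (rule sq_norm_bounded_by[OF m V le]) (use K_nonneg in simp)
qed

lemma sq_integrable_low: "sq_integrable M V \<Longrightarrow> sq_integrable M (low V)"
  and sq_norm_low: "sq_integrable M V \<Longrightarrow> sq_norm M (low V) \<le> 2 * sqrt 2 * K * sq_norm M V"
  using lower_order[OF _ bounded_linear_bc_dagger bounded_linear_bc_star] by (simp_all add: low_def[abs_def])

lemma sq_integrable_vek: "sq_integrable M W \<Longrightarrow> sq_integrable M (vek W)"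
  using lower_order(1)[OF _ bounded_linear_ident bounded_linear_ident] by (simp add: vek_def[abs_def])

text \<open>The scalars are restricted to complex ones because \<open>bc_bar\<close> fixes these but
  changes the sign of j.\<close>

lemma low_add: "low (\<lambda>z. V z + W z) z = low V z + low W z"
  and low_diff: "low (\<lambda>z. V z - W z) z = low V z - low W z"
  and low_cmult: "low (\<lambda>z. Bicomplex c 0 * V z) z = Bicomplex c 0 * low V z"
  by (simp_all add: low_def bicomplex_eq_iff algebra_simps)

lemma sq_integrable_adj: "C_k_compact (Suc 0) \<Omega> \<phi> \<Longrightarrow> sq_integrable M (adj \<phi>)"
  unfolding adj_def[abs_def] by (intro sq_integrable_add sq_integrable_low test_sq[OF C_k_compact_bc_d] test_sq)

lemma adj_add:
  assumes "C_k (Suc k) \<phi>" "C_k (Suc k) \<psi>"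
  shows "adj (\<lambda>z. \<phi> z + \<psi> z) z = adj \<phi> z + adj \<psi> z"
  by (simp add: adj_def bc_d_add[OF assms] low_add)

lemma adj_cmult:
  assumes "C_k (Suc k) \<phi>"
  shows "adj (\<lambda>z. Bicomplex c 0 * \<phi> z) z = Bicomplex c 0 * adj \<phi> z"
  by (simp add: adj_def bc_d_cmult[OF assms] low_cmult distrib_left)

lemma adj_coercive:
  assumes \<phi>: "C_k_compact (Suc 0) \<Omega> \<phi>"
  shows "(1 - 2 * sqrt 2 * K * diameter \<Omega>) * sq_norm M (bc_d \<phi>) \<le> sq_norm M (adj \<phi>)"
proof -
  have "sq_norm M (bc_d \<phi>) = sq_norm M (\<lambda>z. adj \<phi> z + (-1) *\<^sub>R low \<phi> z)"
    by (simp add: adj_def)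
  also have "\<dots> \<le> sq_norm M (adj \<phi>) + sq_norm M (\<lambda>z. (-1) *\<^sub>R low \<phi> z)"
    by (intro sq_norm_triangle sq_integrable_adj \<phi> sq_integrable_scaleR sq_integrable_low test_sq[OF \<phi>])
  also have "sq_norm M (\<lambda>z. (-1) *\<^sub>R low \<phi> z) = sq_norm M (low \<phi>)"
    unfolding sq_norm_scaleR by simp
  also have "\<dots> \<le> 2 * sqrt 2 * K * sq_norm M \<phi>"
    by (rule sq_norm_low[OF test_sq[OF \<phi>]])
  also have "\<dots> \<le> 2 * sqrt 2 * K * (diameter \<Omega> * sq_norm M (bc_d \<phi>))"
    using K_nonneg bc_d_bounds(1)[OF \<phi> open_domain bounded_domain nonempty_domain] by (intro mult_left_mono) auto
  finally show ?thesis by (simp add: algebra_simps)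
qed

section \<open>Weak form of the Vekua equation\<close>

definition weak_form :: "(complex \<Rightarrow> bicomplex) \<Rightarrow> (complex \<Rightarrow> bicomplex) \<Rightarrow> bicomplex" where
  "weak_form W \<psi> = (\<integral>z. W z * bc_dbar \<psi> z + vek W z * \<psi> z \<partial>M)"

lemma weak_form_integrable:
  assumes "sq_integrable M W" "C_k_compact (Suc 0) \<Omega> \<psi>"
  shows "integrable M (\<lambda>z. W z * bc_dbar \<psi> z)" "integrable M (\<lambda>z. vek W z * \<psi> z)"
  by (rule sq_integrable_bilinear[OF bounded_bilinear_bicomplex_mult assms(1) test_sq[OF C_k_compact_bc_dbar[OF assms(2)]]]
      sq_integrable_bilinear[OF bounded_bilinear_bicomplex_mult sq_integrable_vek[OF assms(1)] test_sq[OF assms(2)]])+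

lemma bc_L2_inner_adj:
  assumes W: "sq_integrable M W" and \<phi>: "C_k_compact (Suc 0) \<Omega> \<phi>"
  shows "bc_L2_inner \<Omega> W (adj \<phi>) = Sc (weak_form W (\<lambda>z. bc_dagger (\<phi> z)))"
proof -
  let ?\<psi> = "\<lambda>z. bc_dagger (\<phi> z)"
  have \<psi>: "C_k_compact (Suc 0) \<Omega> ?\<psi>"
    by (rule C_k_compact_bounded_linear[OF bounded_linear_bc_dagger \<phi>])
  have "bc_inner (W z) (adj \<phi> z) = Sc (W z * bc_dbar ?\<psi> z + vek W z * ?\<psi> z)" for z
  proof -
    have "bc_inner (W z) (adj \<phi> z) = Sc (W z * bc_dagger (bc_d \<phi> z) + W z * bc_dagger (low \<phi> z))"
      by (simp add: bc_inner_def adj_def algebra_simps)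
    also have "bc_dagger (bc_d \<phi> z) = bc_dbar ?\<psi> z"
      by (rule bc_dagger_bc_d[OF C_k_compact_C_k[OF \<phi>]])
    \<comment> \<open>The dagger of \<open>bc_dagger (a z)\<close> is \<open>a z\<close>, and that
      of \<open>bc_star (b z)\<close> is the bar of \<open>b z\<close>. As bar is multiplicative and
      does not change \<open>Sc\<close>, it can be moved from \<open>b z\<close> and the test
      function onto \<open>W z\<close>; this is why the adjoint carries
      \<open>bc_star\<close>.\<close>
    also have "Sc (W z * bc_dbar ?\<psi> z + W z * bc_dagger (low \<phi> z)) = Sc (W z * bc_dbar ?\<psi> z + vek W z * ?\<psi> z)"
      by (simp add: low_def vek_def algebra_simps)
    finally show ?thesis .
  qed
  thus ?thesis
    unfolding bc_L2_inner_def weak_form_def using weak_form_integrable[OF W \<psi>]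
    by (subst Sc_eq_integral) auto
qed

lemma vekua_bergman_iff:
  "W \<in> vekua_bergman \<Omega> a b \<longleftrightarrow>
    sq_integrable M W \<and> (\<forall>\<psi>\<in>bc_valued (test_funs \<Omega>). weak_form W \<psi> = 0)"
proof -
  have "has_weak_dbar \<Omega> W (vek W) \<longleftrightarrow> (\<forall>\<psi>\<in>bc_valued (test_funs \<Omega>). weak_form W \<psi> = 0)" if W: "sq_integrable M W"
  proof -
    have "weak_form W \<psi> = 0 \<longleftrightarrow> (\<integral>z. W z * bc_dbar \<psi> z \<partial>M) = - (\<integral>z. vek W z * \<psi> z \<partial>M)"
      if "\<psi> \<in> bc_valued (test_funs \<Omega>)" for \<psi>
    proof -
      have "C_k_compact (Suc 0) \<Omega> \<psi>" using that by (simp add: bc_valued_test_funs_iff)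
      thus ?thesis
        using weak_form_integrable[OF W] by (simp add: weak_form_def add_eq_0_iff2)
    qed
    thus ?thesis
      using bc_L1_loc_if_sq_integrable[OF open_domain bounded_domain] W sq_integrable_vek[OF W]
      by (auto simp: has_weak_dbar_def)
  qed
  moreover have "vek W = (\<lambda>z. a z * W z + b z * bc_bar (W z))" by (simp add: vek_def[abs_def])
  ultimately show ?thesis
    by (auto simp: vekua_bergman_def bc_valued_L2_iff)
qed

lemma vekua_bergman_orthogonal_test:
  assumes W: "W \<in> vekua_bergman \<Omega> a b" and \<phi>: "\<And>k. C_k_compact k \<Omega> \<phi>"
  shows "bc_L2_inner \<Omega> W (adj \<phi>) = 0"
proof -
  have "(\<lambda>z. bc_dagger (\<phi> z)) \<in> bc_valued (test_funs \<Omega>)"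
    unfolding bc_valued_test_funs_iff by (intro allI C_k_compact_bounded_linear[OF bounded_linear_bc_dagger \<phi>])
  thus ?thesis
    using W bc_L2_inner_adj[OF _ \<phi>] by (simp add: vekua_bergman_iff)
qed

text \<open>The scalar part of the weak form determines it, since it is linear over the bicomplex numbers in the test function.\<close>

lemma vekua_bergmanI_orthogonal:
  assumes W: "sq_integrable M W" and 0: "\<And>\<phi>. (\<And>k. C_k_compact k \<Omega> \<phi>) \<Longrightarrow> Re (bc_L2_inner \<Omega> W (adj \<phi>)) = 0"
  shows "W \<in> vekua_bergman \<Omega> a b"
  unfolding vekua_bergman_iff
proof (intro conjI ballI)
  fix \<psi> assume "\<psi> \<in> bc_valued (test_funs \<Omega>)"
  hence \<psi>: "C_k_compact k \<Omega> \<psi>" for k by (simp add: bc_valued_test_funs_iff)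
  let ?X = "weak_form W \<psi>"
  have c: "Re (Sc (c * ?X)) = 0" for c
  proof -
    have cm: "C_k_compact k \<Omega> (\<lambda>z. c * \<psi> z)" for k
      by (rule C_k_compact_bounded_linear[OF bounded_linear_bicomplex_mult_right \<psi>])
    have "C_k_compact k \<Omega> (\<lambda>z. bc_dagger (c * \<psi> z))" for k
      by (rule C_k_compact_bounded_linear[OF bounded_linear_bc_dagger cm])
    from 0[OF this] bc_L2_inner_adj[OF W this[of "Suc 0"]]
    have "Re (Sc (weak_form W (\<lambda>z. bc_dagger (bc_dagger (c * \<psi> z))))) = 0" by simp
    moreover have "bc_dagger (bc_dagger V) = V" for V by (simp add: bicomplex_eq_iff)
    ultimately have "Re (Sc (weak_form W (\<lambda>z. c * \<psi> z))) = 0" by simp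
    also have "weak_form W (\<lambda>z. c * \<psi> z) = (\<integral>z. c * (W z * bc_dbar \<psi> z + vek W z * \<psi> z) \<partial>M)"
      unfolding weak_form_def bc_d_cmult(2)[OF C_k_compact_C_k[OF \<psi>[of "Suc 0"]]]
      by (simp add: distrib_left mult.left_commute)
    also have "\<dots> = c * ?X"
      unfolding weak_form_def
      by (rule integral_bounded_linear[OF bounded_linear_bicomplex_mult_right])
        (use weak_form_integrable[OF W \<psi>] in auto)
    finally show ?thesis .
  qed
  \<comment> \<open>Multiplication by 1, i, j and i j brings each of the four real coordinates of
    \<open>?X\<close>, up to sign, into the real part of \<open>Sc\<close>.\<close>
  show "?X = 0"
    using c[of 1] c[of "Bicomplex \<i> 0"] c[of bc_j] c[of "Bicomplex 0 \<i>"]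
    by (simp add: bicomplex_eq_iff complex_eq_iff)
qed (rule W)

section \<open>The range of the adjoint operator\<close>

lemma adjoint_range_iff:
  "G \<in> adjoint_range \<Omega> a b \<longleftrightarrow> (\<exists>V X Y \<Phi>. W12_limit \<Omega> V X Y \<Phi> \<and>
     (AE z in M. G z = (1/2) *\<^sub>R (X z - bc_j * Y z) + low V z))" (is "_ \<longleftrightarrow> ?R")
proof
  assume "G \<in> adjoint_range \<Omega> a b"
  then obtain V U where V: "V \<in> bc_valued (W12_0 \<Omega>)" and U: "has_weak_d \<Omega> V U"
    and G: "AE z in M. G z = U z + bc_dagger (a z) * V z + bc_star (b z) * bc_bar (V z)"
    unfolding adjoint_range_def by blast
  obtain X Y \<Phi> where L: "W12_limit \<Omega> V X Y \<Phi>"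
    using W12_0_imp_W12_limit[OF open_domain V] .
  \<comment> \<open>\<open>U\<close> was an arbitrary weak derivative; uniqueness ties it to the
    partial derivatives of the approximating sequence.\<close>
  have "AE z in M. U z = (1/2) *\<^sub>R (X z - bc_j * Y z)"
    by (rule has_weak_d_unique[OF open_domain U W12_limit_has_weak_d[OF open_domain bounded_domain L]])
  with G have "AE z in M. G z = (1/2) *\<^sub>R (X z - bc_j * Y z) + low V z"
    by eventually_elim (simp add: low_def add.assoc)
  thus ?R using L by blast
next
  assume ?R
  then obtain V X Y \<Phi> where L: "W12_limit \<Omega> V X Y \<Phi>" and G: "AE z in M. G z = (1/2) *\<^sub>R (X z - bc_j * Y z) + low V z"
    by blast
  show "G \<in> adjoint_range \<Omega> a b"
    unfolding adjoint_range_def mem_Collect_eq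
  proof (intro bexI exI conjI)
    show "has_weak_d \<Omega> V (\<lambda>z. (1/2) *\<^sub>R (X z - bc_j * Y z))"
      by (rule W12_limit_has_weak_d[OF open_domain bounded_domain L])
    show "AE z in M. G z = (1/2) *\<^sub>R (X z - bc_j * Y z) + bc_dagger (a z) * V z + bc_star (b z) * bc_bar (V z)"
      using G by eventually_elim (simp add: low_def add.assoc)
  qed (rule W12_limit_imp_W12_0[OF open_domain bounded_domain L])
qed

lemma sq_integrable_limit_value:
  assumes "W12_limit \<Omega> V X Y \<Phi>"
  shows "sq_integrable M (\<lambda>z. (1/2) *\<^sub>R (X z - bc_j * Y z) + low V z)"
  using assms unfolding W12_limit_def
  by (intro sq_integrable_add sq_integrable_half_diff_j sq_integrable_low) auto

lemma adjoint_range_sq_integrable: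
  assumes "G \<in> adjoint_range \<Omega> a b"
  shows "sq_integrable M G"
  using assms sq_integrable_AE_cong[OF open_domain sq_integrable_limit_value] unfolding adjoint_range_iff by blast

text \<open>The operator is continuous for the Sobolev norm, so its values on Sobolev limits lie in
  the closure of its values on test functions.\<close>

lemma W12_limit_adj:
  assumes L: "W12_limit \<Omega> V X Y \<Phi>"
  shows "(\<lambda>n. sq_norm M (\<lambda>z. adj (\<Phi> n) z - ((1/2) *\<^sub>R (X z - bc_j * Y z) + low V z))) \<longlonglongrightarrow> 0"
proof (rule tendsto_0_squeeze)
  let ?U = "\<lambda>z. (1/2) *\<^sub>R (X z - bc_j * Y z)"
  have Vi: "sq_integrable M V" "sq_integrable M ?U" and \<Phi>: "\<And>k n. C_k_compact k \<Omega> (\<Phi> n)"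
    and lim: "(\<lambda>n. sq_norm M (\<lambda>z. \<Phi> n z - V z)) \<longlonglongrightarrow> 0"
    using L sq_integrable_half_diff_j by (auto simp: W12_limit_def)
  show "(\<lambda>n. sq_norm M (\<lambda>z. bc_d (\<Phi> n) z - ?U z) + 2 * sqrt 2 * K * sq_norm M (\<lambda>z. \<Phi> n z - V z)) \<longlonglongrightarrow> 0"
    using tendsto_add[OF W12_limit_bc_d[OF open_domain L] tendsto_mult_right_zero[OF lim, of "2 * sqrt 2 * K"]] by simp
  fix n
  have i: "sq_integrable M (\<lambda>z. \<Phi> n z - V z)" "sq_integrable M (\<lambda>z. bc_d (\<Phi> n) z - ?U z)"
    by (intro sq_integrable_diff test_sq[OF \<Phi>[of 0]] test_sq[OF C_k_compact_bc_d[OF \<Phi>[of "Suc 0"]]] Vi)+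
  have "sq_norm M (\<lambda>z. adj (\<Phi> n) z - (?U z + low V z))
      = sq_norm M (\<lambda>z. (bc_d (\<Phi> n) z - ?U z) + low (\<lambda>z. \<Phi> n z - V z) z)"
    by (simp add: adj_def low_diff algebra_simps)
  also have "\<dots> \<le> sq_norm M (\<lambda>z. bc_d (\<Phi> n) z - ?U z) + sq_norm M (low (\<lambda>z. \<Phi> n z - V z))"
    by (rule sq_norm_triangle[OF i(2) sq_integrable_low[OF i(1)]])
  also have "\<dots> \<le> sq_norm M (\<lambda>z. bc_d (\<Phi> n) z - ?U z) + 2 * sqrt 2 * K * sq_norm M (\<lambda>z. \<Phi> n z - V z)"
    by (intro add_left_mono sq_norm_low i)
  finally show "sq_norm M (\<lambda>z. adj (\<Phi> n) z - (?U z + low V z))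
      \<le> sq_norm M (\<lambda>z. bc_d (\<Phi> n) z - ?U z) + 2 * sqrt 2 * K * sq_norm M (\<lambda>z. \<Phi> n z - V z)" .
qed simp

lemma bc_L2_inner_AE_cong:
  assumes "sq_integrable M W" "sq_integrable M G" "sq_integrable M H" "AE z in M. G z = H z"
  shows "bc_L2_inner \<Omega> W G = bc_L2_inner \<Omega> W H"
proof -
  have "integrable M (\<lambda>z. bc_inner (W z) (F z))" if "sq_integrable M F" for F
    by (rule sq_integrable_bilinear[OF bc_inner_bounded_bilinear that assms(1)])
  thus ?thesis
    unfolding bc_L2_inner_def using assms
    by (intro integral_cong_AE borel_measurable_integrable) (auto elim!: eventually_mono)
qed

text \<open>For test functions this is the weak equation; continuity of the pairing carries it to
  Sobolev limits, and equality almost everywhere to all representatives.\<close>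

lemma vekua_bergman_orthogonal:
  assumes W: "W \<in> vekua_bergman \<Omega> a b" and G: "G \<in> adjoint_range \<Omega> a b"
  shows "bc_L2_inner \<Omega> W G = 0"
proof -
  obtain V X Y \<Phi> where L: "W12_limit \<Omega> V X Y \<Phi>" and GE: "AE z in M. G z = (1/2) *\<^sub>R (X z - bc_j * Y z) + low V z"
    using G unfolding adjoint_range_iff by blast
  let ?G = "\<lambda>z. (1/2) *\<^sub>R (X z - bc_j * Y z) + low V z"
  have Wi: "sq_integrable M W" using W by (simp add: vekua_bergman_iff)
  have \<Phi>: "\<And>k n. C_k_compact k \<Omega> (\<Phi> n)" using L by (simp add: W12_limit_def)
  have "(\<lambda>n. bc_L2_inner \<Omega> W (adj (\<Phi> n))) \<longlonglongrightarrow> bc_L2_inner \<Omega> W ?G"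
    unfolding bc_L2_inner_def
    by (rule tendsto_integral_bilinear[OF bc_inner_bounded_bilinear sq_integrable_limit_value[OF L] sq_integrable_adj[OF \<Phi>]
          Wi W12_limit_adj[OF L]])
  hence "bc_L2_inner \<Omega> W ?G = 0"
    by (simp add: vekua_bergman_orthogonal_test[OF W \<Phi>] LIMSEQ_const_iff)
  thus ?thesis
    using bc_L2_inner_AE_cong[OF Wi adjoint_range_sq_integrable[OF G] sq_integrable_limit_value[OF L] GE] by simp
qed

section \<open>Complex subspaces\<close>

lemma complex_subspace_vekua_bergman: "complex_subspace (vekua_bergman \<Omega> a b)"
proof -
  have "(\<lambda>z. 0) \<in> vekua_bergman \<Omega> a b"
  proof -
    have "bc_bar 0 = 0" by (simp add: bicomplex_eq_iff)
    thus ?thesis by (simp add: vekua_bergman_iff weak_form_def vek_def)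
  qed
  moreover have "(\<lambda>z. F z + G z) \<in> vekua_bergman \<Omega> a b"
    if F: "F \<in> vekua_bergman \<Omega> a b" and G: "G \<in> vekua_bergman \<Omega> a b" for F G
  proof -
    have i: "sq_integrable M F" "sq_integrable M G" using F G by (auto simp: vekua_bergman_iff)
    have "weak_form (\<lambda>z. F z + G z) \<psi> = weak_form F \<psi> + weak_form G \<psi>" if "\<psi> \<in> bc_valued (test_funs \<Omega>)" for \<psi>
    proof -
      have \<psi>: "C_k_compact (Suc 0) \<Omega> \<psi>" using that by (simp add: bc_valued_test_funs_iff)
      have "weak_form (\<lambda>z. F z + G z) \<psi>
          = (\<integral>z. (F z * bc_dbar \<psi> z + vek F z * \<psi> z) + (G z * bc_dbar \<psi> z + vek G z * \<psi> z) \<partial>M)"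
        unfolding weak_form_def
        by (intro Bochner_Integration.integral_cong refl) (simp add: vek_def bicomplex_eq_iff algebra_simps)
      thus ?thesis
        using weak_form_integrable[OF i(1) \<psi>] weak_form_integrable[OF i(2) \<psi>] by (simp add: weak_form_def)
    qed
    thus ?thesis using F G by (auto simp: vekua_bergman_iff intro: sq_integrable_add)
  qed
  moreover have "(\<lambda>z. Bicomplex c 0 * F z) \<in> vekua_bergman \<Omega> a b" if F: "F \<in> vekua_bergman \<Omega> a b" for c F
  proof -
    have i: "sq_integrable M F" using F by (auto simp: vekua_bergman_iff)
    have "weak_form (\<lambda>z. Bicomplex c 0 * F z) \<psi> = Bicomplex c 0 * weak_form F \<psi>" if "\<psi> \<in> bc_valued (test_funs \<Omega>)" for \<psi>
    proof -
      have \<psi>: "C_k_compact (Suc 0) \<Omega> \<psi>" using that by (simp add: bc_valued_test_funs_iff)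
      have "weak_form (\<lambda>z. Bicomplex c 0 * F z) \<psi> = (\<integral>z. Bicomplex c 0 * (F z * bc_dbar \<psi> z + vek F z * \<psi> z) \<partial>M)"
        unfolding weak_form_def
        by (intro Bochner_Integration.integral_cong refl) (simp add: vek_def bicomplex_eq_iff algebra_simps)
      also have "\<dots> = Bicomplex c 0 * weak_form F \<psi>"
        unfolding weak_form_def
        by (rule integral_bounded_linear[OF bounded_linear_bicomplex_mult_right])
          (use weak_form_integrable[OF i \<psi>] in auto)
      finally show ?thesis .
    qed
    thus ?thesis
      using F sq_integrable_bounded_linear[OF bounded_linear_bicomplex_mult_right i] by (auto simp: vekua_bergman_iff)
  qed
  ultimately show ?thesis by (simp add: complex_subspace_def)
qed

lemma W12_limit_add:
  assumes L: "W12_limit \<Omega> V X Y \<Phi>" and L': "W12_limit \<Omega> V' X' Y' \<Phi>'"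
  shows "W12_limit \<Omega> (\<lambda>z. V z + V' z) (\<lambda>z. X z + X' z) (\<lambda>z. Y z + Y' z) (\<lambda>n z. \<Phi> n z + \<Phi>' n z)"
proof -
  have \<Phi>: "\<And>k n. C_k_compact k \<Omega> (\<Phi> n)" "\<And>k n. C_k_compact k \<Omega> (\<Phi>' n)"
    using L L' by (auto simp: W12_limit_def)
  have pd: "partial_deriv e (\<lambda>z. \<Phi> n z + \<Phi>' n z) z = partial_deriv e (\<Phi> n) z + partial_deriv e (\<Phi>' n) z" for e n z
    by (rule partial_deriv_add[OF C_k_compact_C_k[OF \<Phi>(1)[of "Suc 0"]] C_k_compact_C_k[OF \<Phi>(2)[of "Suc 0"]]])
  have lim: "(\<lambda>n. sq_norm M (\<lambda>z. (A n z + A' n z) - (B z + B' z))) \<longlonglongrightarrow> 0"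
    if "(\<lambda>n. sq_norm M (\<lambda>z. A n z - B z)) \<longlonglongrightarrow> 0" "(\<lambda>n. sq_norm M (\<lambda>z. A' n z - B' z)) \<longlonglongrightarrow> 0"
      and i: "\<And>n. sq_integrable M (A n)" "sq_integrable M B" "\<And>n. sq_integrable M (A' n)" "sq_integrable M B'"
    for A A' :: "nat \<Rightarrow> complex \<Rightarrow> bicomplex" and B B'
  proof (rule tendsto_0_squeeze)
    show "(\<lambda>n. sq_norm M (\<lambda>z. A n z - B z) + sq_norm M (\<lambda>z. A' n z - B' z)) \<longlonglongrightarrow> 0"
      using tendsto_add[OF that(1,2)] by simp
    show "sq_norm M (\<lambda>z. (A n z + A' n z) - (B z + B' z)) \<le> sq_norm M (\<lambda>z. A n z - B z) + sq_norm M (\<lambda>z. A' n z - B' z)" for n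
      using sq_norm_triangle[OF sq_integrable_diff[OF i(1,2)] sq_integrable_diff[OF i(3,4)], of n n]
      by (simp add: algebra_simps)
  qed simp
  have i: "sq_integrable M (\<Phi> n)" "sq_integrable M (\<Phi>' n)" "sq_integrable M (partial_deriv 1 (\<Phi> n))"
    "sq_integrable M (partial_deriv 1 (\<Phi>' n))" "sq_integrable M (partial_deriv \<i> (\<Phi> n))" "sq_integrable M (partial_deriv \<i> (\<Phi>' n))" for n
    using test_sq[OF \<Phi>(1)[of 0]] test_sq[OF \<Phi>(2)[of 0]] test_sq[OF C_k_compact_partial[OF \<Phi>(1)[of "Suc 0"]]]
      test_sq[OF C_k_compact_partial[OF \<Phi>(2)[of "Suc 0"]]] by auto
  show ?thesis
    using L L' i \<Phi> unfolding W12_limit_def pd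
    by (intro conjI lim allI C_k_compact_add sq_integrable_add) auto
qed

lemma W12_limit_cmult:
  assumes L: "W12_limit \<Omega> V X Y \<Phi>"
  shows "W12_limit \<Omega> (\<lambda>z. Bicomplex c 0 * V z) (\<lambda>z. Bicomplex c 0 * X z) (\<lambda>z. Bicomplex c 0 * Y z)
    (\<lambda>n z. Bicomplex c 0 * \<Phi> n z)"
proof -
  note lin = bounded_linear_bicomplex_mult_right[of "Bicomplex c 0"]
  have \<Phi>: "\<And>k n. C_k_compact k \<Omega> (\<Phi> n)" using L by (auto simp: W12_limit_def)
  have pd: "partial_deriv e (\<lambda>z. Bicomplex c 0 * \<Phi> n z) z = Bicomplex c 0 * partial_deriv e (\<Phi> n) z" for e n z
    by (rule partial_deriv_bounded_linear[OF lin C_k_compact_C_k[OF \<Phi>[of "Suc 0"]]])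
  have lim: "(\<lambda>n. sq_norm M (\<lambda>z. Bicomplex c 0 * A n z - Bicomplex c 0 * B z)) \<longlonglongrightarrow> 0"
    if "(\<lambda>n. sq_norm M (\<lambda>z. A n z - B z)) \<longlonglongrightarrow> 0" for A :: "nat \<Rightarrow> complex \<Rightarrow> bicomplex" and B
    unfolding right_diff_distrib[symmetric] sq_norm_complex_mult using tendsto_mult_right_zero[OF that] .
  show ?thesis
    using L unfolding W12_limit_def pd
    by (intro conjI lim allI C_k_compact_bounded_linear[OF lin] sq_integrable_bounded_linear[OF lin]) auto
qed

lemma complex_subspace_adjoint_range: "complex_subspace (adjoint_range \<Omega> a b)"
proof -
  have "W12_limit \<Omega> (\<lambda>z. 0) (\<lambda>z. 0) (\<lambda>z. 0) (\<lambda>n z. 0)"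
  proof -
    have "C_k_compact k \<Omega> (\<lambda>z. 0 :: bicomplex)" for k
      by (auto simp: C_k_compact_def C_k_const intro!: exI[of _ "{}"])
    moreover have "partial_deriv e (\<lambda>z. 0 :: bicomplex) z = 0" for e z
      by (rule partial_deriv_eqI) simp
    ultimately show ?thesis by (simp add: W12_limit_def sq_norm_def)
  qed
  moreover have "low (\<lambda>z. 0) z = 0" for z by (simp add: low_def bicomplex_eq_iff)
  ultimately have "(\<lambda>z. 0) \<in> adjoint_range \<Omega> a b"
    unfolding adjoint_range_iff by (intro exI[of _ "\<lambda>z. 0"] exI[of _ "\<lambda>n z. 0"]) simp
  moreover have "(\<lambda>z. F z + G z) \<in> adjoint_range \<Omega> a b"
    if F: "F \<in> adjoint_range \<Omega> a b" and G: "G \<in> adjoint_range \<Omega> a b" for F G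
  proof -
    obtain V X Y \<Phi> where L: "W12_limit \<Omega> V X Y \<Phi>" and FE: "AE z in M. F z = (1/2) *\<^sub>R (X z - bc_j * Y z) + low V z"
      using F unfolding adjoint_range_iff by blast
    obtain V' X' Y' \<Phi>' where L': "W12_limit \<Omega> V' X' Y' \<Phi>'"
      and GE: "AE z in M. G z = (1/2) *\<^sub>R (X' z - bc_j * Y' z) + low V' z"
      using G unfolding adjoint_range_iff by blast
    have "AE z in M. F z + G z = (1/2) *\<^sub>R ((X z + X' z) - bc_j * (Y z + Y' z)) + low (\<lambda>z. V z + V' z) z"
      using FE GE
    proof eventually_elim
      case (elim z)
      show ?case unfolding elim low_add by (simp add: algebra_simps)
    qed
    thus ?thesis
      unfolding adjoint_range_iff using W12_limit_add[OF L L'] by blast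
  qed
  moreover have "(\<lambda>z. Bicomplex c 0 * F z) \<in> adjoint_range \<Omega> a b" if F: "F \<in> adjoint_range \<Omega> a b" for c F
  proof -
    obtain V X Y \<Phi> where L: "W12_limit \<Omega> V X Y \<Phi>" and FE: "AE z in M. F z = (1/2) *\<^sub>R (X z - bc_j * Y z) + low V z"
      using F unfolding adjoint_range_iff by blast
    have "AE z in M. Bicomplex c 0 * F z
        = (1/2) *\<^sub>R ((Bicomplex c 0 * X z) - bc_j * (Bicomplex c 0 * Y z)) + low (\<lambda>z. Bicomplex c 0 * V z) z"
      using FE
    proof eventually_elim
      case (elim z)
      show ?case unfolding elim low_cmult by (simp add: algebra_simps)
    qed
    thus ?thesis
      unfolding adjoint_range_iff using W12_limit_cmult[OF L] by blast
  qed
  ultimately show ?thesis by (simp add: complex_subspace_def)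
qed

section \<open>Closed range and the decomposition\<close>

lemma adj_Cauchy_limit:
  assumes \<Phi>: "\<And>k n. C_k_compact k \<Omega> (\<Phi> n)" and C: "sq_Cauchy M (\<lambda>n. adj (\<Phi> n))"
  obtains V X Y where "W12_limit \<Omega> V X Y \<Phi>"
proof -
  define q where "q = 1 - 2 * sqrt 2 * K * diameter \<Omega>"
  have q: "q > 0" using K_small by (simp add: q_def)
  \<comment> \<open>The difference is written as a sum with a complex multiple, the form to which
    \<open>adj_add\<close> and \<open>adj_cmult\<close> apply.\<close>
  define D where "D m n = (\<lambda>z. \<Phi> m z + Bicomplex (-1) 0 * \<Phi> n z)" for m n
  have D_eq: "D m n z = \<Phi> m z - \<Phi> n z" for m n z
    by (simp add: D_def bicomplex_eq_iff)
  have lin: "bounded_linear (\<lambda>W. Bicomplex (-1) 0 * W)" by (rule bounded_linear_bicomplex_mult_right)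
  have c: "C_k_compact k \<Omega> (\<lambda>z. Bicomplex (-1) 0 * \<Phi> n z)" for k n
    by (rule C_k_compact_bounded_linear[OF lin \<Phi>])
  have Dc: "C_k_compact k \<Omega> (D m n)" for k m n
    unfolding D_def by (intro C_k_compact_add \<Phi> c)
  note C1 = C_k_compact_C_k[OF \<Phi>[of "Suc 0"]] C_k_compact_C_k[OF c[of "Suc 0"]]
  have adjD: "adj (D m n) z = adj (\<Phi> m) z - adj (\<Phi> n) z" for m n z
    unfolding D_def adj_add[OF C1] adj_cmult[OF C1(1)] by (simp add: bicomplex_eq_iff)
  have pD: "partial_deriv e (D m n) z = partial_deriv e (\<Phi> m) z - partial_deriv e (\<Phi> n) z" for e m n z
    unfolding D_def partial_deriv_add[OF C1] partial_deriv_bounded_linear[OF lin C1(1)]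
    by (simp add: bicomplex_eq_iff)
  \<comment> \<open>Coercivity for the differences turns the Cauchy property of the images into that
    of \<open>bc_d\<close>; \<open>bc_d_bounds\<close> then passes it on to the functions and both
    partial derivatives.\<close>
  have dle: "sq_norm M (bc_d (D m n)) \<le> 1 / q * sq_norm M (\<lambda>z. adj (\<Phi> m) z - adj (\<Phi> n) z)" for m n
    using adj_coercive[OF Dc, of m n] q unfolding q_def[symmetric] adjD[abs_def] by (simp add: field_simps)
  have d: "diameter \<Omega> \<ge> 0"
    using diameter_open_pos[OF open_domain bounded_domain nonempty_domain] by simp
  note bds = bc_d_bounds[OF Dc open_domain bounded_domain nonempty_domain]
  have bd: "sq_norm M F \<le> (B * (1 / q)) * sq_norm M (\<lambda>z. adj (\<Phi> m) z - adj (\<Phi> n) z)"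
    if "sq_norm M F \<le> B * sq_norm M (bc_d (D m n))" "B \<ge> 0" for F :: "complex \<Rightarrow> bicomplex" and B m n
    using order_trans[OF that(1) mult_left_mono[OF dle that(2)]] by (simp only: mult.assoc)
  have "D m n = (\<lambda>z. \<Phi> m z - \<Phi> n z)" for m n
    by (rule ext) (rule D_eq)
  hence "sq_norm M (\<lambda>z. \<Phi> m z - \<Phi> n z) \<le> diameter \<Omega> * sq_norm M (bc_d (D m n))" for m n
    using bds(1)[of m n] by metis
  hence "sq_Cauchy M \<Phi>"
    by (rule_tac sq_Cauchy_bounded_by[OF C, OF bd[OF _ d]])
  then obtain V where V: "sq_integrable M V" "(\<lambda>n. sq_norm M (\<lambda>z. \<Phi> n z - V z)) \<longlonglongrightarrow> 0"
    using sq_complete[of M \<Phi>, OF test_sq[OF \<Phi>[of 0]]] by blast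
  have "sq_Cauchy M (\<lambda>n. partial_deriv 1 (\<Phi> n))"
    by (rule sq_Cauchy_bounded_by[OF C]) (rule bd[OF bds(2)[unfolded pD[abs_def]]]; simp)
  then obtain X where X: "sq_integrable M X" "(\<lambda>n. sq_norm M (\<lambda>z. partial_deriv 1 (\<Phi> n) z - X z)) \<longlonglongrightarrow> 0"
    using sq_complete[of M "\<lambda>n. partial_deriv 1 (\<Phi> n)", OF test_sq[OF C_k_compact_partial[OF \<Phi>[of "Suc 0"]]]] by blast
  have "sq_Cauchy M (\<lambda>n. partial_deriv \<i> (\<Phi> n))"
    by (rule sq_Cauchy_bounded_by[OF C]) (rule bd[OF bds(3)[unfolded pD[abs_def]]]; simp)
  then obtain Y where Y: "sq_integrable M Y" "(\<lambda>n. sq_norm M (\<lambda>z. partial_deriv \<i> (\<Phi> n) z - Y z)) \<longlonglongrightarrow> 0"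
    using sq_complete[of M "\<lambda>n. partial_deriv \<i> (\<Phi> n)", OF test_sq[OF C_k_compact_partial[OF \<Phi>[of "Suc 0"]]]] by blast
  have "W12_limit \<Omega> V X Y \<Phi>"
    using V X Y \<Phi> by (simp add: W12_limit_def)
  thus ?thesis using that by blast
qed

text \<open>The projection is taken onto the closure of the values at test functions, so no
  closedness is presupposed; \<open>adj_Cauchy_limit\<close> shows afterwards that the projection
  lies in the range.\<close>

lemma decomposition:
  assumes F: "sq_integrable M F"
  obtains W G where "W \<in> vekua_bergman \<Omega> a b" "G \<in> adjoint_range \<Omega> a b" "\<And>z. F z = W z + G z"
proof -
  let ?S = "{adj \<phi> | \<phi>. \<forall>k. C_k_compact k \<Omega> \<phi>}"
  have S_sq: "sq_integrable M s" if "s \<in> ?S" for s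
    using that sq_integrable_adj by blast
  have S_add: "(\<lambda>z. s z + t z) \<in> ?S" if "s \<in> ?S" "t \<in> ?S" for s t
  proof -
    from that obtain \<phi> where "s = adj \<phi> \<and> (\<forall>k. C_k_compact k \<Omega> \<phi>)" by blast
    moreover from that obtain \<psi> where "t = adj \<psi> \<and> (\<forall>k. C_k_compact k \<Omega> \<psi>)" by blast
    ultimately have *: "s = adj \<phi>" "t = adj \<psi>" "\<And>k. C_k_compact k \<Omega> \<phi>" "\<And>k. C_k_compact k \<Omega> \<psi>"
      by auto
    have "(\<lambda>z. s z + t z) = adj (\<lambda>z. \<phi> z + \<psi> z)"
      unfolding *(1,2) adj_add[OF C_k_compact_C_k[OF *(3)[of "Suc 0"]] C_k_compact_C_k[OF *(4)[of "Suc 0"]], abs_def] ..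
    thus ?thesis using C_k_compact_add[OF *(3,4)] by blast
  qed
  have S_scale: "(\<lambda>z. c *\<^sub>R s z) \<in> ?S" if "s \<in> ?S" for s c
  proof -
    from that obtain \<phi> where "s = adj \<phi> \<and> (\<forall>k. C_k_compact k \<Omega> \<phi>)" by blast
    hence *: "s = adj \<phi>" "\<And>k. C_k_compact k \<Omega> \<phi>" by auto
    have "c *\<^sub>R W = Bicomplex (of_real c) 0 * W" for W
      by (simp add: bicomplex_eq_iff scaleR_conv_of_real[where 'a=complex])
    hence "(\<lambda>z. c *\<^sub>R s z) = adj (\<lambda>z. Bicomplex (of_real c) 0 * \<phi> z)"
      unfolding *(1) adj_cmult[OF C_k_compact_C_k[OF *(2)[of "Suc 0"]], abs_def] by simp
    thus ?thesis using C_k_compact_bounded_linear[OF bounded_linear_bicomplex_mult_right *(2)] by blast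
  qed
  have S_0: "(\<lambda>z. 0) \<in> ?S"
  proof -
    have "C_k_compact k \<Omega> (\<lambda>z. 0 :: bicomplex)" for k
      by (auto simp: C_k_compact_def C_k_const intro!: exI[of _ "{}"])
    hence "adj (\<lambda>z. 0) \<in> ?S" by blast
    from S_scale[OF this, of 0] show ?thesis by simp
  qed
  obtain g G where g: "\<And>n. g n \<in> ?S" and G: "sq_integrable M G" and C: "sq_Cauchy M g"
    and lim: "(\<lambda>n. sq_norm M (\<lambda>x. g n x - G x)) \<longlonglongrightarrow> 0"
    and orth: "\<And>s. s \<in> ?S \<Longrightarrow> (\<integral>x. (F x - G x) \<bullet> s x \<partial>M) = 0"
    using sq_projection[of ?S M F, OF S_sq S_0 S_add S_scale F] by blast
  have "\<forall>n. \<exists>\<phi>. g n = adj \<phi> \<and> (\<forall>k. C_k_compact k \<Omega> \<phi>)" using g by blast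
  then obtain \<Phi> where g_eq: "\<And>n. g n = adj (\<Phi> n)" and \<Phi>: "\<And>k n. C_k_compact k \<Omega> (\<Phi> n)"
    by metis
  obtain V X Y where L: "W12_limit \<Omega> V X Y \<Phi>"
    using adj_Cauchy_limit[of \<Phi>, OF \<Phi>] C unfolding g_eq[abs_def] by blast
  let ?G = "\<lambda>z. (1/2) *\<^sub>R (X z - bc_j * Y z) + low V z"
  have Gi: "sq_integrable M ?G" by (rule sq_integrable_limit_value[OF L])
  \<comment> \<open>\<open>G\<close> and the value \<open>?G\<close> at the Sobolev limit are both
    limits of the same sequence \<open>g n\<close>, so they agree almost everywhere.\<close>
  have "(\<lambda>n. 0) \<longlonglongrightarrow> sq_norm M (\<lambda>z. G z - ?G z)"
  proof -
    have gi: "sq_integrable M (g n)" for n using S_sq[OF g] .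
    have "(\<lambda>n. sq_norm M (\<lambda>z. G z - ?G z)) \<longlonglongrightarrow> 0"
    proof (rule tendsto_0_squeeze)
      show "(\<lambda>n. sq_norm M (\<lambda>x. g n x - G x) + sq_norm M (\<lambda>z. g n z - ?G z)) \<longlonglongrightarrow> 0"
        using tendsto_add[OF lim W12_limit_adj[OF L]] unfolding g_eq by simp
      show "sq_norm M (\<lambda>z. G z - ?G z) \<le> sq_norm M (\<lambda>x. g n x - G x) + sq_norm M (\<lambda>z. g n z - ?G z)" for n
        using sq_norm_triangle3[OF G gi Gi, of n] unfolding sq_norm_minus_commute[of M G "g n"] .
    qed simp
    thus ?thesis by (simp add: LIMSEQ_const_iff)
  qed
  hence "sq_norm M (\<lambda>z. G z - ?G z) = 0" by (simp add: LIMSEQ_const_iff)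
  from sq_norm_eq_0_imp_AE[OF sq_integrable_diff[OF G Gi] this]
  have "AE z in M. G z = ?G z" by (auto elim!: eventually_mono)
  hence "G \<in> adjoint_range \<Omega> a b"
    unfolding adjoint_range_iff using L by blast
  moreover have "(\<lambda>z. F z - G z) \<in> vekua_bergman \<Omega> a b"
  proof (rule vekua_bergmanI_orthogonal)
    show Wi: "sq_integrable M (\<lambda>z. F z - G z)" by (rule sq_integrable_diff[OF F G])
    fix \<phi> :: "complex \<Rightarrow> bicomplex" assume \<phi>: "\<And>k. C_k_compact k \<Omega> \<phi>"
    have "integrable M (\<lambda>z. bc_inner (F z - G z) (adj \<phi> z))"
      by (rule sq_integrable_bilinear[OF bc_inner_bounded_bilinear sq_integrable_adj[OF \<phi>] Wi])
    \<comment> \<open>The projection is orthogonal for the real inner product, the real part of the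
      complex one, and no more than this is asked for by
      \<open>vekua_bergmanI_orthogonal\<close>.\<close>
    hence "Re (bc_L2_inner \<Omega> (\<lambda>z. F z - G z) (adj \<phi>)) = (\<integral>x. (F x - G x) \<bullet> adj \<phi> x \<partial>M)"
      by (simp add: bc_L2_inner_def inner_bicomplex_eq_Re)
    also have "\<dots> = 0" using \<phi> by (intro orth) blast
    finally show "Re (bc_L2_inner \<Omega> (\<lambda>z. F z - G z) (adj \<phi>)) = 0" .
  qed
  ultimately show ?thesis using that by simp
qed

text \<open>The difference of the first components equals, almost everywhere, a difference of second
  components, so it belongs to both mutually orthogonal spaces and is orthogonal to itself.\<close>

lemma decomposition_unique:
  assumes W: "W \<in> vekua_bergman \<Omega> a b" "W' \<in> vekua_bergman \<Omega> a b"
    and G: "G \<in> adjoint_range \<Omega> a b" "G' \<in> adjoint_range \<Omega> a b"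
    and eq: "AE z in M. W z + G z = W' z + G' z"
  shows "AE z in M. W' z = W z" "AE z in M. G' z = G z"
proof -
  let ?D = "\<lambda>z. W' z - W z" and ?H = "\<lambda>z. G z - G' z"
  have D: "?D \<in> vekua_bergman \<Omega> a b"
    using complex_subspace_diff[OF complex_subspace_vekua_bergman] W by blast
  have H: "?H \<in> adjoint_range \<Omega> a b"
    using complex_subspace_diff[OF complex_subspace_adjoint_range] G by blast
  have Di: "sq_integrable M ?D" using D by (simp add: vekua_bergman_iff)
  have DH: "AE z in M. ?D z = ?H z"
    using eq by eventually_elim (simp add: algebra_simps)
  have "bc_L2_inner \<Omega> ?D ?D = 0"
    using bc_L2_inner_AE_cong[OF Di Di adjoint_range_sq_integrable[OF H] DH] vekua_bergman_orthogonal[OF D H] by simp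
  hence "complex_of_real (\<integral>z. (norm (?D z))\<^sup>2 \<partial>M) = 0"
    unfolding bc_L2_inner_def bc_inner_self by (simp only: integral_complex_of_real)
  hence "sq_norm M ?D = 0" by (simp add: sq_norm_def)
  from sq_norm_eq_0_imp_AE[OF Di this] show 1: "AE z in M. W' z = W z"
    by (auto elim!: eventually_mono)
  show "AE z in M. G' z = G z"
    using 1 eq by eventually_elim simp
qed

theorem orthogonal_decomposition: "L2_orthogonal_sum \<Omega> (vekua_bergman \<Omega> a b) (adjoint_range \<Omega> a b)"
  unfolding L2_orthogonal_sum_def
proof (intro conjI ballI)
  show "vekua_bergman \<Omega> a b \<subseteq> bc_valued (L2 \<Omega>)" by (auto simp: vekua_bergman_def)
  show "adjoint_range \<Omega> a b \<subseteq> bc_valued (L2 \<Omega>)"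
    using adjoint_range_sq_integrable by (auto simp: bc_valued_L2_iff)
  show "bc_L2_inner \<Omega> W G = 0" if "W \<in> vekua_bergman \<Omega> a b" "G \<in> adjoint_range \<Omega> a b" for W G
    using that by (rule vekua_bergman_orthogonal)
next
  fix F assume "F \<in> bc_valued (L2 \<Omega>)"
  then obtain W G where *: "W \<in> vekua_bergman \<Omega> a b" "G \<in> adjoint_range \<Omega> a b" "\<And>z. F z = W z + G z"
    using decomposition by (metis bc_valued_L2_iff)
  show "\<exists>W\<in>vekua_bergman \<Omega> a b. \<exists>G\<in>adjoint_range \<Omega> a b. (AE z in M. F z = W z + G z) \<and>
      (\<forall>W'\<in>vekua_bergman \<Omega> a b. \<forall>G'\<in>adjoint_range \<Omega> a b. (AE z in M. F z = W' z + G' z) \<longrightarrow>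
        (AE z in M. W' z = W z) \<and> (AE z in M. G' z = G z))"
  proof (intro bexI[OF _ *(1)] bexI[OF _ *(2)] conjI ballI impI)
    fix W' G' assume **: "W' \<in> vekua_bergman \<Omega> a b" "G' \<in> adjoint_range \<Omega> a b" "AE z in M. F z = W' z + G' z"
    have "AE z in M. W z + G z = W' z + G' z" using **(3) by (simp add: *(3))
    from decomposition_unique[OF *(1) **(1) *(2) **(2) this]
    show "AE z in M. W' z = W z" "AE z in M. G' z = G z" .
  qed (simp add: *(3))
qed (rule complex_subspace_vekua_bergman complex_subspace_adjoint_range)+

end

theorem theorem37:
  fixes \<Omega> :: "complex set" and a b :: "complex \<Rightarrow> bicomplex"
  assumes "open \<Omega>" and "connected \<Omega>" and "\<Omega> \<noteq> {}"
    and "bounded \<Omega>" and "simply_connected \<Omega>"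
    and "liapunov_curve (frontier \<Omega>)"
    and "a \<in> bc_valued (L_infty \<Omega>)" and "b \<in> bc_valued (L_infty \<Omega>)"
    and "max (bc_L_infty_norm \<Omega> a) (bc_L_infty_norm \<Omega> b) < ereal (1 / (2 * sqrt 2 * diameter \<Omega>))"
  shows "L2_orthogonal_sum \<Omega> (vekua_bergman \<Omega> a b) (adjoint_range \<Omega> a b)"
proof -
  have d: "diameter \<Omega> > 0" using diameter_open_pos assms(1,3,4) by blast
  \<comment> \<open>The strict inequality leaves room for a real number between the extended real
    norms and the threshold.\<close>
  obtain k where k: "max (bc_L_infty_norm \<Omega> a) (bc_L_infty_norm \<Omega> b) < ereal k"
    "ereal k < ereal (1 / (2 * sqrt 2 * diameter \<Omega>))"
    using ereal_dense2[OF assms(9)] by blast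
  \<comment> \<open>The maximum with 0 gives the required sign directly, without an argument that
    the essential suprema are nonnegative; the threshold is positive, so the upper bound is
    kept.\<close>
  define K where "K = max 0 k"
  have "k < 1 / (2 * sqrt 2 * diameter \<Omega>)" using k(2) by simp
  hence "K < 1 / (2 * sqrt 2 * diameter \<Omega>)" using d by (simp add: K_def)
  hence small: "2 * sqrt 2 * K * diameter \<Omega> < 1" using d by (simp add: field_simps)
  have le: "AE z in lebesgue_on \<Omega>. norm (f z) \<le> K" if "bc_L_infty_norm \<Omega> f < ereal k" for f
    using esssup_AE[of "\<lambda>z. ereal (norm (f z))" "lebesgue_on \<Omega>"]
  proof eventually_elim
    case (elim z)
    hence "ereal (norm (f z)) < ereal k"
      using that unfolding bc_L_infty_norm_def by (rule le_less_trans)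
    thus ?case by (simp add: K_def)
  qed
  interpret vekua_coefficients \<Omega> a b K
  proof
    show "a \<in> borel_measurable (lebesgue_on \<Omega>)" "b \<in> borel_measurable (lebesgue_on \<Omega>)"
      using assms(7,8) by (auto simp: bc_valued_def L_infty_def borel_measurable_bicomplex_iff)
    show "AE z in lebesgue_on \<Omega>. norm (a z) \<le> K" "AE z in lebesgue_on \<Omega>. norm (b z) \<le> K"
      using k(1) by (auto intro!: le)
    show "0 \<le> K" by (simp add: K_def)
  qed (use assms small in auto)
  show ?thesis by (rule orthogonal_decomposition)
qed

end
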